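(* For almost all positive integers $n$, $$f_2(n)=\left(\frac{2}{1-\gamma}+o(1)\right)\log n=(4.730544237\ldots+o(1))\log n .$$ That is, $\frac{2}{1-\gamma}=4.730544237\ldots$, and for every $\eta>0$ the set of integers $n\ge 2$ such that either $f_2(n)=\infty$ or $\left|\frac{f_2(n)}{\log n}-\frac{2}{1-\gamma}\right|>\eta$ has natural density zero.
   Context: All logarithms are natural, and $\gamma$ is the Euler–Mascheroni constant. For a prime $p$, $\nu_p$ denotes the $p$-adic valuation. For integers $0\le k\le n$ define $u(n,k):=\prod_{p\le k}p^{\nu_p\binom nk}$ (product over primes $p\le k$), i.e. the largest divisor of $\binom nk$ all of whose prime factors are at most $k$. Define $f_2(n):=\min\{0\le k\le n:\ u(n,k)>n^2\}$ ($k$ an integer), with $f_2(n)=\infty$ if this set is empty. *)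

theory Defs
  imports
    "HOL-Analysis.Analysis"
    "HOL-Computational_Algebra.Primes"
    "HOL-Library.Extended_Nat"
begin

definition u :: "nat \<Rightarrow> nat \<Rightarrow> nat" where
  "u n k = (\<Prod>p | prime p \<and> p \<le> k. p ^ multiplicity p (n choose k))"

text \<open>The infimum of the empty set in \<^typ>\<open>enat\<close> is \<open>\<infinity>\<close>; the infimum of a nonempty set is
  its minimum.\<close>

definition f2 :: "nat \<Rightarrow> enat" where
  "f2 n = (INF k \<in> {k. k \<le> n \<and> u n k > n ^ 2}. enat k)"

definition has_natural_density :: "nat set \<Rightarrow> real \<Rightarrow> bool" where
  "has_natural_density A d \<longleftrightarrow>
     (\<lambda>N. real (card (A \<inter> {1..N})) / real N) \<longlonglongrightarrow> d"

end

theory Submission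
  imports Defs
    "HOL-Complex_Analysis.Complex_Analysis"
    "HOL-Real_Asymp.Real_Asymp"
    "HOL-Number_Theory.Prime_Powers"
    "HOL-Number_Theory.Cong"
begin

text \<open>By Kummer's theorem, $\ln u(n,k)$ is the sum of $\Lambda(q)$ over the prime powers $q = p^j \le n$ with
  $p \le k$ and $n \bmod q < k \bmod q$. For random $n$ the terms with $q \le k$ have mean
  $\sum_{q \le k} \Lambda(q)\,(k \bmod q)/q = k \sum_{q \le k} \Lambda(q)/q - \ln k!$, which is $(1-\gamma+o(1))\,k$ by the prime
  number theorem in the form $\sum_{q \le k} \Lambda(q)/q = \ln k - \gamma + o(1)$; the terms with $q > k$ have mean $o(k)$
  because they are proper prime powers. A second moment bound shows that $\ln u(n,k)$ is concentrated
  around $(1-\gamma) k$, so it crosses $2 \ln n$ near $k = 2 \ln n / (1-\gamma)$. The prime number theorem is obtained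
  by Newman's contour argument, applied to the partial sums of $(\Lambda(q) - 1)/q$, followed by a
  Tauberian step.\<close>

section \<open>Numerical bounds for the Euler--Mascheroni constant\<close>

text \<open>The two halves of the claim differ in difficulty. For the upper bound on
  \<open>f2 n\<close> a single k with \<open>u n k > n ^ 2\<close> is enough; for the lower bound
  all smaller k have to fail simultaneously, so exceptional sets must be controlled uniformly in k.
  The cut-off K is tied to N and not to n, with K of order ln N: one family of moduli then serves
  all n up to N, errors such as K^4 are harmless against N, and the bad sets become families indexed
  by N. For a fixed theta < 1 the n below N^theta form a negligible set, and for all others ln n
  lies between theta ln N and ln N. The constant -gamma in the prime number theorem arises as -2
  gamma + gamma. The first part is the value at z = 0 of -(zeta'/zeta)(1+z) - zeta(1+z), whose poles
  cancel; the second comes from the harmonic numbers that are subtracted. No rate of convergence is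
  used anywhere, so nonvanishing on the line Re s = 1 is all that is required of zeta.\<close>

lemma nonneg_if_antimono_tendsto_0:
  fixes g g' :: "real \<Rightarrow> real"
  assumes der: "\<And>x. x \<ge> 1 \<Longrightarrow> (g has_real_derivative g' x) (at x)"
    and neg: "\<And>x. x \<ge> 1 \<Longrightarrow> g' x \<le> 0"
    and lim: "(g \<longlongrightarrow> 0) at_top" and x: "x \<ge> 1"
  shows "g x \<ge> 0"
proof (rule tendsto_upperbound[OF lim])
  have "g y \<le> g x" if "y \<ge> x" for y
    by (rule DERIV_nonpos_imp_nonincreasing[OF that]) (use der neg x in \<open>meson order_trans\<close>)
  then show "\<forall>\<^sub>F y in at_top. g y \<le> g x"
    by (auto simp: eventually_at_top_linorder)
qed auto

text \<open>\<open>e\<close> is the Euler-Maclaurin expansion of harm n - ln n - gamma, cut after a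
  positive term. With this cut \<open>h\<close> increases to its limit gamma, so each of its values
  is a lower bound.\<close>

lemma euler_mascheroni_ge_4th_order:
  fixes n :: nat
  assumes n: "n > 0"
  shows "harm n - ln n - 1/(2*n) + 1/(12*n^2) - 1/(120*n^4) \<le> (euler_mascheroni :: real)"
proof -
  define e :: "real \<Rightarrow> real" where "e x = 1/(2*x) - 1/(12*x^2) + 1/(120*x^4)" for x
  \<comment> \<open>The increment h (n + 1) - h n of the sequence \<open>h\<close> below, taken at
    real arguments so that calculus applies; it is nonnegative because it decreases to 0.\<close>
  define g where "g x = 1/(x+1) - ln (x+1) + ln x - e (x+1) + e x" for x :: real
  have g0: "g x \<ge> 0" if "x \<ge> 1" for x
  proof (rule nonneg_if_antimono_tendsto_0[OF _ _ _ that])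
    fix x :: real assume x: "x \<ge> 1"
    have e: "(e has_real_derivative -1/(2*y^2) + 1/(6*y^3) - 1/(30*y^5)) (at y)" if "y > 0" for y
      unfolding e_def using that
      by (auto intro!: derivative_eq_intros) (simp add: divide_simps eval_nat_numeral)
    have e1: "((\<lambda>x. e (x + 1)) has_real_derivative -1/(2*(x+1)^2) + 1/(6*(x+1)^3) - 1/(30*(x+1)^5)) (at x)"
      using e[of "x+1"] x by (simp add: DERIV_shift)
    have *: "(g has_real_derivative -1/(x+1)^2 - 1/(x+1) + 1/x - (-1/(2*(x+1)^2) + 1/(6*(x+1)^3) - 1/(30*(x+1)^5)) + (-1/(2*x^2) + 1/(6*x^3) - 1/(30*x^5))) (at x)"
      unfolding g_def using x
      by (auto intro!: derivative_eq_intros e e1 simp: power2_eq_square)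
    \<comment> \<open>The lower-order terms cancel; what remains is minus a fraction with positive
      coefficients, which makes the sign evident.\<close>
    have "-1/(x+1)^2 - 1/(x+1) + 1/x - (-1/(2*(x+1)^2) + 1/(6*(x+1)^3) - 1/(30*(x+1)^5)) + (-1/(2*x^2) + 1/(6*x^3) - 1/(30*x^5)) = - ((1 + 5*x + 5*x^2) / (30 * x^5 * (x+1)^5))"
      using x by (simp add: divide_simps) algebra
    with * show "(g has_real_derivative - ((1 + 5*x + 5*x^2) / (30 * x^5 * (x+1)^5))) (at x)" by simp
    show "- ((1 + 5*x + 5*x^2) / (30 * x^5 * (x+1)^5)) \<le> 0" using x by simp
  next
    show "(g \<longlongrightarrow> 0) at_top" unfolding g_def e_def by real_asymp
  qed
  define h where "h n = harm n - ln (real n) - e n" for n :: nat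
  have inc: "h n \<le> h (Suc n)" if "n > 0" for n
    using g0[of n] that by (simp add: h_def g_def harm_Suc inverse_eq_divide add.commute)
  have lim: "h \<longlonglongrightarrow> euler_mascheroni - 0"
    unfolding h_def
    by (intro tendsto_diff euler_mascheroni_LIMSEQ) (unfold e_def, real_asymp)
  have "h n \<le> h (n + k)" for k
  proof (induction k)
    case (Suc k)
    then show ?case using inc[of "n + k"] n by simp
  qed simp
  then have "h n \<le> h m" if "m \<ge> n" for m
    using le_Suc_ex that by blast
  then have "h n \<le> euler_mascheroni"
    by (intro tendsto_lowerbound[OF lim[simplified]]) (auto simp: eventually_sequentially)
  then show ?thesis by (simp add: h_def e_def)
qed

text \<open>Keeping one more term of the same expansion, a negative one, reverses the monotonicity,
  so the two estimates enclose gamma.\<close>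

lemma euler_mascheroni_le_6th_order:
  fixes n :: nat
  assumes n: "n > 0"
  shows "(euler_mascheroni :: real) \<le> harm n - ln n - 1/(2*n) + 1/(12*n^2) - 1/(120*n^4) + 1/(252*n^6)"
proof -
  define e :: "real \<Rightarrow> real" where "e x = 1/(2*x) - 1/(12*x^2) + 1/(120*x^4) - 1/(252*x^6)" for x
  define g where "g x = - (1/(x+1) - ln (x+1) + ln x - e (x+1) + e x)" for x :: real
  have g0: "g x \<ge> 0" if "x \<ge> 1" for x
  proof (rule nonneg_if_antimono_tendsto_0[OF _ _ _ that])
    fix x :: real assume x: "x \<ge> 1"
    have e: "(e has_real_derivative -1/(2*y^2) + 1/(6*y^3) - 1/(30*y^5) + 1/(42*y^7)) (at y)" if "y > 0" for y
      unfolding e_def using that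
      by (auto intro!: derivative_eq_intros) (simp add: divide_simps eval_nat_numeral)
    have e1: "((\<lambda>x. e (x + 1)) has_real_derivative -1/(2*(x+1)^2) + 1/(6*(x+1)^3) - 1/(30*(x+1)^5) + 1/(42*(x+1)^7)) (at x)"
      using e[of "x+1"] x by (simp add: DERIV_shift)
    have *: "(g has_real_derivative -(-1/(x+1)^2 - 1/(x+1) + 1/x - (-1/(2*(x+1)^2) + 1/(6*(x+1)^3) - 1/(30*(x+1)^5) + 1/(42*(x+1)^7)) + (-1/(2*x^2) + 1/(6*x^3) - 1/(30*x^5) + 1/(42*x^7)))) (at x)"
      unfolding g_def using x
      by (auto intro!: derivative_eq_intros e e1 simp: power2_eq_square)
    have "-(-1/(x+1)^2 - 1/(x+1) + 1/x - (-1/(2*(x+1)^2) + 1/(6*(x+1)^3) - 1/(30*(x+1)^5) + 1/(42*(x+1)^7)) + (-1/(2*x^2) + 1/(6*x^3) - 1/(30*x^5) + 1/(42*x^7))) = - ((5 + 35*x + 98*x^2 + 126*x^3 + 63*x^4) / (210 * x^7 * (x+1)^7))"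
      using x by (simp add: divide_simps) algebra
    with * show "(g has_real_derivative - ((5 + 35*x + 98*x^2 + 126*x^3 + 63*x^4) / (210 * x^7 * (x+1)^7))) (at x)" by simp
    show "- ((5 + 35*x + 98*x^2 + 126*x^3 + 63*x^4) / (210 * x^7 * (x+1)^7)) \<le> 0" using x by simp
  next
    show "(g \<longlongrightarrow> 0) at_top" unfolding g_def e_def by real_asymp
  qed
  define h where "h n = harm n - ln (real n) - e n" for n :: nat
  have dec: "h (Suc n) \<le> h n" if "n > 0" for n
    using g0[of n] that by (simp add: h_def g_def harm_Suc inverse_eq_divide add.commute)
  have lim: "h \<longlonglongrightarrow> euler_mascheroni - 0"
    unfolding h_def
    by (intro tendsto_diff euler_mascheroni_LIMSEQ) (unfold e_def, real_asymp)
  have "h (n + k) \<le> h n" for k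
  proof (induction k)
    case (Suc k)
    then show ?case using dec[of "n + k"] n by simp
  qed simp
  then have "h m \<le> h n" if "m \<ge> n" for m
    using le_Suc_ex that by blast
  then have "euler_mascheroni \<le> h n"
    by (intro tendsto_upperbound[OF lim[simplified]]) (auto simp: eventually_sequentially)
  then show ?thesis by (simp add: h_def e_def)
qed

text \<open>At n = 32 the two estimates differ by 1/(252 * 32^6), less than 4e-12, and ln 32 = 5 ln
  2 requires only one logarithm. This precision is called for because x -> 2/(1 - x) magnifies
  errors about elevenfold.\<close>

lemma euler_mascheroni_bounds_10_digits:
  "(euler_mascheroni :: real) \<in> {0.57721566489..0.57721566495}"
proof -
  have "ln (32::real) = real (5::nat) * ln 2" by (subst ln_realpow[symmetric]) simp_all
  moreover have "ln (2::real) \<in> {0.69314718055994..0.69314718055995}"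
    using ln_approx_bounds[of 2 14] by (simp add: eval_nat_numeral)
  ultimately show ?thesis
    using euler_mascheroni_ge_4th_order[of 32] euler_mascheroni_le_6th_order[of 32]
    by (simp add: harm_expand)
qed

lemma two_over_one_minus_gamma_bounds:
  "4.730544237 \<le> 2 / (1 - (euler_mascheroni :: real))"
  "2 / (1 - (euler_mascheroni :: real)) < 4.730544238"
  using euler_mascheroni_bounds_10_digits by (auto simp: field_simps)

section \<open>Chebyshev and Mertens estimates\<close>

definition psi :: "nat \<Rightarrow> real" where
  "psi n = (\<Sum>d=1..n. mangoldt d)"

lemma psi_mono: "m \<le> n \<Longrightarrow> psi m \<le> psi n"
  unfolding psi_def by (intro sum_mono2) (auto intro: mangoldt_nonneg)

lemma psi_nonneg: "psi n \<ge> 0"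
  unfolding psi_def by (intro sum_nonneg mangoldt_nonneg)

lemma card_multiples: "d > 0 \<Longrightarrow> card {m \<in> {1..n}. d dvd m} = n div (d::nat)"
proof -
  assume d: "d > 0"
  have "{m \<in> {1..n}. d dvd m} = (\<lambda>k. d * k) ` {1..n div d}"
    using d by (auto simp: less_eq_div_iff_mult_less_eq mult.commute elim!: dvdE)
  also have "card \<dots> = n div d"
    using d by (subst card_image) (auto simp: inj_on_def)
  finally show ?thesis .
qed

text \<open>Double counting of the pairs \<open>d dvd m\<close>. The bound \<open>N\<close> may
  exceed \<open>n\<close>, the extra terms being 0, so that factorials of different arguments can be
  expanded over one range and combined term by term.\<close>

lemma sum_divisor_sum:
  fixes g h :: "nat \<Rightarrow> real"
  assumes "\<And>m. m \<in> {1..n} \<Longrightarrow> g m = (\<Sum>d | d dvd m. h d)" and "n \<le> N"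
  shows "(\<Sum>m=1..n. g m) = (\<Sum>d=1..N. h d * real (n div d))"
proof -
  have "(\<Sum>m=1..n. g m) = (\<Sum>m=1..n. \<Sum>d=1..N. if d dvd m then h d else 0)"
  proof (rule sum.cong [OF refl])
    fix m assume m: "m \<in> {1..n}"
    then have "{d. d dvd m} = {d \<in> {1..N}. d dvd m}"
      using assms by (auto dest: dvd_imp_le intro: Nat.gr0I simp: Suc_le_eq)
    then show "g m = (\<Sum>d=1..N. if d dvd m then h d else 0)"
      unfolding assms(1)[OF m] by (simp only: sum.inter_filter finite_atLeastAtMost)
  qed
  also have "\<dots> = (\<Sum>d=1..N. \<Sum>m=1..n. if d dvd m then h d else 0)"
    by (rule sum.swap)
  also have "\<dots> = (\<Sum>d=1..N. h d * real (n div d))"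
  proof (rule sum.cong [OF refl])
    fix d assume d: "d \<in> {1..N}"
    have "(\<Sum>m=1..n. if d dvd m then h d else 0) = (\<Sum>m\<in>{m\<in>{1..n}. d dvd m}. h d)"
      by (simp only: sum.inter_filter finite_atLeastAtMost)
    also have "\<dots> = h d * real (n div d)"
      unfolding sum_constant using d by (subst card_multiples) auto
    finally show "(\<Sum>m=1..n. if d dvd m then h d else 0) = h d * real (n div d)" .
  qed
  finally show ?thesis .
qed

lemma ln_fact_eq_sum_mangoldt:
  assumes "n \<le> N"
  shows "ln (fact n :: real) = (\<Sum>d=1..N. mangoldt d * real (n div d))"
proof -
  have "ln (fact n :: real) = (\<Sum>m=1..n. ln (real m))"
    unfolding fact_prod of_nat_prod by (subst ln_prod) auto
  also have "\<dots> = (\<Sum>d=1..N. mangoldt d * real (n div d))"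
  proof (rule sum_divisor_sum[OF _ assms])
    fix m assume "m \<in> {1..n}"
    then show "ln (real m) = (\<Sum>d | d dvd m. mangoldt d)"
      using mangoldt_sum[of m, where 'a = real] by simp
  qed
  finally show ?thesis .
qed

text \<open>Chebyshev's argument: the coefficient floor(2m/d) - 2 floor(m/d) is never negative and
  is at least 1 for m < d <= 2m, so the difference is at most the logarithm of the central binomial
  coefficient.\<close>

lemma psi_double: "psi (2 * m) - psi m \<le> 2 * ln 2 * m"
proof -
  have "psi (2*m) - psi m = (\<Sum>d\<in>{m<..2*m}. mangoldt d)"
    unfolding psi_def by (subst sum_diff [symmetric]) (auto intro!: sum.cong)
  also have "\<dots> \<le> (\<Sum>d\<in>{m<..2*m}. mangoldt d * (real (2*m div d) - 2 * real (m div d)))"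
  proof (intro sum_mono)
    fix d assume d: "d \<in> {m<..2*m}"
    then have "m div d = 0" "1 \<le> 2 * m div d" by (auto simp: less_eq_div_iff_mult_less_eq)
    then show "mangoldt d \<le> mangoldt d * (real (2*m div d) - 2 * real (m div d))"
      using mult_left_mono[OF _ mangoldt_nonneg, of 1 "real (2*m div d)" d] by simp
  qed
  also have "\<dots> \<le> (\<Sum>d=1..2*m. mangoldt d * (real (2*m div d) - 2 * real (m div d)))"
  proof (intro sum_mono2 mult_nonneg_nonneg mangoldt_nonneg)
    fix d
    have "2 * (m div d) \<le> 2 * m div d"
      by (cases "d = 0") (auto simp: less_eq_div_iff_mult_less_eq)
    then show "0 \<le> real (2*m div d) - 2 * real (m div d)" by linarith
  qed auto
  also have "\<dots> = ln (fact (2*m)) - 2 * ln (fact m)"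
    using ln_fact_eq_sum_mangoldt[of "2*m" "2*m"] ln_fact_eq_sum_mangoldt[of m "2*m"]
    by (simp add: right_diff_distrib sum_subtractf sum_distrib_left mult_ac)
  also have "\<dots> = ln (real (2*m choose m))"
    using binomial_fact[of m "2*m", where 'a = real] by (simp add: ln_div ln_mult)
  also have "\<dots> \<le> ln (2 ^ (2*m))"
  proof (subst ln_le_cancel_iff)
    have "2*m choose m \<le> 2 ^ (2*m)" by (rule binomial_le_pow2)
    then show "real (2*m choose m) \<le> 2 ^ (2*m)"
      by (metis of_nat_le_iff of_nat_numeral of_nat_power)
  qed (auto simp: zero_less_binomial)
  also have "\<dots> = 2 * ln 2 * m" by (subst ln_realpow) auto
  finally show ?thesis .
qed

lemma psi_le: "psi n \<le> 4 * n"
proof -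
  have pow: "psi (2^k) \<le> 2 * ln 2 * 2^k" for k
  proof (induction k)
    case (Suc k)
    then show ?case using psi_double[of "2^k"] by simp
  qed (simp add: psi_def)
  show ?thesis
  proof (cases "n = 0")
    case False
    \<comment> \<open>The least power of two that is at least \<open>n\<close> is at most 2n; with
      ln 2 < 1 this turns 2 ln 2 into the constant 4.\<close>
    define k where "k = (LEAST k. n \<le> 2^k)"
    have k: "n \<le> 2^k" unfolding k_def by (rule LeastI[of _ n]) (simp add: less_imp_le)
    have "2^k \<le> 2 * n"
    proof (cases k)
      case 0 then show ?thesis using False by simp
    next
      case (Suc j)
      have "\<not> n \<le> 2^j"
        using not_less_Least[of j "\<lambda>k. n \<le> 2^k"] Suc by (simp flip: k_def)
      then show ?thesis using Suc by simp
    qed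
    then have "real (2^k) \<le> real (2 * n)" by (simp only: of_nat_le_iff)
    then have "(2::real)^k \<le> 2 * n" by simp
    have "psi n \<le> psi (2^k)" by (rule psi_mono[OF k])
    also have "\<dots> \<le> 2 * ln 2 * 2^k" by (rule pow)
    also have "\<dots> \<le> 2 * 1 * real (2 * n)"
      using ln_2_less_1 \<open>(2::real)^k \<le> 2 * n\<close> by (intro mult_mono) auto
    finally show ?thesis by simp
  qed (simp add: psi_def)
qed

text \<open>A weak Stirling formula; the induction rests on n ln(1 + 1/n) <= 1 <= (n + 1) ln(1 +
  1/n). The gap ln n + 1 is o(n), which suffices after division by n.\<close>

lemma ln_fact_bounds:
  assumes "n > 0"
  shows "ln (fact n :: real) \<ge> n * ln n - n" "ln (fact n :: real) \<le> n * ln n - n + ln n + 1"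
proof -
  have "ln (fact n :: real) \<ge> n * ln n - n \<and> ln (fact n :: real) \<le> n * ln n - n + ln n + 1"
    using assms
  proof (induction n rule: nat_induct_non_zero)
    case (Suc n)
    define a where "a = ln (1 + 1 / real n)"
    have pos: "0 < 1 + 1 / real n" by (simp add: add_pos_nonneg)
    have lnS: "ln (real (Suc n)) = ln n + a"
      using Suc.hyps ln_mult_pos[of "real n" "1 + 1/n"] pos by (simp add: a_def distrib_left add.commute)
    have a1: "n * a \<le> 1"
      using ln_add_one_self_le_self[of "1 / real n"] Suc.hyps by (simp add: a_def field_simps)
    have "ln (1 / (1 + 1 / real n)) \<le> 1 / (1 + 1 / real n) - 1"
      using Suc.hyps by (intro ln_le_minus_one) (auto simp: field_simps add_pos_pos)
    also have "ln (1 / (1 + 1 / real n)) = - a"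
      by (simp add: a_def ln_div add_pos_nonneg)
    finally have a2: "(n + 1) * a \<ge> 1"
      using Suc.hyps by (simp add: field_simps)
    have f: "ln (fact (Suc n) :: real) = ln (real (Suc n)) + ln (fact n)"
      by (simp add: ln_mult del: of_nat_Suc)
    show ?case unfolding f using Suc.IH a1 a2 lnS by (simp add: algebra_simps)
  qed simp
  then show "ln (fact n :: real) \<ge> n * ln n - n" "ln (fact n :: real) \<le> n * ln n - n + ln n + 1"
    by auto
qed

definition mangoldt_harm :: "nat \<Rightarrow> real" where
  "mangoldt_harm n = (\<Sum>d=1..n. mangoldt d / d)"

lemma mangoldt_harm_mono: "m \<le> n \<Longrightarrow> mangoldt_harm m \<le> mangoldt_harm n"
  unfolding mangoldt_harm_def by (intro sum_mono2) (auto intro!: mangoldt_nonneg divide_nonneg_nonneg)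

text \<open>Insert n mod d = n - d * (n div d). The identity serves twice: estimated trivially it
  yields Mertens' first theorem, evaluated asymptotically it yields the mean of the carries.\<close>

lemma sum_mangoldt_mod:
  "(\<Sum>d=1..n. mangoldt d * real (n mod d) / d) = n * mangoldt_harm n - ln (fact n :: real)"
proof -
  have *: "mangoldt d * real (n mod d) / d = n * (mangoldt d / d) - mangoldt d * real (n div d)"
    if "d \<in> {1..n}" for d
  proof -
    have "real n = real d * real (n div d) + real (n mod d)"
      by (metis mult_div_mod_eq of_nat_add of_nat_mult)
    then show ?thesis using that by (simp add: field_simps)
  qed
  have "(\<Sum>d=1..n. mangoldt d * real (n mod d) / d) =
      (\<Sum>d=1..n. n * (mangoldt d / d) - mangoldt d * real (n div d))"
    by (intro sum.cong refl *)
  then show ?thesis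
    unfolding ln_fact_eq_sum_mangoldt[OF order.refl] mangoldt_harm_def sum_distrib_left
      sum_subtractf .
qed

text \<open>Supplies the boundedness hypothesis of \<open>newman\<close>. The remainder sum
  \<open>S\<close> lies between 0 and \<open>psi n\<close>, so division by n leaves a bounded
  error.\<close>

lemma mertens_first:
  assumes n: "n > 0"
  shows "\<bar>mangoldt_harm n - ln n\<bar> \<le> 4"
proof -
  define S where "S = (\<Sum>d=1..n. mangoldt d * real (n mod d) / d)"
  have "S \<ge> 0" unfolding S_def by (intro sum_nonneg divide_nonneg_nonneg mult_nonneg_nonneg mangoldt_nonneg) auto
  have "S \<le> psi n" unfolding S_def psi_def
  proof (rule sum_mono)
    fix d assume "d \<in> {1..n}"
    then have "real (n mod d) / d \<le> 1" by (simp add: less_imp_le)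
    from mult_left_mono[OF this mangoldt_nonneg] show "mangoldt d * real (n mod d) / d \<le> mangoldt d"
      by simp
  qed
  with psi_le[of n] have "S \<le> 4 * n" by linarith
  have S: "n * mangoldt_harm n = ln (fact n) + S" using sum_mangoldt_mod[of n] by (simp add: S_def)
  have l: "ln n + 1 \<le> n" using ln_le_minus_one[of "real n"] n by simp
  have "real n * (mangoldt_harm n - ln n) \<le> real n * 4" "real n * (mangoldt_harm n - ln n) \<ge> real n * (- 4)"
    using ln_fact_bounds[OF n] S \<open>S \<ge> 0\<close> \<open>S \<le> 4 * n\<close> l by (simp_all add: algebra_simps)
  then have "mangoldt_harm n - ln n \<le> 4" "mangoldt_harm n - ln n \<ge> - 4"
    using n mult_le_cancel_left_pos[of "real n"] by fastforce+
  then show ?thesis by linarith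
qed

section \<open>Newman's Tauberian theorem\<close>

text \<open>\<open>npow n z\<close> is $n^{-z}$, and \<open>wt n z\<close> is $\int_{\ln n}^{\ln(n+1)} e^{-zt}\,dt$: with these weights in place of
  $n^{-z}$, summation by parts and the bounds in Newman's argument are exact.\<close>

definition npow :: "nat \<Rightarrow> complex \<Rightarrow> complex" where
  "npow n z = exp (- z * of_real (ln (real n)))"

definition wt :: "nat \<Rightarrow> complex \<Rightarrow> complex" where
  "wt n z = (if z = 0 then of_real (ln (real (Suc n)) - ln (real n)) else (npow n z - npow (Suc n) z) / z)"

lemma holomorphic_npow [holomorphic_intros]:
  "f holomorphic_on S \<Longrightarrow> (\<lambda>z. npow n (f z)) holomorphic_on S"
  unfolding npow_def by (intro holomorphic_intros)

lemma norm_npow: "norm (npow n z) = exp (- Re z * ln (real n))"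
  by (simp add: npow_def)

text \<open>The numerator vanishes at 0, so the singularity is removable, and its derivative there
  is the value prescribed by \<open>wt_def\<close>.\<close>

lemma holomorphic_wt: "wt n holomorphic_on UNIV"
proof -
  define f where "f z = npow n z - npow (Suc n) z" for z
  have "f holomorphic_on UNIV" unfolding f_def by (intro holomorphic_intros)
  from pole_lemma_open[OF this open_UNIV, of 0]
  have *: "(\<lambda>z. if z = 0 then deriv f 0 else (f z - f 0) / (z - 0)) holomorphic_on UNIV" .
  have "(f has_field_derivative of_real (ln (real (Suc n)) - ln (real n))) (at 0)"
    unfolding f_def npow_def by (auto intro!: derivative_eq_intros)
  then have "deriv f 0 = of_real (ln (real (Suc n)) - ln (real n))" by (rule DERIV_imp_deriv)
  then have "(\<lambda>z. if z = 0 then deriv f 0 else (f z - f 0) / (z - 0)) = wt n"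
    by (auto simp: fun_eq_iff wt_def f_def npow_def)
  with * show ?thesis by simp
qed

text \<open>The difference is the integral of z exp(-z t) over [a, b], estimated under the integral
  sign. \<open>Re z\<close> may have either sign, because both half planes occur later.\<close>

lemma norm_exp_diff_le:
  fixes z :: complex and a b :: real
  assumes "a \<le> b" "Re z \<noteq> 0"
  shows "norm (exp (- z * a) - exp (- z * b)) \<le> norm z * ((exp (- Re z * a) - exp (- Re z * b)) / Re z)"
proof -
  have I1: "((\<lambda>t. z * exp (- z * of_real t)) has_integral (- exp (- z * b)) - (- exp (- z * a))) {a..b}"
    using assms(1)
    by (intro fundamental_theorem_of_calculus)
       (auto intro!: derivative_eq_intros has_vector_derivative_real_field)
  have I2: "((\<lambda>t. norm z * exp (- Re z * t)) has_integral
      (- norm z * exp (- Re z * b) / Re z) - (- norm z * exp (- Re z * a) / Re z)) {a..b}"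
    using assms
    by (intro fundamental_theorem_of_calculus)
       (auto intro!: derivative_eq_intros simp flip: has_real_derivative_iff_has_vector_derivative)
  have "norm (integral {a..b} (\<lambda>t. z * exp (- z * of_real t))) \<le> integral {a..b} (\<lambda>t. norm z * exp (- Re z * t))"
    using I1 I2 by (intro integral_norm_bound_integral) (auto simp: norm_mult integrable_on_def)
  then have "norm ((- exp (- z * b)) - (- exp (- z * a))) \<le>
      (- norm z * exp (- Re z * b) / Re z) - (- norm z * exp (- Re z * a) / Re z)"
    unfolding integral_unique[OF I1] integral_unique[OF I2] .
  also have "\<dots> = norm z * ((exp (- Re z * a) - exp (- Re z * b)) / Re z)"
    by (simp add: right_diff_distrib diff_divide_distrib)
  finally show ?thesis by simp
qed

text \<open>The bound is a difference of consecutive values of one sequence, so sums of it telescope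
  exactly.\<close>

lemma norm_wt_le:
  assumes "n > 0" "Re z \<noteq> 0"
  shows "norm (wt n z) \<le> (exp (- Re z * ln (real n)) - exp (- Re z * ln (real (Suc n)))) / Re z"
proof -
  have z: "z \<noteq> 0" using assms(2) by auto
  have "norm (npow n z - npow (Suc n) z) \<le>
      norm z * ((exp (- Re z * ln (real n)) - exp (- Re z * ln (real (Suc n)))) / Re z)"
    unfolding npow_def using assms by (intro norm_exp_diff_le) auto
  then show ?thesis using z by (simp add: wt_def norm_divide divide_le_eq mult.commute)
qed

lemma cos_3pi2: "cos (3 * pi / 2) = 0" and sin_3pi2: "sin (3 * pi / 2) = -1"
  using cos_3over2_pi sin_3over2_pi by simp_all

text \<open>Cauchy's formula for a circle cut in two, since the halves are later estimated by
  different means. Subtracting h 0 / z leaves an entire integrand, and 1/z contributes i pi on each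
  half.\<close>

lemma contour_integral_half_circles:
  assumes h: "h holomorphic_on UNIV" and R: "R > 0"
  shows "contour_integral (part_circlepath 0 R (-(pi/2)) (pi/2)) (\<lambda>z. h z / z) +
         contour_integral (part_circlepath 0 R (pi/2) (3*pi/2)) (\<lambda>z. h z / z) = 2 * pi * \<i> * h 0"
proof -
  define c1 where "c1 = part_circlepath 0 R (-(pi/2)) (pi/2)"
  define c2 where "c2 = part_circlepath 0 R (pi/2) (3*pi/2)"
  define g where "g z = (if z = 0 then deriv h 0 else (h z - h 0) / (z - 0))" for z
  have g: "g holomorphic_on UNIV"
    unfolding g_def using pole_lemma_open[OF h open_UNIV, of 0] .
  have inv: "((\<lambda>z. 1 / z) has_contour_integral \<i> * (b - a)) (part_circlepath 0 R a b)" if "a < b" for a b :: real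
  proof -
    have "((\<lambda>t. \<i>) has_integral (b - a) *\<^sub>R \<i>) {a..b}"
      using has_integral_const_real[of \<i> a b] that by simp
    moreover have "(\<lambda>t. 1 / (0 + of_real R * cis t) * of_real R * \<i> * cis t) = (\<lambda>t. \<i>)"
      using R by auto
    ultimately show ?thesis
      by (subst has_contour_integral_part_circlepath_iff[OF that]) (simp add: scaleR_conv_of_real mult.commute)
  qed
  have int: "f contour_integrable_on c1 \<and> f contour_integrable_on c2" if "f holomorphic_on UNIV" for f
    unfolding c1_def c2_def
    using that by (auto intro!: contour_integrable_holomorphic_simple[OF that open_UNIV])
  have nz: "z \<noteq> 0" if "z \<in> path_image c1 \<union> path_image c2" for z
    using that R path_image_part_circlepath_subset'[of R 0 "-(pi/2)" "pi/2"]
      path_image_part_circlepath_subset'[of R 0 "pi/2" "3*pi/2"] unfolding c1_def c2_def by auto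
  have start: "pathstart c1 = - \<i> * R" "pathfinish c1 = \<i> * R" "pathstart c2 = \<i> * R" "pathfinish c2 = - \<i> * R"
    unfolding c1_def c2_def
    by (auto simp: exp_eq_polar cis_conv_exp [symmetric] cis.ctr complex_eq_iff cos_3pi2 sin_3pi2)
  have "(g has_contour_integral 0) (c1 +++ c2)"
    using start by (intro Cauchy_theorem_convex_simple[OF g]) (auto simp: c1_def c2_def intro!: valid_path_join)
  moreover have "(g has_contour_integral (contour_integral c1 g + contour_integral c2 g)) (c1 +++ c2)"
    using int[OF g] by (intro has_contour_integral_join has_contour_integral_integral) (auto simp: c1_def c2_def)
  ultimately have 0: "contour_integral c1 g + contour_integral c2 g = 0"
    using contour_integral_unique by metis
  have c: "contour_integral c (\<lambda>z. h z / z) = contour_integral c g + h 0 * (\<i> * pi)"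
    if "c = c1 \<or> c = c2" for c
  proof -
    have "((\<lambda>z. 1 / z) has_contour_integral \<i> * pi) c"
      using that inv[of "-(pi/2)" "pi/2"] inv[of "pi/2" "3*pi/2"] unfolding c1_def c2_def by auto
    then have "((\<lambda>z. g z + h 0 * (1 / z)) has_contour_integral contour_integral c g + h 0 * (\<i> * pi)) c"
      using int[OF g] that
      by (intro has_contour_integral_add has_contour_integral_lmul has_contour_integral_integral) auto
    then have "((\<lambda>z. h z / z) has_contour_integral contour_integral c g + h 0 * (\<i> * pi)) c"
      by (rule has_contour_integral_eq) (use nz that in \<open>auto simp: g_def field_simps\<close>)
    then show ?thesis by (rule contour_integral_unique)
  qed
  show ?thesis
    using c[of c1] c[of c2] 0 unfolding c1_def [symmetric] c2_def [symmetric] by (simp add: algebra_simps)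
qed

text \<open>On the circle R^2 = z * cnj z, so the kernel equals the real number 2 Re z / R^2. Its
  factor Re z cancels the 1 / Re z in the estimates of tails and partial sums.\<close>

lemma norm_circle_kernel:
  fixes z :: complex
  assumes "norm z = R" "R > 0"
  shows "norm ((1 + z^2 / R^2) / z) = 2 * \<bar>Re z\<bar> / R^2"
proof -
  have z: "z \<noteq> 0" using assms by auto
  have "of_real (R^2) = z * cnj z" using assms complex_norm_square[of z] by simp
  then have "(1 + z^2 / R^2) / z = (cnj z + z) / (z * cnj z)"
    using z by (simp add: field_simps power2_eq_square)
  also have "\<dots> = of_real (2 * Re z) / of_real (R^2)"
    using \<open>of_real (R^2) = z * cnj z\<close> complex_add_cnj[of z] by (simp add: add.commute)
  finally have "(1 + z^2 / R^2) / z = of_real (2 * Re z) / of_real (R^2)" .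
  then show ?thesis by (simp add: norm_divide norm_mult norm_power abs_mult)
qed

text \<open>From y <= exp y at y = - x * L. This is the source of the decay like 1 / ln N on the
  parts of the contours left of the imaginary axis.\<close>

lemma mult_exp_le_inverse:
  fixes x L :: real
  assumes "x \<le> 0" "L > 0"
  shows "exp (x * L) * \<bar>x\<bar> \<le> 1 / L"
proof -
  have "- x * L \<le> exp (- x * L)" using exp_ge_add_one_self[of "- x * L"] by linarith
  then have "exp (x * L) * (- x * L) \<le> exp (x * L) * exp (- x * L)" by (intro mult_left_mono) auto
  also have "\<dots> = 1" by (simp flip: exp_add)
  finally show ?thesis using assms by (simp add: field_simps)
qed


text \<open>Newman's contour: a right half circle of radius \<open>R\<close> closed by two segments meeting at \<open>- d\<close>. The
  partial sums \<open>SN N\<close> are entire, so their contour is moved to the full circle. The kernel \<open>E\<close>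
  vanishes at \<open>\<i> R\<close> and \<open>- \<i> R\<close> to first order, so pointwise bounds suffice near the imaginary axis.\<close>

theorem newman:
  fixes A :: "nat \<Rightarrow> complex" and G :: "complex \<Rightarrow> complex"
  assumes A: "\<And>n. norm (A n) \<le> C"
    and S: "open S" "{z. Re z \<ge> 0} \<subseteq> S" and G: "G holomorphic_on S"
    and sums: "\<And>z. Re z > 0 \<Longrightarrow> (\<lambda>n. A n * wt (Suc n) z) sums G z"
  shows "(\<lambda>n. A n * of_real (ln (real (n + 2)) - ln (real (n + 1)))) sums G 0"
proof -
  define SN where "SN N z = (\<Sum>n<N. A n * wt (Suc n) z)" for N z
  have C: "C \<ge> 0" using A[of 0] norm_ge_zero order_trans by blast
  have SN_hol: "SN N holomorphic_on T" for N T
    unfolding SN_def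
    by (intro holomorphic_intros holomorphic_on_subset[OF holomorphic_wt]) auto
  define ex where "ex x n = exp (- x * ln (real (Suc n)))" for x :: real and n
  have wt_le: "norm (A n * wt (Suc n) z) \<le> C * ((ex (Re z) n - ex (Re z) (Suc n)) / Re z)"
    if "Re z \<noteq> 0" for n z
    unfolding norm_mult ex_def using A[of n] norm_wt_le[of "Suc n" z] C that
    by (intro mult_mono) auto
  \<comment> \<open>One telescoping bound, cut at N, is used from both sides: the tail is controlled
    for Re z > 0, the partial sum for Re z < 0.\<close>
  have tail: "norm (G z - SN N z) \<le> C * (ex (Re z) N / Re z)" if z: "Re z > 0" for N z
  proof -
    have "ex (Re z) \<longlonglongrightarrow> 0"
      unfolding ex_def using z by real_asymp
    then have "(\<lambda>n. ex (Re z) (n + N)) \<longlonglongrightarrow> 0" by (rule LIMSEQ_ignore_initial_segment)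
    from telescope_sums'[OF this]
    have "(\<lambda>n. C * ((ex (Re z) (n + N) - ex (Re z) (Suc n + N)) / Re z)) sums (C * ((ex (Re z) (0 + N) - 0) / Re z))"
      by (intro sums_mult sums_divide) simp
    moreover have "(\<lambda>n. A (n + N) * wt (Suc (n + N)) z) sums (G z - SN N z)"
      using sums_split_initial_segment[OF sums[OF z], of N] by (simp add: SN_def)
    ultimately have "norm (\<Sum>n. A (n + N) * wt (Suc (n + N)) z) \<le> C * ((ex (Re z) (0 + N) - 0) / Re z)"
      using wt_le[of z] z
      by (metis (no_types, lifting) add_Suc less_irrefl norm_suminf_le sums_iff)
    then show ?thesis
      using \<open>(\<lambda>n. A (n + N) * wt (Suc (n + N)) z) sums (G z - SN N z)\<close> by (simp add: sums_iff)
  qed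
  have head: "norm (SN N z) \<le> C * (ex (Re z) N / \<bar>Re z\<bar>)" if z: "Re z < 0" for N z
  proof -
    have "norm (SN N z) \<le> (\<Sum>n<N. C * ((ex (Re z) n - ex (Re z) (Suc n)) / Re z))"
      unfolding SN_def using z by (intro sum_norm_le wt_le) auto
    also have "\<dots> = C * ((ex (Re z) 0 - ex (Re z) N) / Re z)"
      by (simp add: sum_lessThan_telescope' flip: sum_distrib_left sum_divide_distrib)
    also have "\<dots> \<le> C * (ex (Re z) N / \<bar>Re z\<bar>)"
      using z C by (intro mult_left_mono) (auto simp: field_simps ex_def)
    finally show ?thesis .
  qed

  \<comment> \<open>\<open>M\<close> depends on \<open>R\<close> but not on \<open>N\<close>: at the
    end \<open>R\<close> is fixed so that 2 C / R is small, and then \<open>N\<close> tends to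
    infinity.\<close>
  have key: "\<exists>M\<ge>0. \<forall>N\<ge>1. norm (G 0 - SN N 0) \<le> 2 * C / R + M / ln (real (Suc N))"
    if R: "R > 0" for R :: real
  proof -
    have "compact ((\<lambda>y. \<i> * of_real y) ` {-(R+1)..R+1})"
      by (intro compact_continuous_image continuous_intros compact_Icc)
    moreover have "(\<lambda>y. \<i> * of_real y) ` {-(R+1)..R+1} \<subseteq> S" using S by auto
    ultimately obtain e where e: "e > 0" "(\<Union>x\<in>(\<lambda>y. \<i> * of_real y) ` {-(R+1)..R+1}. ball x e) \<subseteq> S"
      using compact_subset_open_imp_ball_epsilon_subset[OF _ S(1)] by metis
    \<comment> \<open>A convex neighbourhood of the contour inside \<open>S\<close>; compactness of
      a segment of the imaginary axis provides the uniform width \<open>e\<close> to its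
      left.\<close>
    define U where "U = {z. Re z > -e} \<inter> {z. Im z > -(R+1)} \<inter> {z. Im z < R+1}"
    have U: "convex U" "open U"
      unfolding U_def
      by (intro convex_Int open_Int convex_halfspace_Re_gt convex_halfspace_Im_gt convex_halfspace_Im_lt
          open_halfspace_Re_gt open_halfspace_Im_gt open_halfspace_Im_lt)+
    have US: "U \<subseteq> S"
    proof
      fix z assume z: "z \<in> U"
      show "z \<in> S"
      proof (cases "Re z \<ge> 0")
        case False
        have "dist (\<i> * of_real (Im z)) z = \<bar>Re z\<bar>"
          by (simp add: dist_norm cmod_def)
        then have "z \<in> ball (\<i> * of_real (Im z)) e" using z False by (auto simp: U_def)
        then show ?thesis using e z by (force simp: U_def)
      qed (use S in auto)
    qed
    define d where "d = min (e/2) R"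
    have d: "d > 0" "d < e" "d \<le> R" using e R by (auto simp: d_def)
    \<comment> \<open>With G 0 subtracted the integrand is holomorphic at the origin, so the
      integral of \<open>G1 * E\<close> moves from the arc to \<open>p\<close> by Cauchy's theorem
      on a convex set. The subtracted part G 0 * E z / z is handled together with the partial sum on
      the full circle.\<close>
    define G1 where "G1 z = (if z = 0 then deriv G 0 else (G z - G 0) / (z - 0))" for z
    have G1: "G1 holomorphic_on U"
      unfolding G1_def by (intro pole_lemma_open holomorphic_on_subset[OF G US] U)
    define c1 where "c1 = part_circlepath 0 R (-(pi/2)) (pi/2)"
    define c2 where "c2 = part_circlepath 0 R (pi/2) (3*pi/2)"
    define p where "p = linepath (\<i> * R) (- of_real d) +++ linepath (- of_real d) (- \<i> * R)"
    have c1: "norm z = R" "Re z \<ge> 0" if "z \<in> path_image c1" for z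
    proof -
      show "norm z = R"
        using path_image_part_circlepath_subset'[of R 0 "-(pi/2)" "pi/2"] that R by (auto simp: c1_def)
      show "Re z \<ge> 0" using that R cos_ge_zero
        by (auto simp: c1_def path_image_part_circlepath' exp_eq_polar Re_exp closed_segment_eq_real_ivl intro!: mult_nonneg_nonneg)
    qed
    have c2: "norm z = R" "Re z \<le> 0" if "z \<in> path_image c2" for z
    proof -
      show "norm z = R"
        using path_image_part_circlepath_subset'[of R 0 "pi/2" "3*pi/2"] that R by (auto simp: c2_def)
      have "cos t \<le> 0" if "t \<in> {pi/2..3*pi/2}" for t
        using cos_ge_zero[of "t - pi"] that by (auto simp: cos_diff)
      then show "Re z \<le> 0" using that R
        by (auto simp: c2_def path_image_part_circlepath' exp_eq_polar Re_exp closed_segment_eq_real_ivl mult_nonneg_nonpos)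
    qed
    have start: "pathstart c1 = - \<i> * R" "pathfinish c1 = \<i> * R" "pathstart c2 = \<i> * R" "pathfinish c2 = - \<i> * R"
      unfolding c1_def c2_def
      by (auto simp: exp_eq_polar cis_conv_exp [symmetric] cis.ctr complex_eq_iff cos_3pi2 sin_3pi2)
    have c1U: "path_image c1 \<subseteq> U"
    proof
      fix z assume "z \<in> path_image c1"
      then show "z \<in> U" using c1[of z] e abs_Im_le_cmod[of z] by (auto simp: U_def)
    qed
    have pim: "path_image p = closed_segment (\<i> * R) (- of_real d) \<union> closed_segment (- of_real d) (- \<i> * R)"
      by (simp add: p_def path_image_join)
    have ptsU: "\<i> * of_real R \<in> U" "- of_real d \<in> U" "- \<i> * of_real R \<in> U"
      using e R d by (auto simp: U_def)
    then have pU: "path_image p \<subseteq> U"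
      unfolding pim using closed_segment_subset[OF _ _ U(1)] by blast
    have pvalid: "valid_path p" by (simp add: p_def)

    have "compact (G1 ` path_image p)"
      by (intro compact_continuous_image holomorphic_on_imp_continuous_on holomorphic_on_subset[OF G1 pU]
          compact_path_image valid_path_imp_path pvalid)
    then obtain B where B: "B > 0" "\<And>z. z \<in> path_image p \<Longrightarrow> norm (G1 z) \<le> B"
      using compact_imp_bounded bounded_pos by (metis imageI)

    define K where "K = norm (\<i> * R + of_real d) * (2 * R) / (d * R^2)"
    have K: "K \<ge> 0" unfolding K_def using d R by auto
    define M where "M = (norm (G 0) * (2 / R^2 * R * pi) + B * K * (2 * norm (\<i> * R + of_real d))) / (2 * pi)"
    have "M \<ge> 0" unfolding M_def using K B R by auto
    moreover have "norm (G 0 - SN N 0) \<le> 2 * C / R + M / ln (real (Suc N))" if N: "N \<ge> 1" for N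
    proof -
      define L where "L = ln (real (Suc N))"
      have L: "L > 0" unfolding L_def using N by simp
      \<comment> \<open>exp (z * L) = (N+1)^z offsets the size (N+1)^(-Re z) of both estimates, the
        second factor is Newman's kernel, and E 0 = 1 leaves the value at the origin
        unchanged.\<close>
      define E where "E z = exp (z * of_real L) * (1 + z^2 / R^2)" for z :: complex
      have E_hol: "E holomorphic_on T" for T unfolding E_def using R by (intro holomorphic_intros) auto
      have E0: "E 0 = 1" by (simp add: E_def)
      have exN: "ex x N = exp (- x * L)" for x unfolding ex_def L_def ..
      have Enorm: "norm (E z / z) = exp (Re z * L) * (2 * \<bar>Re z\<bar> / R^2)" if "norm z = R" for z
        using norm_circle_kernel[OF that R] unfolding E_def times_divide_eq_right [symmetric] norm_mult by simp

      \<comment> \<open>The tail bound divides by Re z; at the two points of the circle on the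
        imaginary axis the kernel itself is 0.\<close>
      have b1: "norm ((G z - SN N z) * (E z / z)) \<le> 2 * C / R^2" if "z \<in> path_image c1" for z
      proof (cases "Re z = 0")
        case False
        then have x: "Re z > 0" using c1[OF that] by auto
        have "norm ((G z - SN N z) * (E z / z)) \<le> C * (exp (- Re z * L) / Re z) * (exp (Re z * L) * (2 * \<bar>Re z\<bar> / R^2))"
          unfolding norm_mult [of _ "E z / z"] Enorm[OF c1(1)[OF that]]
          using tail[OF x, of N] by (intro mult_right_mono) (auto simp: exN)
        also have "\<dots> = 2 * C / R^2 * (exp (- Re z * L) * exp (Re z * L))"
          using x by simp
        also have "\<dots> = 2 * C / R^2" by (simp flip: exp_add)
        finally show ?thesis .
      qed (use C R Enorm[OF c1(1)[OF that]] in \<open>auto simp: norm_mult\<close>)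
      have b2: "norm (SN N z * (E z / z)) \<le> 2 * C / R^2" if "z \<in> path_image c2" for z
      proof (cases "Re z = 0")
        case False
        then have x: "Re z < 0" using c2[OF that] by auto
        have "norm (SN N z * (E z / z)) \<le> C * (exp (- Re z * L) / \<bar>Re z\<bar>) * (exp (Re z * L) * (2 * \<bar>Re z\<bar> / R^2))"
          unfolding norm_mult [of _ "E z / z"] Enorm[OF c2(1)[OF that]]
          using head[OF x, of N] by (intro mult_right_mono) (auto simp: exN)
        also have "\<dots> = 2 * C / R^2 * (exp (- Re z * L) * exp (Re z * L))"
          using x by simp
        also have "\<dots> = 2 * C / R^2" by (simp flip: exp_add)
        finally show ?thesis .
      qed (use C R Enorm[OF c2(1)[OF that]] in \<open>auto simp: norm_mult\<close>)
      have b3: "norm (E z / z) \<le> 2 / R^2 * (1 / L)" if "z \<in> path_image c2" for z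
      proof -
        have "norm (E z / z) = 2 / R^2 * (exp (Re z * L) * \<bar>Re z\<bar>)" using Enorm[OF c2(1)[OF that]] by simp
        also have "\<dots> \<le> 2 / R^2 * (1 / L)"
          using mult_exp_le_inverse[OF c2(2)[OF that] L] by (intro mult_left_mono) auto
        finally show ?thesis .
      qed
      have b4: "norm (G1 z * E z) \<le> B * (K / L)" if "z \<in> path_image p" for z
      proof -
        \<comment> \<open>A common form for both segments: \<open>t\<close> measures the progress
          from the end point s * i * R towards - d, so that |Re z| = t d. The second segment is
          therefore traversed backwards.\<close>
        have "\<exists>s t. z = - of_real (t * d) + of_real (s * (1 - t)) * \<i> * R \<and> 0 \<le> t \<and> t \<le> 1 \<and> (s = 1 \<or> s = -1)"
        proof (cases "z \<in> closed_segment (\<i> * R) (- of_real d)")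
          case True
          then obtain t where "0 \<le> t" "t \<le> 1" "z = (1 - t) *\<^sub>R (\<i> * R) + t *\<^sub>R (- of_real d)"
            unfolding closed_segment_def by auto
          then show ?thesis by (intro exI[of _ 1] exI[of _ t]) (simp add: scaleR_conv_of_real)
        next
          case False
          then have "z \<in> closed_segment (- of_real d) (- \<i> * R)" using that pim by blast
          then obtain t where "0 \<le> t" "t \<le> 1" "z = (1 - t) *\<^sub>R (- of_real d) + t *\<^sub>R (- \<i> * R)"
            unfolding closed_segment_def by blast
          then show ?thesis by (intro exI[of _ "-1"] exI[of _ "1 - t"]) (simp add: scaleR_conv_of_real)
        qed
        then obtain s t where st: "z = - of_real (t * d) + of_real (s * (1 - t)) * \<i> * R" "0 \<le> t" "t \<le> 1" "s = 1 \<or> s = -1"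
          by blast
        define w where "w = of_real s * \<i> * of_real R"
        have w2: "w^2 = - of_real (R^2)" using st(4) by (auto simp: w_def power_mult_distrib)
        \<comment> \<open>The factor \<open>z - w\<close> vanishes at the end point and is
          proportional to \<open>t\<close>, hence to |Re z|. This compensates for exp (Re z * L) not
          being small near the axis.\<close>
        have E1: "1 + z^2 / R^2 = (z - w) * (z + w) / R^2"
          using R w2 by (simp add: field_simps power2_eq_square)
        have Rez: "Re z = - (t * d)" by (simp add: st(1))
        have "z - w = - of_real t * (of_real d + w)" by (simp add: st(1) w_def algebra_simps)
        moreover have "norm (of_real d + w) = norm (\<i> * R + of_real d)"
          using st(4) by (auto simp: w_def cmod_def)
        ultimately have n1: "norm (z - w) = t * norm (\<i> * R + of_real d)"
          using st(2) by (simp add: norm_mult)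
        have nw: "norm w = R" using st(4) R by (auto simp: w_def norm_mult)
        have "z = of_real t * (- of_real d) + of_real (1 - t) * w" by (simp add: st(1) w_def)
        also have "norm \<dots> \<le> t * d + (1 - t) * R"
        proof (rule norm_triangle_le)
          show "norm (of_real t * (- of_real d) :: complex) + norm (of_real (1 - t) * w) \<le> t * d + (1 - t) * R"
            unfolding norm_mult norm_of_real nw using st d by simp
        qed
        also have "\<dots> \<le> t * R + (1 - t) * R" using d st by (intro add_right_mono mult_left_mono) auto
        finally have "norm z \<le> R" by (simp add: algebra_simps)
        then have n2: "norm (z + w) \<le> 2 * R" using norm_triangle_ineq[of z w] nw by simp
        have "norm (E z) = exp (Re z * L) * (norm (z - w) * norm (z + w) / R^2)"
          unfolding E_def E1 by (simp add: norm_mult norm_divide norm_power)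
        also have "\<dots> \<le> exp (Re z * L) * (t * norm (\<i> * R + of_real d) * (2 * R) / R^2)"
          unfolding n1 using n2 st by (intro mult_left_mono divide_right_mono) auto
        also have "\<dots> = K * (exp (Re z * L) * \<bar>Re z\<bar>)"
          using d st unfolding K_def Rez by (simp add: abs_mult)
        also have "\<dots> \<le> K * (1 / L)"
          using K Rez d st L by (intro mult_left_mono mult_exp_le_inverse) auto
        finally have "norm (E z) \<le> K / L" by simp
        then show ?thesis unfolding norm_mult using B that by (intro mult_mono) auto
      qed

      have nz1: "z \<noteq> 0" if "z \<in> path_image c1 \<union> path_image c2" for z
        using that c1(1)[of z] c2(1)[of z] R by auto
      have hc: "\<exists>i. (f has_contour_integral i) c" if "f holomorphic_on V - {0}" "path_image c \<subseteq> V" "open V" "c = c1 \<or> c = c2"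
        for f V c
      proof -
        have "f contour_integrable_on c"
          using that nz1
          by (intro contour_integrable_holomorphic_simple[OF that(1)]) (auto simp: c1_def c2_def)
        then show ?thesis by (auto simp: contour_integrable_on_def)
      qed
      obtain I1 where I1: "((\<lambda>z. (G z - SN N z) * (E z / z)) has_contour_integral I1) c1"
        using hc[of "\<lambda>z. (G z - SN N z) * (E z / z)" U c1] c1U U
        by (force intro!: holomorphic_intros SN_hol E_hol holomorphic_on_subset[OF G] dest: subsetD[OF US])
      obtain I2 where I2: "((\<lambda>z. SN N z * (E z / z)) has_contour_integral I2) c2"
        using hc[of "\<lambda>z. SN N z * (E z / z)" UNIV c2]
        by (force intro!: holomorphic_intros SN_hol E_hol)
      obtain I3 where I3: "((\<lambda>z. E z / z) has_contour_integral I3) c2"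
        using hc[of "\<lambda>z. E z / z" UNIV c2]
        by (force intro!: holomorphic_intros E_hol)
      have GE: "(\<lambda>z. G1 z * E z) holomorphic_on U" by (intro holomorphic_intros G1 E_hol)
      have "(\<lambda>z. G1 z * E z) contour_integrable_on p"
        by (intro contour_integrable_holomorphic_simple[OF GE] U pvalid pU)
      then obtain I4 where I4: "((\<lambda>z. G1 z * E z) has_contour_integral I4) p"
        by (auto simp: contour_integrable_on_def)
      have "(\<lambda>z. G1 z * E z) contour_integrable_on c1"
        by (intro contour_integrable_holomorphic_simple[OF GE] U c1U) (simp add: c1_def)
      then obtain I5 where I5: "((\<lambda>z. G1 z * E z) has_contour_integral I5) c1"
        by (auto simp: contour_integrable_on_def)
      have vc: "valid_path c1" "valid_path c2" by (auto simp: c1_def c2_def)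
      have ps: "pathstart p = \<i> * R" "pathfinish p = - \<i> * R" by (auto simp: p_def)
      have "((\<lambda>z. G1 z * E z) has_contour_integral 0) (c1 +++ p)"
        using start ps vc pvalid c1U pU
        by (intro Cauchy_theorem_convex_simple[OF GE U(1)]) (auto simp: path_image_join intro!: valid_path_join)
      moreover have "((\<lambda>z. G1 z * E z) has_contour_integral (I5 + I4)) (c1 +++ p)"
        using vc pvalid by (intro has_contour_integral_join I5 I4)
      ultimately have I54: "I5 = - I4" using contour_integral_unique by (metis eq_neg_iff_add_eq_0)
      \<comment> \<open>Entire, so the integral of h z / z over the full circle evaluates
        \<open>G 0 - SN N 0\<close>; on the arcs it is rewritten through the pieces estimated
        above.\<close>
      define h where "h z = (G 0 - SN N z) * E z" for z
      have "h holomorphic_on UNIV" unfolding h_def by (intro holomorphic_intros SN_hol E_hol)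
      from contour_integral_half_circles[OF this R]
      have hint: "contour_integral c1 (\<lambda>z. h z / z) + contour_integral c2 (\<lambda>z. h z / z) = 2 * pi * \<i> * (G 0 - SN N 0)"
        unfolding c1_def c2_def by (simp add: h_def E0)
      have "((\<lambda>z. (G z - SN N z) * (E z / z) - G1 z * E z) has_contour_integral I1 - I5) c1"
        by (intro has_contour_integral_diff I1 I5)
      then have "((\<lambda>z. h z / z) has_contour_integral I1 - I5) c1"
        by (rule has_contour_integral_eq) (use nz1 in \<open>auto simp: h_def G1_def field_simps\<close>)
      then have h1: "contour_integral c1 (\<lambda>z. h z / z) = I1 - I5" by (rule contour_integral_unique)
      have "((\<lambda>z. G 0 * (E z / z) - SN N z * (E z / z)) has_contour_integral G 0 * I3 - I2) c2"
        by (intro has_contour_integral_diff has_contour_integral_lmul I2 I3)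
      then have "((\<lambda>z. h z / z) has_contour_integral G 0 * I3 - I2) c2"
        by (rule has_contour_integral_eq) (use nz1 in \<open>auto simp: h_def field_simps\<close>)
      then have h2: "contour_integral c2 (\<lambda>z. h z / z) = G 0 * I3 - I2" by (rule contour_integral_unique)
      have main: "2 * pi * \<i> * (G 0 - SN N 0) = I1 + I4 + G 0 * I3 - I2"
        using hint [symmetric] unfolding h1 h2 I54 by (simp only: diff_minus_eq_add add_diff_eq)

      have n1: "norm I1 \<le> 2 * C / R^2 * R * pi"
        using has_contour_integral_bound_part_circlepath[OF I1[unfolded c1_def], of "2 * C / R^2"] b1 C R
        by (simp add: c1_def)
      have n2: "norm I2 \<le> 2 * C / R^2 * R * pi"
        using has_contour_integral_bound_part_circlepath[OF I2[unfolded c2_def], of "2 * C / R^2"] b2 C R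
        by (simp add: c2_def)
      have n3: "norm I3 \<le> 2 / R^2 * (1 / L) * R * pi"
        using has_contour_integral_bound_part_circlepath[OF I3[unfolded c2_def], of "2 / R^2 * (1 / L)"] b3 L R
        by (simp add: c2_def)
      have n4: "norm I4 \<le> B * (K / L) * (2 * norm (\<i> * R + of_real d))"
      proof -
        let ?f = "\<lambda>z. G1 z * E z"
        have "?f contour_integrable_on linepath (\<i> * R) (- of_real d)" "?f contour_integrable_on linepath (- of_real d) (- \<i> * R)"
          by (intro contour_integrable_holomorphic_simple[OF GE] U; use pU pim in auto)+
        then obtain J1 J2 where J: "(?f has_contour_integral J1) (linepath (\<i> * R) (- of_real d))"
          "(?f has_contour_integral J2) (linepath (- of_real d) (- \<i> * R))"
          by (auto simp: contour_integrable_on_def)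
        then have "(?f has_contour_integral (J1 + J2)) p"
          unfolding p_def by (intro has_contour_integral_join) auto
        then have I4J: "I4 = J1 + J2" using I4 contour_integral_unique by metis
        have BK: "0 \<le> B * (K / L)" using B K L by auto
        have e: "norm (- of_real d - \<i> * R) = norm (\<i> * R + of_real d)"
          "norm (- \<i> * R - - of_real d) = norm (\<i> * R + of_real d)"
          by (auto simp: cmod_def)
        have "norm J1 \<le> B * (K / L) * norm (- of_real d - \<i> * R)"
          by (rule has_contour_integral_bound_linepath[OF J(1) BK]) (use b4 pim in auto)
        moreover have "norm J2 \<le> B * (K / L) * norm (- \<i> * R - - of_real d)"
          by (rule has_contour_integral_bound_linepath[OF J(2) BK]) (use b4 pim in auto)
        ultimately show ?thesis
          unfolding I4J e mult_2 distrib_left by (rule norm_triangle_mono)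
      qed
      have "2 * pi * norm (G 0 - SN N 0) = norm (2 * pi * \<i> * (G 0 - SN N 0))"
        by (simp add: norm_mult)
      also have "\<dots> \<le> norm I1 + norm I4 + norm (G 0) * norm I3 + norm I2"
        unfolding main norm_mult [symmetric]
        using norm_triangle_ineq4[of "I1 + I4 + G 0 * I3" I2] norm_triangle_ineq[of "I1 + I4" "G 0 * I3"]
          norm_triangle_ineq[of I1 I4] by linarith
      also have "\<dots> \<le> 2 * C / R^2 * R * pi + B * (K / L) * (2 * norm (\<i> * R + of_real d)) +
          norm (G 0) * (2 / R^2 * (1 / L) * R * pi) + 2 * C / R^2 * R * pi"
        by (intro add_mono n1 n2 n4 mult_left_mono n3) auto
      also have "\<dots> = 2 * pi * (2 * C / R + M / L)"
        unfolding M_def using R L by (simp add: field_simps power2_eq_square)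
      finally show ?thesis unfolding L_def by simp
    qed
    ultimately show ?thesis by blast
  qed
  have "(\<lambda>N. SN N 0) \<longlonglongrightarrow> G 0"
  proof (rule LIMSEQ_I)
    fix r :: real assume r: "r > 0"
    \<comment> \<open>Chosen so that 2 C / R <= r / 2; the summand 1 keeps \<open>R\<close> positive
      when \<open>C\<close> is 0.\<close>
    define R where "R = 4 * C / r + 1"
    have R: "R > 0" unfolding R_def using r C by (simp add: add_nonneg_pos)
    have "2 * C / R \<le> r / 2" using R r C unfolding R_def by (simp add: field_simps)
    obtain M where M: "M \<ge> 0" "\<And>N. N \<ge> 1 \<Longrightarrow> norm (G 0 - SN N 0) \<le> 2 * C / R + M / ln (real (Suc N))"
      using key[OF R] by blast
    have "(\<lambda>N. M / ln (real (Suc N))) \<longlonglongrightarrow> 0" by real_asymp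
    then have "eventually (\<lambda>N. M / ln (real (Suc N)) < r / 2) sequentially"
      using r by (intro order_tendstoD) auto
    then obtain N0 where N0: "\<And>N. N \<ge> N0 \<Longrightarrow> M / ln (real (Suc N)) < r / 2"
      by (auto simp: eventually_sequentially)
    show "\<exists>no. \<forall>n\<ge>no. norm (SN n 0 - G 0) < r"
    proof (intro exI allI impI)
      fix n assume n: "n \<ge> max N0 1"
      then have "n \<ge> 1" "n \<ge> N0" by auto
      from M(2)[OF this(1)] N0[OF this(2)] \<open>2 * C / R \<le> r / 2\<close>
      have "norm (G 0 - SN n 0) < r" by linarith
      then show "norm (SN n 0 - G 0) < r" by (simp add: norm_minus_commute)
    qed
  qed
  then show ?thesis
    unfolding sums_def SN_def by (simp add: wt_def add.commute)
qed

section \<open>The zeta function on the line $\mathrm{Re}\,s = 1$\<close>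

text \<open>\<open>zt z\<close> is the continuation of $z\,\zeta(1+z)$ to $\mathrm{Re}\,z > -1$, written as the sum over $n$ of
  $z\,(n^{-1-z} - \int_n^{n+1} x^{-1-z}\,dx)$ plus the contribution 1 of $\int_1^\infty$.\<close>

definition zt_term :: "nat \<Rightarrow> complex \<Rightarrow> complex" where
  "zt_term n z = z * npow (Suc n) (1 + z) - (npow (Suc n) z - npow (n + 2) z)"

definition zt_term' :: "nat \<Rightarrow> complex \<Rightarrow> complex" where
  "zt_term' n z = npow (Suc n) (1 + z) - z * of_real (ln (real (Suc n))) * npow (Suc n) (1 + z)
     + of_real (ln (real (Suc n))) * npow (Suc n) z - of_real (ln (real (n + 2))) * npow (n + 2) z"

definition zt :: "complex \<Rightarrow> complex" where "zt z = 1 + (\<Sum>n. zt_term n z)"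
definition zt' :: "complex \<Rightarrow> complex" where "zt' z = (\<Sum>n. zt_term' n z)"

lemma npow_0 [simp]: "npow n 0 = 1" and npow_1 [simp]: "npow (Suc 0) z = 1"
  by (auto simp: npow_def)

lemma npow_add: "npow n (z + w) = npow n z * npow n w"
  by (simp add: npow_def ring_distribs flip: exp_add)

lemma npow_mult: "m > 0 \<Longrightarrow> n > 0 \<Longrightarrow> npow (m * n) z = npow m z * npow n z"
  by (simp add: npow_def ln_mult ring_distribs flip: exp_add)

lemma npow_one: "n > 0 \<Longrightarrow> npow n 1 = 1 / of_nat n"
  by (simp add: npow_def exp_minus exp_of_real divide_inverse flip: of_real_minus)

lemma has_field_derivative_npow [derivative_intros]:
  "(f has_field_derivative f') (at z within A) \<Longrightarrow>
   ((\<lambda>z. npow n (f z)) has_field_derivative (- of_real (ln (real n)) * npow n (f z) * f')) (at z within A)"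
  unfolding npow_def by (auto intro!: derivative_eq_intros)

lemma has_field_derivative_zt_term: "(zt_term n has_field_derivative zt_term' n z) (at z)"
  unfolding zt_term_def zt_term'_def
  by (auto intro!: derivative_eq_intros simp: algebra_simps)

text \<open>Here ln t - ln m <= 1/m, by ln x <= x - 1. This gains the factor 1/m that makes the
  series for \<open>zt\<close> converge beyond the imaginary axis.\<close>

lemma norm_npow_diff_le:
  assumes "m > 0" "real m \<le> t" "t \<le> real m + 1" "Re z > 0"
  shows "norm (npow m z - exp (- z * of_real (ln t))) \<le> norm z * (exp (- Re z * ln (real m)) / m)"
proof -
  define a where "a = ln (real m)"
  define b where "b = ln t"
  have ab: "a \<le> b" unfolding a_def b_def using assms by simp
  have "b - a = ln (t / m)" unfolding a_def b_def using assms by (simp add: ln_div)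
  also have "\<dots> \<le> t / m - 1" using assms by (intro ln_le_minus_one) auto
  also have "\<dots> \<le> (real m + 1) / m - 1"
    using assms by (intro diff_right_mono divide_right_mono) auto
  also have "\<dots> = 1 / m" using assms by (simp add: add_divide_distrib)
  finally have b_a: "b - a \<le> 1 / m" .
  have "norm (npow m z - exp (- z * of_real b)) \<le> norm z * ((exp (- Re z * a) - exp (- Re z * b)) / Re z)"
    unfolding npow_def a_def [symmetric] using ab assms by (intro norm_exp_diff_le) auto
  also have "(exp (- Re z * a) - exp (- Re z * b)) / Re z \<le> exp (- Re z * a) / m"
  proof -
    have "1 - exp (- Re z * (b - a)) \<le> Re z * (b - a)"
      using exp_ge_add_one_self[of "- Re z * (b - a)"] by simp
    also have "\<dots> \<le> Re z * (1 / m)" using b_a assms by (intro mult_left_mono) auto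
    finally have "exp (- Re z * a) * (1 - exp (- Re z * (b - a))) \<le> exp (- Re z * a) * (Re z * (1 / m))"
      by (intro mult_left_mono) auto
    also have "exp (- Re z * a) * (1 - exp (- Re z * (b - a))) = exp (- Re z * a) - exp (- Re z * b)"
      by (simp add: right_diff_distrib flip: exp_add)
    finally show ?thesis using assms by (simp add: field_simps)
  qed
  finally show ?thesis unfolding a_def b_def by (simp add: mult_left_mono)
qed

text \<open>The term is the integral over [m, m + 1] of z (m^(-1-z) - t^(-1-z)), with antiderivative
  \<open>F\<close>. The resulting size m^(-2 - Re z) is summable for Re z > -1.\<close>

lemma norm_zt_term_le:
  assumes "Re z > -1"
  shows "norm (zt_term n z) \<le> norm z * norm (1 + z) * (exp (- (Re z + 1) * ln (real (Suc n))) / Suc n)"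
proof -
  define m where "m = Suc n"
  define F where "F t = z * npow m (1 + z) * of_real t + exp (- z * of_real (ln t))" for t :: real
  define F' where "F' t = z * (npow m (1 + z) - exp (- (1 + z) * of_real (ln t)))" for t :: real
  define B where "B = norm z * norm (1 + z) * (exp (- (Re z + 1) * ln (real m)) / m)"
  have "(F has_vector_derivative F' t) (at t within {real m..real m + 1})" if "t \<in> {real m..real m + 1}" for t
  proof -
    have t: "t > 0" using that by (simp add: m_def)
    have "exp (- (1 + z) * of_real (ln t)) = exp (- z * of_real (ln t)) / of_real t"
      using t by (simp add: ring_distribs exp_diff exp_minus exp_of_real divide_inverse flip: of_real_minus)
    then have F': "F' t = z * npow m (1 + z) + (- z * of_real (1 / t)) * exp (- z * of_real (ln t))"
      by (simp add: F'_def algebra_simps)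
    have "((\<lambda>t. of_real (ln t) :: complex) has_vector_derivative of_real (1 / t)) (at t within {real m..real m + 1})"
      by (rule has_vector_derivative_of_real)
         (use DERIV_ln_divide[OF t] in \<open>auto intro: has_field_derivative_at_within\<close>)
    then have "((\<lambda>t. - z * of_real (ln t)) has_vector_derivative (- z * of_real (1 / t))) (at t within {real m..real m + 1})"
      by (rule has_vector_derivative_mult_right)
    then have "((exp \<circ> (\<lambda>t. - z * of_real (ln t))) has_vector_derivative (- z * of_real (1 / t)) * exp (- z * of_real (ln t)))
        (at t within {real m..real m + 1})"
      by (rule field_vector_diff_chain_within) (auto intro!: derivative_eq_intros)
    moreover have "((\<lambda>t. z * npow m (1 + z) * of_real t) has_vector_derivative z * npow m (1 + z) * of_real 1) (at t within {real m..real m + 1})"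
      by (intro has_vector_derivative_mult_right has_vector_derivative_of_real) (auto intro!: derivative_eq_intros)
    ultimately show ?thesis
      unfolding F_def F' o_def using has_vector_derivative_add by (simp only: of_real_1 mult_1_right) 
  qed
  then have "(F' has_integral (F (real m + 1) - F (real m))) {real m..real m + 1}"
    by (intro fundamental_theorem_of_calculus) auto
  moreover have "norm (F' t) \<le> B" if "t \<in> {real m..real m + 1}" for t
  proof -
    have "norm (F' t) \<le> norm z * (norm (1 + z) * (exp (- Re (1 + z) * ln (real m)) / m))"
      unfolding F'_def norm_mult using that assms
      by (intro mult_left_mono norm_npow_diff_le) (auto simp: m_def)
    then show ?thesis by (simp add: B_def add.commute mult.assoc)
  qed
  moreover have "B \<ge> 0" unfolding B_def by auto
  ultimately have "norm (F (real m + 1) - F (real m)) \<le> B * measure lborel {real m..real m + 1}"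
    by (intro has_integral_bound_real) auto
  moreover have "F (real m + 1) - F (real m) = zt_term n z"
    by (simp add: F_def zt_term_def npow_def m_def algebra_simps)
  ultimately show ?thesis by (simp add: B_def m_def)
qed

lemma summable_exp_ln: "c > 1 \<Longrightarrow> summable (\<lambda>n. exp (- c * ln (real (Suc n))))"
proof -
  assume c: "c > 1"
  then have "summable (\<lambda>n. real (Suc n) powr (- c))"
    by (subst summable_Suc_iff) (simp add: summable_real_powr_iff)
  then show ?thesis by (simp add: powr_def)
qed

lemma zt_sums:
  assumes "Re z > -1"
  shows "(\<lambda>n. zt_term n z) sums (zt z - 1)" "(\<lambda>n. zt_term' n z) sums zt' z"
    "(zt has_field_derivative zt' z) (at z)"
proof -
  define S where "S = {z. Re z > -1}"
  have S: "open S" unfolding S_def by (rule open_halfspace_Re_gt)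
  have "\<exists>g g'. \<forall>x \<in> S. ((\<lambda>n. zt_term n x) sums g x) \<and> ((\<lambda>n. zt_term' n x) sums g' x) \<and> (g has_field_derivative g' x) (at x)"
  proof (rule series_and_derivative_comparison_complex[OF S has_field_derivative_zt_term])
    fix x assume x: "x \<in> S"
    \<comment> \<open>Half the distance from \<open>x\<close> to the line Re z = -1: all y in the
      ball satisfy Re y + 1 >= d, which gives one majorant for the whole ball.\<close>
    define d where "d = (Re x + 1) / 2"
    have d: "d > 0" using x by (simp add: d_def S_def)
    define K where "K = (norm x + d) * (norm (1 + x) + d)"
    define h where "h n = complex_of_real (K * exp (- (d + 1) * ln (real (Suc n))))" for n
    have K: "K \<ge> 0" unfolding K_def using d by auto
    have "summable h"
      unfolding h_def summable_of_real_iff using d by (intro summable_mult summable_exp_ln) auto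
    moreover have "range h \<subseteq> \<real>\<^sub>\<ge>\<^sub>0" unfolding h_def using K by (auto simp: nonneg_Reals_of_real_iff)
    moreover have "norm (zt_term n y) \<le> norm (h n)" if y: "y \<in> ball x d \<inter> S" for y n
    proof -
      have 1: "norm (y - x) < d" using y by (simp add: dist_norm norm_minus_commute)
      then have 2: "norm y \<le> norm x + d" "norm (1 + y) \<le> norm (1 + x) + d"
        using norm_triangle_sub[of y x] norm_triangle_sub[of "1 + y" "1 + x"] by auto
      have "Re y \<ge> Re x - d" using abs_Re_le_cmod[of "y - x"] 1 by simp
      then have 3: "Re y + 1 \<ge> d" unfolding d_def by (simp add: field_simps)
      have "exp (- (Re y + 1) * ln (real (Suc n))) / Suc n = exp (- (Re y + 1) * ln (real (Suc n)) - ln (real (Suc n)))"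
        by (simp add: exp_diff)
      also have "\<dots> = exp (- (Re y + 1 + 1) * ln (real (Suc n)))" by (simp add: algebra_simps)
      also have "\<dots> \<le> exp (- (d + 1) * ln (real (Suc n)))"
        using 3 by (auto intro!: mult_right_mono)
      finally have 4: "exp (- (Re y + 1) * ln (real (Suc n))) / Suc n \<le> exp (- (d + 1) * ln (real (Suc n)))" .
      have "norm (zt_term n y) \<le> norm y * norm (1 + y) * (exp (- (Re y + 1) * ln (real (Suc n))) / Suc n)"
        using y by (intro norm_zt_term_le) (auto simp: S_def)
      also have "\<dots> \<le> K * exp (- (d + 1) * ln (real (Suc n)))"
        unfolding K_def using 2 4 d by (intro mult_mono) auto
      also have "\<dots> \<le> norm (h n)" unfolding h_def norm_of_real by simp
      finally show ?thesis .
    qed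
    ultimately show "\<exists>d h. 0 < d \<and> summable h \<and> range h \<subseteq> \<real>\<^sub>\<ge>\<^sub>0 \<and>
        (\<forall>\<^sub>F n in sequentially. \<forall>y\<in>ball x d \<inter> S. cmod (zt_term n y) \<le> cmod (h n))"
      using d by (intro exI[of _ d] exI[of _ h]) auto
  qed
  then obtain g g' where g: "\<And>x. x \<in> S \<Longrightarrow> (\<lambda>n. zt_term n x) sums g x"
    "\<And>x. x \<in> S \<Longrightarrow> (\<lambda>n. zt_term' n x) sums g' x" "\<And>x. x \<in> S \<Longrightarrow> (g has_field_derivative g' x) (at x)"
    by blast
  have zS: "z \<in> S" using assms by (simp add: S_def)
  have gz: "zt x = 1 + g x" if "x \<in> S" for x using g(1)[OF that] by (simp add: zt_def sums_iff)
  show "(\<lambda>n. zt_term n z) sums (zt z - 1)" using g(1)[OF zS] gz[OF zS] by simp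
  show "(\<lambda>n. zt_term' n z) sums zt' z" using g(2)[OF zS] by (simp add: zt'_def sums_iff)
  have g'z: "g' z = zt' z" using g(2)[OF zS] by (simp add: zt'_def sums_iff)
  have "((\<lambda>x. 1 + g x) has_field_derivative zt' z) (at z)"
    using g(3)[OF zS] unfolding g'z by (auto intro!: derivative_eq_intros)
  then show "(zt has_field_derivative zt' z) (at z)"
    by (rule has_field_derivative_transform_within_open[OF _ S zS]) (simp add: gz)
qed

lemma zt_0: "zt 0 = 1"
  by (simp add: zt_def zt_term_def)

text \<open>The constant Laurent coefficient of zeta at 1, and the point at which gamma enters the
  prime number theorem. At z = 0 the terms become 1/(n+1) + ln(n+1) - ln(n+2), a known series for
  gamma.\<close>

lemma zt'_0: "zt' 0 = euler_mascheroni"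
proof -
  have "zt_term' n 0 = of_real (inverse (of_nat (n+1)) + ln (of_nat (n+1)) - ln (of_nat (n+2)))" for n
    by (simp add: zt_term'_def npow_one inverse_eq_divide add.commute)
  then have "(\<lambda>n. zt_term' n 0) sums of_real euler_mascheroni"
    using euler_mascheroni_sum_real by (simp only: sums_of_real_iff)
  then show ?thesis using zt_sums(2)[of 0] sums_unique2 by fastforce
qed

section \<open>The Dirichlet series of zeta(1+z) and of its logarithmic derivative for Re z >
  0\<close>

definition zeta1 :: "complex \<Rightarrow> complex" where "zeta1 z = (\<Sum>n. npow (Suc n) (1 + z))"

lemma summable_norm_npow: "Re z > 0 \<Longrightarrow> summable (\<lambda>n. norm (npow (Suc n) (1 + z)))"
  using summable_exp_ln[of "1 + Re z"] by (simp add: norm_npow)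

lemma npow_tendsto_0: "Re z > 0 \<Longrightarrow> (\<lambda>n. npow (Suc n) z) \<longlonglongrightarrow> 0"
proof (rule tendsto_norm_zero_cancel)
  assume "Re z > 0"
  then show "(\<lambda>n. norm (npow (Suc n) z)) \<longlonglongrightarrow> 0" unfolding norm_npow by real_asymp
qed

text \<open>For Re z > 0 the two parts of \<open>zt_term\<close> can be summed separately; the
  second telescopes to 1 and cancels the 1 in \<open>zt\<close>.\<close>

lemma zt_eq_zeta1: "Re z > 0 \<Longrightarrow> zt z = z * zeta1 z"
proof -
  assume z: "Re z > 0"
  have "(\<lambda>n. npow (Suc n) (1 + z)) sums zeta1 z"
    unfolding zeta1_def using summable_norm_cancel[OF summable_norm_npow[OF z]] by (rule summable_sums)
  moreover have "(\<lambda>n. npow (Suc n) z - npow (Suc (Suc n)) z) sums (npow (Suc 0) z - 0)"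
    by (rule telescope_sums'[OF npow_tendsto_0[OF z]])
  ultimately have "(\<lambda>n. zt_term n z) sums (z * zeta1 z - (npow (Suc 0) z - 0))"
    using sums_diff[OF sums_mult] unfolding zt_term_def by simp
  with zt_sums(1)[of z] z have "zt z - 1 = z * zeta1 z - (npow (Suc 0) z - 0)"
    by (intro sums_unique2[of "\<lambda>n. zt_term n z"]) auto
  then show ?thesis by simp
qed


definition zeta1' :: "complex \<Rightarrow> complex" where
  "zeta1' z = (\<Sum>n. - of_real (ln (real (Suc n))) * npow (Suc n) (1 + z))"

lemma zeta1_sums:
  assumes z: "Re z > 0"
  shows "(\<lambda>n. npow (Suc n) (1 + z)) sums zeta1 z"
    "(\<lambda>n. - of_real (ln (real (Suc n))) * npow (Suc n) (1 + z)) sums zeta1' z"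
    "(zeta1 has_field_derivative zeta1' z) (at z)"
proof -
  define S where "S = {z. Re z > 0}"
  have S: "open S" unfolding S_def by (rule open_halfspace_Re_gt)
  have "\<exists>g g'. \<forall>x \<in> S. ((\<lambda>n. npow (Suc n) (1 + x)) sums g x) \<and>
      ((\<lambda>n. - of_real (ln (real (Suc n))) * npow (Suc n) (1 + x)) sums g' x) \<and> (g has_field_derivative g' x) (at x)"
  proof (rule series_and_derivative_comparison_complex[OF S])
    fix n :: nat and x :: complex
    show "((\<lambda>x. npow (Suc n) (1 + x)) has_field_derivative - of_real (ln (real (Suc n))) * npow (Suc n) (1 + x)) (at x)"
      by (auto intro!: derivative_eq_intros)
  next
    fix x assume x: "x \<in> S"
    define d where "d = Re x / 2"
    have d: "d > 0" using x by (simp add: d_def S_def)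
    define h where "h n = complex_of_real (exp (- (1 + d) * ln (real (Suc n))))" for n
    have "summable h"
      unfolding h_def summable_of_real_iff using d by (intro summable_exp_ln) auto
    moreover have "range h \<subseteq> \<real>\<^sub>\<ge>\<^sub>0" unfolding h_def by (auto simp: nonneg_Reals_of_real_iff)
    moreover have "norm (npow (Suc n) (1 + y)) \<le> norm (h n)" if y: "y \<in> ball x d \<inter> S" for y n
    proof -
      have "norm (y - x) < d" using y by (simp add: dist_norm norm_minus_commute)
      then have "Re y \<ge> d" using abs_Re_le_cmod[of "y - x"] unfolding d_def by simp
      then show ?thesis
        unfolding norm_npow h_def norm_of_real by (auto intro!: mult_right_mono)
    qed
    ultimately show "\<exists>d h. 0 < d \<and> summable h \<and> range h \<subseteq> \<real>\<^sub>\<ge>\<^sub>0 \<and>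
        (\<forall>\<^sub>F n in sequentially. \<forall>y\<in>ball x d \<inter> S. cmod (npow (Suc n) (1 + y)) \<le> cmod (h n))"
      using d by (intro exI[of _ d] exI[of _ h]) auto
  qed
  then obtain g g' where g: "\<And>x. x \<in> S \<Longrightarrow> (\<lambda>n. npow (Suc n) (1 + x)) sums g x"
    "\<And>x. x \<in> S \<Longrightarrow> (\<lambda>n. - of_real (ln (real (Suc n))) * npow (Suc n) (1 + x)) sums g' x"
    "\<And>x. x \<in> S \<Longrightarrow> (g has_field_derivative g' x) (at x)"
    by blast
  have zS: "z \<in> S" using assms by (simp add: S_def)
  have gz: "zeta1 x = g x" if "x \<in> S" for x using g(1)[OF that] by (simp add: zeta1_def sums_iff)
  show "(\<lambda>n. npow (Suc n) (1 + z)) sums zeta1 z" using g(1)[OF zS] gz[OF zS] by simp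
  have g'z: "g' z = zeta1' z" using g(2)[OF zS] by (simp add: zeta1'_def sums_iff)
  show "(\<lambda>n. - of_real (ln (real (Suc n))) * npow (Suc n) (1 + z)) sums zeta1' z"
    using g(2)[OF zS] g'z by simp
  show "(zeta1 has_field_derivative zeta1' z) (at z)"
    by (rule has_field_derivative_transform_within_open[OF _ S zS]) (use g(3)[OF zS] g'z gz in auto)
qed

text \<open>\<open>dlz z\<close> is $-(\zeta'/\zeta)(1+z)$.\<close>

definition dlz :: "complex \<Rightarrow> complex" where
  "dlz z = (\<Sum>n. mangoldt (Suc n) * npow (Suc n) (1 + z))"

lemma summable_norm_mangoldt_npow:
  assumes "Re z > 0"
  shows "summable (\<lambda>n. norm (mangoldt (Suc n) * npow (Suc n) (1 + z)))"
proof (rule summable_comparison_test')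
  \<comment> \<open>Half of Re z is spent on ln n <= n^d / d; the other half keeps the exponent
    above 1.\<close>
  define d where "d = Re z / 2"
  have d: "d > 0" using assms by (simp add: d_def)
  show "summable (\<lambda>n. 1 / d * exp (- (1 + d) * ln (real (Suc n))))"
    using d by (intro summable_mult summable_exp_ln) auto
  fix n :: nat
  define L where "L = ln (real (Suc n))"
  have L: "mangoldt (Suc n) \<le> L" using mangoldt_le[of "Suc n"] by (simp add: L_def)
  have "L \<le> 1 / d * exp (d * L)"
  proof -
    have "d * L \<le> exp (d * L)" using exp_ge_add_one_self[of "d * L"] by linarith
    then show ?thesis using d by (simp add: field_simps)
  qed
  with L have "mangoldt (Suc n) * exp (- Re (1 + z) * L) \<le> 1 / d * exp (d * L) * exp (- Re (1 + z) * L)"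
    by (intro mult_right_mono) auto
  also have "\<dots> = 1 / d * exp (- (1 + d) * L)"
    by (simp add: d_def algebra_simps flip: exp_add)
  finally show "norm (norm (mangoldt (Suc n) * npow (Suc n) (1 + z))) \<le> 1 / d * exp (- (1 + d) * ln (real (Suc n)))"
    by (simp add: norm_mult norm_npow L_def abs_mult)
qed

lemma dlz_sums: "Re z > 0 \<Longrightarrow> (\<lambda>n. mangoldt (Suc n) * npow (Suc n) (1 + z)) sums dlz z"
  unfolding dlz_def by (rule summable_sums[OF summable_norm_cancel[OF summable_norm_mangoldt_npow]])

text \<open>Passes from series to unordered sums, in which the double sum of a Dirichlet product can
  be regrouped freely.\<close>

lemma has_sum_Suc_of_norm_summable:
  fixes f :: "nat \<Rightarrow> complex"
  assumes "summable (\<lambda>n. norm (f (Suc n)))" "(\<lambda>n. f (Suc n)) sums s"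
  shows "(f has_sum s) {1..}" "(\<lambda>x. norm (f x)) summable_on {1..}"
proof -
  have r: "{1..} = range Suc" by (auto simp: image_iff Suc_le_eq gr0_conv_Suc)
  have "((\<lambda>n. f (Suc n)) has_sum s) UNIV"
    by (rule norm_summable_imp_has_sum[OF assms])
  then show "(f has_sum s) {1..}"
    unfolding r by (subst has_sum_reindex) (auto simp: o_def)
  have "(\<lambda>n. norm (f (Suc n))) summable_on UNIV"
    using norm_summable_imp_summable_on[of "\<lambda>n. norm (f (Suc n))"] assms(1) by simp
  then show "(\<lambda>x. norm (f x)) summable_on {1..}"
    unfolding r by (subst summable_on_reindex) (auto simp: o_def)
qed

text \<open>The Dirichlet convolution of \<open>mangoldt\<close> with 1 is ln: the absolutely
  summable family over pairs (d, k) is regrouped by n = d * k. The product form avoids dividing by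
  \<open>zeta1 z\<close>, not yet known to be nonzero.\<close>

lemma dlz_times_zeta1:
  assumes z: "Re z > 0"
  shows "dlz z * zeta1 z = - zeta1' z"
proof -
  define a b where "a n = mangoldt n * npow n (1 + z)" and "b n = npow n (1 + z)" for n
  have a: "(a has_sum dlz z) {1..}" "(\<lambda>x. norm (a x)) summable_on {1..}"
    unfolding a_def using has_sum_Suc_of_norm_summable[OF summable_norm_mangoldt_npow dlz_sums] z by auto
  have b: "(b has_sum zeta1 z) {1..}" "(\<lambda>x. norm (b x)) summable_on {1..}"
    unfolding b_def using has_sum_Suc_of_norm_summable[OF summable_norm_npow zeta1_sums(1)] z by auto
  have inner: "((\<lambda>k. a d * b k) has_sum a d * zeta1 z) {1..}" for d
    by (intro has_sum_cmult_right b)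
  have "((\<lambda>(d,k). a d * b k) has_sum (dlz z * zeta1 z)) ({1..} \<times> {1..})"
  proof (rule has_sum_SigmaI)
    show "((\<lambda>d. a d * zeta1 z) has_sum (dlz z * zeta1 z)) {1..}"
      by (intro has_sum_cmult_left a)
    have "infsum (\<lambda>k. norm (a d * b k)) {1..} = norm (a d) * infsum (\<lambda>k. norm (b k)) {1..}" for d
      unfolding norm_mult by (rule infsum_cmult_right') 
    moreover have "(\<lambda>d. norm (norm (a d) * infsum (\<lambda>k. norm (b k)) {1..})) summable_on {1..}"
      using summable_on_cmult_left[OF a(2)] by (simp add: abs_mult infsum_nonneg)
    moreover have "(\<lambda>k. norm (a d * b k)) summable_on {1..}" for d
      unfolding norm_mult by (intro summable_on_cmult_right b)
    ultimately have "(\<lambda>x. norm (case x of (d,k) \<Rightarrow> a d * b k)) summable_on ({1..} \<times> {1..})"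
      unfolding Infinite_Sum.abs_summable_on_Sigma_iff by simp
    then show "(\<lambda>(d,k). a d * b k) summable_on ({1..} \<times> {1..})"
      by (rule Infinite_Sum.abs_summable_summable)
  qed (use inner in auto)
  also have "?this \<longleftrightarrow> ((\<lambda>(n,d). mangoldt d * npow n (1 + z)) has_sum (dlz z * zeta1 z)) (SIGMA n:{1..}. {d. d dvd n})"
  proof (rule has_sum_reindex_bij_witness[where j = "\<lambda>(d,k). (d * k, d)" and i = "\<lambda>(n,d). (d, n div d)"])
    fix x :: "nat \<times> nat" assume "x \<in> {1..} \<times> {1..}"
    then show "(case case x of (d, k) \<Rightarrow> (d * k, d) of (n, d) \<Rightarrow> mangoldt d * npow n (1 + z)) = (case x of (d, k) \<Rightarrow> a d * b k)"
      by (auto simp: a_def b_def npow_mult Suc_le_eq)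
  qed (auto simp: Suc_le_eq dvd_imp_le intro: Nat.gr0I elim!: dvdE)
  finally have *: "((\<lambda>(n,d). mangoldt d * npow n (1 + z)) has_sum (dlz z * zeta1 z)) (SIGMA n:{1..}. {d. d dvd n})" .
  have "((\<lambda>n. of_real (ln (real n)) * npow n (1 + z)) has_sum (dlz z * zeta1 z)) {1..}"
  proof (rule has_sum_SigmaD[OF *])
    fix n :: nat assume n: "n \<in> {1..}"
    then have "finite {d. d dvd n}" by (intro finite_divisors_nat) auto
    then have "((\<lambda>d. mangoldt d * npow n (1 + z)) has_sum (\<Sum>d | d dvd n. mangoldt d * npow n (1 + z))) {d. d dvd n}"
      by (rule has_sum_finite)
    also have "(\<Sum>d | d dvd n. mangoldt d * npow n (1 + z)) = of_real (ln (real n)) * npow n (1 + z)"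
      using n mangoldt_sum[of n, where 'a = complex] by (simp flip: sum_distrib_right)
    finally show "((\<lambda>d. (case (n, d) of (n, d) \<Rightarrow> mangoldt d * npow n (1 + z))) has_sum of_real (ln (real n)) * npow n (1 + z)) {d. d dvd n}"
      by simp
  qed
  also have "{1..} = range Suc" by (auto simp: image_iff Suc_le_eq gr0_conv_Suc)
  finally have "((\<lambda>n. of_real (ln (real (Suc n))) * npow (Suc n) (1 + z)) has_sum (dlz z * zeta1 z)) UNIV"
    by (subst (asm) has_sum_reindex) (auto simp: o_def)
  then have "(\<lambda>n. of_real (ln (real (Suc n))) * npow (Suc n) (1 + z)) sums (dlz z * zeta1 z)"
    by (rule has_sum_imp_sums)
  from sums_minus[OF this] sums_unique2[OF zeta1_sums(2)[OF z]]
  have "zeta1' z = - (dlz z * zeta1 z)" by simp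
  then show ?thesis by simp
qed

text \<open>The logarithmic derivative of z zeta(1+z), in a product form that does not presuppose
  nonvanishing.\<close>

lemma zt'_eq: "Re z > 0 \<Longrightarrow> zt' z = zt z * (1 / z - dlz z)"
proof -
  assume z: "Re z > 0"
  define S where "S = {z. Re z > 0}"
  have S: "open S" "z \<in> S" unfolding S_def using z by (auto intro: open_halfspace_Re_gt)
  have z0: "z \<noteq> 0" using z by auto
  have "((\<lambda>z. z * zeta1 z) has_field_derivative zeta1 z + z * zeta1' z) (at z)"
    using zeta1_sums(3)[OF z] by (auto intro!: derivative_eq_intros)
  then have "(zt has_field_derivative zeta1 z + z * zeta1' z) (at z)"
    by (rule has_field_derivative_transform_within_open[OF _ S]) (simp add: S_def zt_eq_zeta1)
  then have "zt' z = zeta1 z + z * zeta1' z"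
    using DERIV_unique zt_sums(3)[of z] z by force
  also have "zeta1' z = - (dlz z * zeta1 z)" using dlz_times_zeta1[OF z] by simp
  also have "zeta1 z + z * - (dlz z * zeta1 z) = (z * zeta1 z) * (1 / z - dlz z)"
    using z0 by (simp add: algebra_simps)
  finally show ?thesis by (simp add: zt_eq_zeta1[OF z])
qed

section \<open>Orders of zeros and nonvanishing on the closed half plane\<close>

lemma holomorphic_zt: "zt holomorphic_on {z. Re z > -1}"
  using zt_sums(3) by (intro holomorphic_onI) (auto simp: field_differentiable_def intro: has_field_derivative_at_within)

lemma holomorphic_zt': "zt' holomorphic_on {z. Re z > -1}"
proof -
  have "deriv zt holomorphic_on {z. Re z > -1}"
    by (intro holomorphic_deriv holomorphic_zt open_halfspace_Re_gt)
  then show ?thesis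
    by (rule holomorphic_transform) (use zt_sums(3) in \<open>auto intro: DERIV_imp_deriv\<close>)
qed

text \<open>If f = (z - z0)^m g with g z0 nonzero, then f'/f = m/(z - z0) + g'/g, so the scaled
  limit reads off the order of vanishing. The point is approached from the right only, where the
  Dirichlet series are available.\<close>

lemma logderiv_limit_order:
  assumes f: "f holomorphic_on S" "open S" "connected S" "\<not> f constant_on S" "z0 \<in> S"
    and der: "\<And>z. z \<in> S \<Longrightarrow> (f has_field_derivative f' z) (at z)"
  shows "\<exists>m::nat. (m = 0 \<longleftrightarrow> f z0 \<noteq> 0) \<and> (\<forall>\<^sub>F e in at_right (0::real). f (z0 + of_real e) \<noteq> 0) \<and>
     ((\<lambda>e. of_real e * (f' (z0 + of_real e) / f (z0 + of_real e))) \<longlongrightarrow> of_nat m) (at_right (0::real))"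
proof (cases "f z0 = 0")
  case False
  have f': "f' holomorphic_on S"
    by (rule holomorphic_transform[OF holomorphic_deriv[OF f(1,2)]]) (use der in \<open>auto intro: DERIV_imp_deriv\<close>)
  have "isCont f z0" "isCont f' z0"
    using f(5) holomorphic_on_imp_continuous_on[OF f(1)] holomorphic_on_imp_continuous_on[OF f']
    by (simp_all add: continuous_on_eq_continuous_at[OF f(2)])
  then have "((\<lambda>e. of_real e * (f' (z0 + of_real e) / f (z0 + of_real e))) \<longlongrightarrow> of_real 0 * (f' (z0 + of_real 0) / f (z0 + of_real 0))) (at_right (0::real))"
    using False by (intro tendsto_intros isCont_tendsto_compose[of _ f'] isCont_tendsto_compose[of _ f]) auto
  moreover have "((\<lambda>e. f (z0 + of_real e)) \<longlongrightarrow> f (z0 + of_real 0)) (at_right (0::real))"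
    using \<open>isCont f z0\<close> by (intro isCont_tendsto_compose[of _ f] tendsto_intros) auto
  then have "\<forall>\<^sub>F e in at_right (0::real). f (z0 + of_real e) \<noteq> 0"
    using False by (intro tendsto_imp_eventually_ne) auto
  ultimately show ?thesis using False by (intro exI[of _ 0]) auto
next
  case True
  obtain g r n where g: "0 < n" "0 < r" "ball z0 r \<subseteq> S" "g holomorphic_on ball z0 r"
     "\<And>w. w \<in> ball z0 r \<Longrightarrow> f w = (w - z0)^n * g w" "\<And>w. w \<in> ball z0 r \<Longrightarrow> g w \<noteq> 0"
    using holomorphic_factor_zero_nonconstant[OF f(1,2,3,5) True f(4)] by metis
  have dg: "deriv g holomorphic_on ball z0 r" using g by (intro holomorphic_deriv) auto
  have cont: "isCont g z0" "isCont (deriv g) z0"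
    using g dg holomorphic_on_imp_continuous_on[of _ "ball z0 r"]
    by (auto simp: continuous_on_eq_continuous_at)
  have eq: "(w - z0) * (f' w / f w) = of_nat n + (w - z0) * (deriv g w / g w)"
    if w: "w \<in> ball z0 r" "w \<noteq> z0" for w
  proof -
    have "(g has_field_derivative deriv g w) (at w)"
      using g(4) w holomorphic_derivI open_ball by blast
    then have "((\<lambda>w. (w - z0)^n * g w) has_field_derivative (of_nat n * (w - z0)^(n-1)) * g w + (w - z0)^n * deriv g w) (at w)"
      by (auto intro!: derivative_eq_intros)
    then have "(f has_field_derivative (of_nat n * (w - z0)^(n-1)) * g w + (w - z0)^n * deriv g w) (at w)"
      by (rule has_field_derivative_transform_within_open[OF _ open_ball w(1)]) (use g(5) in auto)
    then have f'w: "f' w = (of_nat n * (w - z0)^(n-1)) * g w + (w - z0)^n * deriv g w"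
      using DERIV_unique der w g(3) by blast
    define D where "D = w - z0"
    define P where "P = (w - z0) ^ (n - 1)"
    have DP: "D \<noteq> 0" "P \<noteq> 0" "g w \<noteq> 0" using w g(6) by (auto simp: D_def P_def)
    have pow: "(w - z0) ^ n = D * P" using g(1) by (simp add: D_def P_def flip: power_Suc)
    have "f w = P * (D * g w)" using g(5)[OF w(1)] pow by simp
    moreover have "f' w = P * (of_nat n * g w + D * deriv g w)"
      using f'w unfolding pow P_def [symmetric] by (simp add: algebra_simps)
    ultimately have "D * (f' w / f w) = of_nat n + D * (deriv g w / g w)"
      using DP by (simp add: field_simps)
    then show ?thesis by (simp add: D_def)
  qed
  have "((\<lambda>e. of_nat n + of_real e * (deriv g (z0 + of_real e) / g (z0 + of_real e))) \<longlongrightarrow>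
      of_nat n + of_real 0 * (deriv g (z0 + of_real 0) / g (z0 + of_real 0))) (at_right (0::real))"
    using cont g(2) g(6)[of z0] by (intro tendsto_intros isCont_tendsto_compose[of _ "deriv g"] isCont_tendsto_compose[of _ g]) auto
  moreover have "eventually (\<lambda>e. of_nat n + of_real e * (deriv g (z0 + of_real e) / g (z0 + of_real e)) =
      of_real e * (f' (z0 + of_real e) / f (z0 + of_real e))) (at_right (0::real))"
    unfolding eventually_at_right_field
  proof (intro exI[of _ r] conjI allI impI)
    fix e :: real assume "0 < e" "e < r"
    then show "of_nat n + of_real e * (deriv g (z0 + of_real e) / g (z0 + of_real e)) =
      of_real e * (f' (z0 + of_real e) / f (z0 + of_real e))"
      using eq[of "z0 + of_real e"] by (simp add: dist_norm)
  qed (use g in auto)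
  ultimately have "((\<lambda>e. of_real e * (f' (z0 + of_real e) / f (z0 + of_real e))) \<longlongrightarrow> of_nat n) (at_right (0::real))"
    using tendsto_cong by force
  moreover have "\<forall>\<^sub>F e in at_right (0::real). f (z0 + of_real e) \<noteq> 0"
    unfolding eventually_at_right_field
  proof (intro exI[of _ r] conjI allI impI)
    fix e :: real assume "0 < e" "e < r"
    then show "f (z0 + of_real e) \<noteq> 0"
      using g(5,6)[of "z0 + of_real e"] by (simp add: dist_norm)
  qed (use g in auto)
  ultimately show ?thesis using True g(1) by (intro exI[of _ n]) auto
qed

text \<open>Ensures that zeros have finite order. A constant function would have zt' 0 = 0, whereas
  zt' 0 = gamma > 0.\<close>

lemma zt_not_constant: "\<not> zt constant_on {z. Re z > -1}"
proof
  assume "zt constant_on {z. Re z > -1}"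
  then obtain c where c: "\<And>z. Re z > -1 \<Longrightarrow> zt z = c" unfolding constant_on_def by auto
  have "(zt has_field_derivative 0) (at 0)"
    by (rule has_field_derivative_transform_within_open[OF DERIV_const open_halfspace_Re_gt[of "-1"]])
       (use c in auto)
  then have "zt' 0 = 0" using zt_sums(3)[of 0] DERIV_unique by force
  then have "complex_of_real euler_mascheroni = 0" unfolding zt'_0 by simp
  then show False using euler_mascheroni_pos unfolding of_real_eq_0_iff by simp
qed

text \<open>The limit is the residue of -(zeta'/zeta)(1+z) at z0: the pole of zeta contributes 1, a
  zero of order m contributes -m.\<close>

lemma dlz_limit:
  assumes z0: "Re z0 \<ge> 0"
  shows "\<exists>m::nat. (m = 0 \<longleftrightarrow> zt z0 \<noteq> 0) \<and>
    ((\<lambda>e. of_real e * dlz (z0 + of_real e)) \<longlongrightarrow> (if z0 = 0 then 1 else 0) - of_nat m) (at_right (0::real))"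
proof -
  obtain m :: nat where m: "m = 0 \<longleftrightarrow> zt z0 \<noteq> 0" "\<forall>\<^sub>F e in at_right (0::real). zt (z0 + of_real e) \<noteq> 0"
     "((\<lambda>e. of_real e * (zt' (z0 + of_real e) / zt (z0 + of_real e))) \<longlongrightarrow> of_nat m) (at_right (0::real))"
    using logderiv_limit_order[OF holomorphic_zt open_halfspace_Re_gt _ zt_not_constant, of z0 zt'] z0
      zt_sums(3) convex_connected[OF convex_halfspace_Re_gt] by auto
  have "((\<lambda>e. of_real e * (1 / (z0 + of_real e))) \<longlongrightarrow> (if z0 = 0 then 1 else 0)) (at_right (0::real))"
  proof (cases "z0 = 0")
    case True
    have "\<forall>\<^sub>F e in at_right (0::real). 1 = of_real e * (1 / (z0 + of_real e))"
      unfolding eventually_at_right_field using True by (intro exI[of _ 1]) auto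
    then have "((\<lambda>e. of_real e * (1 / (z0 + of_real e))) \<longlongrightarrow> 1) (at_right (0::real))"
      by (rule Lim_transform_eventually[OF tendsto_const])
    then show ?thesis using True by simp
  next
    case False
    have "((\<lambda>e. of_real e * (1 / (z0 + of_real e))) \<longlongrightarrow> of_real 0 * (1 / (z0 + of_real 0))) (at_right (0::real))"
      using False by (intro tendsto_intros) auto
    then show ?thesis using False by simp
  qed
  from tendsto_diff[OF this m(3)]
  have "((\<lambda>e. of_real e * (1 / (z0 + of_real e)) - of_real e * (zt' (z0 + of_real e) / zt (z0 + of_real e)))
      \<longlongrightarrow> (if z0 = 0 then 1 else 0) - of_nat m) (at_right (0::real))" .
  moreover have "\<forall>\<^sub>F e in at_right (0::real). of_real e * (1 / (z0 + of_real e)) - of_real e * (zt' (z0 + of_real e) / zt (z0 + of_real e))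
      = of_real e * dlz (z0 + of_real e)"
    using m(2) eventually_at_right_less
  proof eventually_elim
    case (elim e)
    have "zt' (z0 + of_real e) = zt (z0 + of_real e) * (1 / (z0 + of_real e) - dlz (z0 + of_real e))"
      using elim z0 by (intro zt'_eq) auto
    then have "zt' (z0 + of_real e) / zt (z0 + of_real e) = 1 / (z0 + of_real e) - dlz (z0 + of_real e)"
      using elim by simp
    then show ?case by (simp only: right_diff_distrib) simp
  qed
  ultimately have "((\<lambda>e. of_real e * dlz (z0 + of_real e)) \<longlongrightarrow> (if z0 = 0 then 1 else 0) - of_nat m) (at_right (0::real))"
    by (rule Lim_transform_eventually)
  with m(1) show ?thesis by (intro exI[of _ m] conjI)
qed

text \<open>Mertens' inequality 3 + 4 cos x + cos 2x = 2 (1 + cos x)^2 >= 0, applied to each term of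
  the series.\<close>

lemma dlz_3_4_1:
  assumes e: "e > 0"
  shows "0 \<le> 3 * Re (dlz (of_real e)) + 4 * Re (dlz (\<i> * of_real y + of_real e)) + Re (dlz (\<i> * of_real (2 * y) + of_real e))"
proof -
  define t where "t x n = mangoldt (Suc n) * (exp (- (1 + e) * ln (real (Suc n))) * cos (x * ln (real (Suc n))))" for x :: real and n
  have t: "t x sums Re (dlz (\<i> * of_real x + of_real e))" for x
  proof -
    have "(\<lambda>n. Re (mangoldt (Suc n) * npow (Suc n) (1 + (\<i> * of_real x + of_real e)))) sums Re (dlz (\<i> * of_real x + of_real e))"
      using e by (intro sums_Re dlz_sums) auto
    moreover have "Re (mangoldt (Suc n) * npow (Suc n) (1 + (\<i> * of_real x + of_real e))) = t x n" for n
      by (simp add: t_def npow_def Re_exp)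
    ultimately show ?thesis by simp
  qed
  have S: "(\<lambda>n. 3 * t 0 n + 4 * t y n + t (2 * y) n) sums
     (3 * Re (dlz (\<i> * of_real 0 + of_real e)) + 4 * Re (dlz (\<i> * of_real y + of_real e)) + Re (dlz (\<i> * of_real (2 * y) + of_real e)))"
    by (intro sums_add sums_mult t)
  have P: "0 \<le> 3 * t 0 n + 4 * t y n + t (2 * y) n" for n
  proof -
    define c where "c = cos (y * ln (real (Suc n)))"
    have cd: "cos (2 * y * ln (real (Suc n))) = 2 * c^2 - 1"
      using cos_double_cos[of "y * ln (real (Suc n))"] by (simp add: c_def mult.assoc)
    then have "3 * t 0 n + 4 * t y n + t (2 * y) n =
        mangoldt (Suc n) * exp (- (1 + e) * ln (real (Suc n))) * (2 * (1 + c)^2)"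
      unfolding t_def cd c_def [symmetric] by (simp add: algebra_simps power2_eq_square)
    then show ?thesis by (simp add: mangoldt_nonneg)
  qed
  from sums_le[OF P sums_zero S] show ?thesis by simp
qed

text \<open>Let m be the order of vanishing at z. For Re z > 0 the values of \<open>dlz\<close> to
  the right of z are bounded, so m = 0. For z = i y with y nonzero, the scaled limit of the 3-4-1
  inequality reads 3 - 4 m - m' >= 0, with m' the order at 2 i y, and again m = 0.\<close>

lemma zt_nonzero:
  assumes z: "Re z \<ge> 0"
  shows "zt z \<noteq> 0"
proof (cases "z = 0")
  case True
  then show ?thesis by (simp add: zt_0)
next
  case z0: False
  obtain m :: nat where m: "m = 0 \<longleftrightarrow> zt z \<noteq> 0"
    "((\<lambda>e. of_real e * dlz (z + of_real e)) \<longlongrightarrow> - of_nat m) (at_right (0::real))"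
    using dlz_limit[OF z] z0 by auto
  have "m = 0"
  proof (cases "Re z = 0")
    case False
    then have x: "Re z > 0" using z by simp
    define B where "B = (\<Sum>n. norm (mangoldt (Suc n) * npow (Suc n) (1 + z)))"
    have B: "norm (dlz (z + of_real e)) \<le> B" if "e > 0" for e
      unfolding dlz_def B_def
    proof (rule norm_suminf_le[OF _ summable_norm_mangoldt_npow[OF x]])
      fix n
      show "norm (mangoldt (Suc n) * npow (Suc n) (1 + (z + of_real e))) \<le> norm (mangoldt (Suc n) * npow (Suc n) (1 + z))"
        unfolding norm_mult norm_npow using that by (intro mult_left_mono) (auto intro!: mult_right_mono mangoldt_nonneg)
    qed
    have "((\<lambda>e. of_real e * dlz (z + of_real e)) \<longlongrightarrow> 0) (at_right (0::real))"
    proof (rule Lim_null_comparison)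
      show "\<forall>\<^sub>F e in at_right (0::real). norm (of_real e * dlz (z + of_real e)) \<le> e * B"
        using eventually_at_right_less
        by eventually_elim (use B in \<open>auto simp: norm_mult intro!: mult_left_mono\<close>)
      have "((\<lambda>e. e * B) \<longlongrightarrow> 0 * B) (at_right (0::real))" by (intro tendsto_intros)
      then show "((\<lambda>e. e * B) \<longlongrightarrow> 0) (at_right (0::real))" by simp
    qed
    from tendsto_unique[OF _ m(2) this] show ?thesis by simp
  next
    case True
    define y where "y = Im z"
    have zy: "z = \<i> * of_real y" using True by (simp add: complex_eq_iff y_def)
    have y: "y \<noteq> 0" using z0 zy by auto
    have l0: "((\<lambda>e. of_real e * dlz (0 + of_real e)) \<longlongrightarrow> 1) (at_right (0::real))"
      using dlz_limit[of 0] by (auto simp: zt_0)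
    obtain m' :: nat where m': "((\<lambda>e. of_real e * dlz (\<i> * of_real (2 * y) + of_real e)) \<longlongrightarrow> - of_nat m') (at_right (0::real))"
      using dlz_limit[of "\<i> * of_real (2 * y)"] y by auto
    have "((\<lambda>e. 3 * Re (of_real e * dlz (0 + of_real e)) + 4 * Re (of_real e * dlz (\<i> * of_real y + of_real e)) +
        Re (of_real e * dlz (\<i> * of_real (2 * y) + of_real e))) \<longlongrightarrow> 3 * Re 1 + 4 * Re (- of_nat m) + Re (- of_nat m')) (at_right (0::real))"
      using m(2) unfolding zy by (intro tendsto_intros l0 m')
    moreover have "\<forall>\<^sub>F e in at_right (0::real). 0 \<le> 3 * Re (of_real e * dlz (0 + of_real e)) + 4 * Re (of_real e * dlz (\<i> * of_real y + of_real e)) +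
        Re (of_real e * dlz (\<i> * of_real (2 * y) + of_real e))"
      using eventually_at_right_less
    proof eventually_elim
      case (elim e)
      have "0 \<le> e * (3 * Re (dlz (of_real e)) + 4 * Re (dlz (\<i> * of_real y + of_real e)) + Re (dlz (\<i> * of_real (2 * y) + of_real e)))"
        using elim dlz_3_4_1[OF elim, of y] by (intro mult_nonneg_nonneg) auto
      then show ?case by (simp add: algebra_simps)
    qed
    ultimately have "0 \<le> 3 * Re 1 + 4 * Re (- of_nat m :: complex) + Re (- of_nat m' :: complex)"
      by (rule tendsto_lowerbound) auto
    then have "4 * real m + real m' \<le> 3" by simp
    then show ?thesis by linarith
  qed
  with m(1) show ?thesis by simp
qed

section \<open>The prime number theorem\<close>

text \<open>The second hypothesis limits how fast \<open>a\<close> can fall: if a n >= 2 e, then a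
  stays above e until ln has grown by e, a stretch that contributes about e^2 to a convergent
  series. If a n <= -2 e, the stretch preceding n is used instead.\<close>

lemma slowly_decreasing_tendsto_0:
  fixes a :: "nat \<Rightarrow> real"
  assumes sum: "summable (\<lambda>n. a n * (ln (real (n + 2)) - ln (real (n + 1))))"
    and inc: "\<And>m n. m \<le> n \<Longrightarrow> a m + ln (real (m + 1)) \<le> a n + ln (real (n + 1))"
  shows "a \<longlonglongrightarrow> 0"
proof (rule LIMSEQ_I)
  fix r :: real assume r: "r > 0"
  define e where "e = r / 2"
  have e: "e > 0" using r by (simp add: e_def)
  define L where "L n = ln (real (n + 1))" for n
  have Lmono: "L m \<le> L n" if "m \<le> n" for m n using that by (simp add: L_def)
  have Lstep: "L (Suc n) - L n \<le> 1 / real (n + 1)" for n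
  proof -
    have "L (Suc n) - L n = ln (1 + 1 / real (n + 1))"
    proof -
      have "1 + 1 / real (n + 1) = real (Suc n + 1) / real (n + 1)" by (simp add: field_simps)
      then show ?thesis unfolding L_def by (simp add: ln_div)
    qed
    also have "\<dots> \<le> 1 / real (n + 1)" by (intro ln_add_one_self_le_self) auto
    finally show ?thesis .
  qed
  have Ltop: "\<exists>n. L n \<ge> x" for x
  proof -
    have "filterlim L at_top sequentially" unfolding L_def by real_asymp
    then have "eventually (\<lambda>n. L n \<ge> x) sequentially" by (simp add: filterlim_at_top)
    then show ?thesis by (auto simp: eventually_sequentially)
  qed
  have "e^2 / 2 > 0" using e by simp
  moreover have "summable (\<lambda>i. a i * (L (Suc i) - L i))"
    using sum unfolding L_def by (simp add: add_ac)
  ultimately obtain N0 where N0: "\<forall>m\<ge>N0. \<forall>n. norm (\<Sum>i\<in>{m..<n}. a i * (L (Suc i) - L i)) < e^2 / 2"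
    unfolding summable_Cauchy by blast
  \<comment> \<open>\<open>N1\<close> keeps the stretch before n beyond \<open>N0\<close>;
    \<open>N2\<close>, reached through \<open>N3\<close> in the same way, makes single steps of
    \<open>L\<close> on it at most e / 2.\<close>
  obtain N1 where N1: "L N1 \<ge> L N0 + e" using Ltop by blast
  obtain N2 where N2: "2 / e \<le> real N2" using real_arch_simple by blast
  obtain N3 where N3: "L N3 \<ge> L N2 + e" using Ltop by blast
  have tele: "(\<Sum>i\<in>{m..<n}. L (Suc i) - L i) = L n - L m" if "m \<le> n" for m n
    using sum_Suc_diff'[OF that] .
  show "\<exists>no. \<forall>n\<ge>no. norm (a n - 0) < r"
  proof (intro exI allI impI)
    fix n assume n: "n \<ge> max N0 (max N1 N3)"
    have up: "a n < r"
    proof (rule ccontr)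
      assume "\<not> a n < r"
      then have an: "a n \<ge> 2 * e" by (simp add: e_def)
      define m where "m = (LEAST m. L m \<ge> L n + e)"
      have m: "L m \<ge> L n + e" unfolding m_def using Ltop by (rule LeastI_ex)
      have nm: "n \<le> m" using m e Lmono[of m n] by (cases "n \<le> m") auto
      have "e * (L m - L n) = (\<Sum>i\<in>{n..<m}. e * (L (Suc i) - L i))"
        using tele[OF nm] by (simp flip: sum_distrib_left)
      also have "\<dots> \<le> (\<Sum>i\<in>{n..<m}. a i * (L (Suc i) - L i))"
      proof (intro sum_mono mult_right_mono)
        fix i assume i: "i \<in> {n..<m}"
        then have "\<not> L i \<ge> L n + e" unfolding m_def using not_less_Least by auto
        then show "e \<le> a i" using inc[of n i] i an unfolding L_def by auto
      qed (use Lmono in auto)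
      also have "\<dots> < e^2 / 2" using N0[rule_format, of n m] n by auto
      finally have "e * (L m - L n) < e^2 / 2" .
      moreover have "e * e \<le> e * (L m - L n)" using m e by (intro mult_left_mono) auto
      ultimately show False using e by (simp add: power2_eq_square)
    qed
    have low: "a n > - r"
    proof (rule ccontr)
      assume "\<not> a n > - r"
      then have an: "a n \<le> - 2 * e" by (simp add: e_def)
      define m where "m = (LEAST m. L m \<ge> L n - e)"
      have "\<exists>m. L m \<ge> L n - e" by (rule exI[of _ n]) (use e in auto)
      then have m: "L m \<ge> L n - e" unfolding m_def by (rule LeastI_ex)
      have mn: "m \<le> n" unfolding m_def by (rule Least_le) (use e in auto)
      have "L n \<ge> L N0 + e" "L n \<ge> L N2 + e" using N1 N3 Lmono[of N1 n] Lmono[of N3 n] n by auto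
      then have "L N0 \<le> L m" "L N2 \<le> L m" using m by auto
      then have mN: "N0 \<le> m" "N2 \<le> m" by (auto simp: L_def)
      have "m \<noteq> 0" using mN N2 e by (cases N2) (auto simp: field_simps)
      then obtain k where k: "m = Suc k" by (cases m) auto
      have "\<not> L k \<ge> L n - e" using not_less_Least[of k "\<lambda>m. L m \<ge> L n - e"] k by (simp flip: m_def)
      moreover have "1 / real (k + 1) \<le> e / 2"
      proof -
        have "2 / e \<le> real (k + 1)" using N2 mN k by linarith
        then show ?thesis using e by (simp add: field_simps)
      qed
      \<comment> \<open>By minimality the predecessor of m lies below L n - e, and one step adds at
        most e / 2. The stretch thus has length at least e / 2, and the sum over it has absolute
        value at least e^2 / 2, contradicting the Cauchy bound.\<close>
      ultimately have "L m \<le> L n - e / 2" using Lstep[of k] k by auto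
      then have "e * (e / 2) \<le> e * (L n - L m)" using e by (intro mult_left_mono) auto
      also have "\<dots> = (\<Sum>i\<in>{m..<n}. e * (L (Suc i) - L i))"
        using tele[OF mn] by (simp flip: sum_distrib_left)
      also have "\<dots> \<le> (\<Sum>i\<in>{m..<n}. - a i * (L (Suc i) - L i))"
      proof (intro sum_mono mult_right_mono)
        fix i assume i: "i \<in> {m..<n}"
        then have "L i \<ge> L n - e" using m Lmono[of m i] by auto
        then show "e \<le> - a i" using inc[of i n] i an unfolding L_def by auto
      qed (use Lmono in auto)
      also have "\<dots> = - (\<Sum>i\<in>{m..<n}. a i * (L (Suc i) - L i))" by (simp add: sum_negf)
      also have "\<dots> < e^2 / 2" using N0[rule_format, of m n] mN by auto
      finally show False by (simp add: power2_eq_square)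
    qed
    show "norm (a n - 0) < r" using up low by auto
  qed
qed

text \<open>Abel summation: passing from coefficients to their partial sums divides the transform by
  z. The boundary term vanishes because the partial sums are bounded and \<open>npow\<close> tends
  to 0.\<close>

lemma sums_weighted_partial_sums:
  fixes c :: "nat \<Rightarrow> real"
  assumes z: "Re z > 0" and bd: "\<And>n. \<bar>\<Sum>m<n. c m\<bar> \<le> C"
    and F: "(\<lambda>n. of_real (c n) * npow (Suc n) z) sums F"
  shows "(\<lambda>n. of_real (\<Sum>m<Suc n. c m) * wt (Suc n) z) sums (F / z)"
proof -
  define b where "b n = npow (Suc n) z" for n
  have parts: "(\<Sum>n<N. of_real (\<Sum>m<Suc n. c m) * (b n - b (Suc n))) =
      (\<Sum>n<N. of_real (c n) * b n) - of_real (\<Sum>m<N. c m) * b N" for N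
    by (induction N) (simp_all add: algebra_simps)
  have "(\<lambda>N. of_real (\<Sum>m<N. c m) * b N) \<longlonglongrightarrow> 0"
  proof (rule Lim_null_comparison)
    show "\<forall>\<^sub>F n in sequentially. norm (of_real (\<Sum>m<n. c m) * b n) \<le> C * norm (b n)"
      unfolding norm_mult norm_of_real using bd by (intro always_eventually allI mult_right_mono) auto
    have "(\<lambda>n. C * norm (b n)) \<longlonglongrightarrow> C * norm (0::complex)"
      unfolding b_def by (intro tendsto_intros npow_tendsto_0 z)
    then show "(\<lambda>n. C * norm (b n)) \<longlonglongrightarrow> 0" by simp
  qed
  then have "(\<lambda>N. (\<Sum>n<N. of_real (c n) * b n) - of_real (\<Sum>m<N. c m) * b N) \<longlonglongrightarrow> F - 0"
    using F unfolding sums_def b_def by (intro tendsto_diff)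
  then have "(\<lambda>n. of_real (\<Sum>m<Suc n. c m) * (b n - b (Suc n))) sums F"
    unfolding sums_def parts by simp
  then have "(\<lambda>n. of_real (\<Sum>m<Suc n. c m) * (b n - b (Suc n)) / z) sums (F / z)"
    by (rule sums_divide)
  moreover have "z \<noteq> 0" using z by auto
  ultimately show ?thesis by (simp add: wt_def b_def)
qed

theorem mangoldt_harm_asymp: "(\<lambda>n. mangoldt_harm n - ln (real n)) \<longlonglongrightarrow> - euler_mascheroni"
proof -
  define \<gamma> where "\<gamma> = (euler_mascheroni :: real)"
  \<comment> \<open>The series of (Lambda(n) - 1) / n^(1+z) is -(zeta'/zeta)(1+z) - zeta(1+z), which
    tends to -2 gamma at 0. Adding 2 gamma to the coefficient of index 0 makes
    \<open>P 0 = 0\<close>, so that P z / z has no pole there.\<close>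
  define c where "c n = (mangoldt (Suc n) - 1) / real (Suc n) + (if n = 0 then 2 * \<gamma> else 0)" for n
  define a where "a n = (\<Sum>m<Suc n. c m)" for n
  have Suc_sum: "(\<Sum>m=1..n. f m) = (\<Sum>m<n. f (Suc m))" for f :: "nat \<Rightarrow> real" and n
    by (rule sum.reindex_bij_witness[of _ Suc "\<lambda>m. m - 1"]) auto
  have csum: "(\<Sum>m<n. c m) = mangoldt_harm n - harm n + 2 * \<gamma>" if "n > 0" for n
  proof -
    have "(\<Sum>m<n. c m) = (\<Sum>m<n. mangoldt (Suc m) / real (Suc m) - inverse (real (Suc m))) + (\<Sum>m<n. if m = 0 then 2 * \<gamma> else 0)"
      unfolding c_def sum.distrib by (simp add: diff_divide_distrib inverse_eq_divide)
    also have "(\<Sum>m<n. if m = 0 then 2 * \<gamma> else 0) = 2 * \<gamma>" using that by (simp add: sum.delta)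
    also have "(\<Sum>m<n. mangoldt (Suc m) / real (Suc m) - inverse (real (Suc m))) = mangoldt_harm n - harm n"
      unfolding mangoldt_harm_def harm_def Suc_sum sum_subtractf ..
    finally show ?thesis .
  qed
  have a: "a n = mangoldt_harm (Suc n) - harm (Suc n) + 2 * \<gamma>" for n
    unfolding a_def by (rule csum) simp
  have \<gamma>: "0 \<le> \<gamma>" "\<gamma> \<le> 1"
    using euler_mascheroni_pos euler_mascheroni_less_13_over_22 unfolding \<gamma>_def by auto
  have harm: "0 \<le> harm n - ln (real n)" "harm n - ln (real n) \<le> 1" if "n > 0" for n :: nat
    using that euler_mascheroni_sequence_nonneg[of n] euler_mascheroni_sequence_decreasing[of 1 n] by (auto simp: harm_def)
  \<comment> \<open>7 = 4 + 1 + 2: Mertens' bound, the range of harm n - ln n, and 2 gamma <=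
    2.\<close>
  have bd: "\<bar>\<Sum>m<n. c m\<bar> \<le> 7" for n
  proof (cases "n = 0")
    case False
    then show ?thesis
      using csum[of n] mertens_first[of n] harm[of n] \<gamma> by auto
  qed auto
  \<comment> \<open>Open by continuity of \<open>zt\<close>, and containing the closed right half
    plane by \<open>zt_nonzero\<close>: the domain that \<open>newman\<close> asks for.\<close>
  define S where "S = {z. Re z > -1} \<inter> {z. zt z \<noteq> 0}"
  have "continuous_on {z. Re z > -1} zt" by (intro holomorphic_on_imp_continuous_on holomorphic_zt)
  then have "open ({z. Re z > -1} \<inter> zt -` (- {0}))"
    by (intro continuous_open_preimage) (auto intro: open_halfspace_Re_gt)
  then have S: "open S" unfolding S_def by (simp add: vimage_def Collect_conj_eq)
  have S0: "{z. Re z \<ge> 0} \<subseteq> S" using zt_nonzero by (auto simp: S_def)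
  define Q where "Q z = (if z = 0 then deriv zt 0 else (zt z - zt 0) / (z - 0))" for z
  define P where "P z = 2 * of_real \<gamma> - Q z - zt' z / zt z" for z
  define G where "G z = (if z = 0 then deriv P 0 else (P z - P 0) / (z - 0))" for z
  have zS: "zt holomorphic_on S" "zt' holomorphic_on S"
    using holomorphic_zt holomorphic_zt' by (auto simp: S_def intro: holomorphic_on_subset)
  have Q: "Q holomorphic_on S" unfolding Q_def by (intro pole_lemma_open zS S)
  have P: "P holomorphic_on S"
    unfolding P_def by (intro holomorphic_intros Q zS) (auto simp: S_def)
  have G: "G holomorphic_on S" unfolding G_def by (intro pole_lemma_open P S)
  have "deriv zt 0 = of_real \<gamma>"
    using zt_sums(3)[of 0] by (auto intro!: DERIV_imp_deriv simp: zt'_0 \<gamma>_def)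
  then have P0: "P 0 = 0" by (simp add: P_def Q_def zt_0 zt'_0 \<gamma>_def)
  have "(\<lambda>n. of_real (a n) * wt (Suc n) z) sums G z" if z: "Re z > 0" for z
  proof -
    have z0: "z \<noteq> 0" using z by auto
    have zn: "zt z \<noteq> 0" using z by (intro zt_nonzero) auto
    have "(\<lambda>n. if n = 0 then 2 * of_real \<gamma> else 0) sums (2 * of_real \<gamma> :: complex)"
      using sums_single[of 0 "\<lambda>_. 2 * of_real \<gamma> :: complex"] by simp
    then have "(\<lambda>n. mangoldt (Suc n) * npow (Suc n) (1 + z) - npow (Suc n) (1 + z) + (if n = 0 then 2 * of_real \<gamma> else 0))
        sums (dlz z - zeta1 z + 2 * of_real \<gamma>)"
      by (intro sums_add sums_diff dlz_sums zeta1_sums z)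
    moreover have "mangoldt (Suc n) * npow (Suc n) (1 + z) - npow (Suc n) (1 + z) + (if n = 0 then 2 * of_real \<gamma> else 0)
        = of_real (c n) * npow (Suc n) z" for n
      by (cases "n = 0") (auto simp: c_def npow_add npow_one algebra_simps diff_divide_distrib simp del: of_nat_Suc)
    moreover have "dlz z - zeta1 z + 2 * of_real \<gamma> = P z"
    proof -
      have "dlz z = 1 / z - zt' z / zt z" using zt'_eq[OF z] zn by simp
      moreover have "zeta1 z = zt z / z" using zt_eq_zeta1[OF z] z0 by simp
      ultimately show ?thesis using z0 by (simp add: P_def Q_def zt_0 diff_divide_distrib)
    qed
    ultimately have "(\<lambda>n. of_real (c n) * npow (Suc n) z) sums P z" by simp
    from sums_weighted_partial_sums[OF z bd this]
    have "(\<lambda>n. of_real (a n) * wt (Suc n) z) sums (P z / z)" by (simp only: a_def)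
    then show ?thesis using z0 P0 by (simp add: G_def)
  qed
  moreover have "norm (of_real (a n) :: complex) \<le> 7" for n
    unfolding norm_of_real a_def by (rule bd)
  ultimately have "(\<lambda>n. of_real (a n) * of_real (ln (real (n + 2)) - ln (real (n + 1)))) sums G 0"
    using newman[of "\<lambda>n. of_real (a n)" 7 S G] S S0 G by blast
  then have "summable (\<lambda>n. complex_of_real (a n * (ln (real (n + 2)) - ln (real (n + 1)))))"
    by (simp only: of_real_mult sums_summable)
  then have "summable (\<lambda>n. a n * (ln (real (n + 2)) - ln (real (n + 1))))"
    by (simp only: summable_of_real_iff)
  \<comment> \<open>\<open>mangoldt_harm\<close> is nondecreasing while harm n - ln n is
    nonincreasing.\<close>
  moreover have "a m + ln (real (m + 1)) \<le> a n + ln (real (n + 1))" if "m \<le> n" for m n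
    using mangoldt_harm_mono[of "Suc m" "Suc n"] euler_mascheroni_sequence_decreasing[of "Suc m" "Suc n"] that
    by (simp add: a)
  ultimately have "a \<longlonglongrightarrow> 0" by (rule slowly_decreasing_tendsto_0)
  then have "(\<lambda>n. mangoldt_harm (Suc n) - harm (Suc n) + 2 * \<gamma>) \<longlonglongrightarrow> 0"
    by (simp only: a [symmetric])
  then have "(\<lambda>n. mangoldt_harm n - harm n + 2 * \<gamma>) \<longlonglongrightarrow> 0" by (rule LIMSEQ_imp_Suc)
  from tendsto_add[OF this euler_mascheroni_LIMSEQ]
  have "(\<lambda>n. mangoldt_harm n - ln (real n) + 2 * \<gamma>) \<longlonglongrightarrow> \<gamma>" by (simp add: \<gamma>_def algebra_simps)
  from tendsto_diff[OF this tendsto_const[of "2 * \<gamma>"]] show ?thesis by (simp add: \<gamma>_def)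
qed

section \<open>The smooth part of a binomial coefficient\<close>

definition mangoldt_upto :: "nat \<Rightarrow> nat \<Rightarrow> real" where
  "mangoldt_upto k d = (if aprimedivisor d \<le> k then mangoldt d else 0)"

text \<open>The logarithm of the largest divisor of m with all prime factors at most k, arranged as
  an additive function of m so that Legendre's expansion of ln (fact n) carries over to it.\<close>

definition ln_smooth :: "nat \<Rightarrow> nat \<Rightarrow> real" where
  "ln_smooth k m = (\<Sum>p\<in>#prime_factorization m. if p \<le> k then ln (real p) else 0)"

lemma ln_smooth_mult: "a \<noteq> 0 \<Longrightarrow> b \<noteq> 0 \<Longrightarrow> ln_smooth k (a * b) = ln_smooth k a + ln_smooth k b"
  by (simp add: ln_smooth_def prime_factorization_mult)

lemma ln_smooth_eq_sum_divisors:
  assumes "m \<noteq> 0"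
  shows "ln_smooth k m = (\<Sum>d | d dvd m. mangoldt_upto k d)"
proof -
  have "ln_smooth k m = (\<Sum>q\<in>primepow_factors m. if aprimedivisor q \<le> k then ln (real (aprimedivisor q)) else 0)"
    unfolding ln_smooth_def by (rule sum_prime_factorization_conv_sum_primepow_factors [OF assms, symmetric])
  also have "\<dots> = (\<Sum>d | d dvd m. mangoldt_upto k d)"
    using assms by (intro sum.mono_neutral_cong_left)
      (auto simp: primepow_factors_def mangoldt_def mangoldt_upto_def finite_divisors_nat)
  finally show ?thesis .
qed

lemma ln_smooth_fact:
  "n \<le> N \<Longrightarrow> ln_smooth k (fact n) = (\<Sum>d=1..N. mangoldt_upto k d * real (n div d))"
proof -
  assume n: "n \<le> N"
  have "ln_smooth k (fact n) = (\<Sum>m=1..n. ln_smooth k m)"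
  proof (induction n)
    case (Suc n)
    have "ln_smooth k (fact (Suc n)) = ln_smooth k (Suc n) + ln_smooth k (fact n)"
      unfolding fact_Suc of_nat_id by (rule ln_smooth_mult) auto
    then show ?case using Suc by simp
  qed (simp add: ln_smooth_def)
  also have "\<dots> = (\<Sum>d=1..N. mangoldt_upto k d * real (n div d))"
    by (rule sum_divisor_sum[OF ln_smooth_eq_sum_divisors n]) auto
  finally show ?thesis .
qed

lemma sum_mset_eq_sum_count:
  fixes f :: "'a \<Rightarrow> real"
  assumes "finite S" "set_mset M \<subseteq> S"
  shows "(\<Sum>x\<in>#M. f x) = (\<Sum>x\<in>S. real (count M x) * f x)"
  using assms(2)
proof (induction M)
  case (add a M)
  then have a: "a \<in> S" and IH: "(\<Sum>x\<in>#M. f x) = (\<Sum>x\<in>S. real (count M x) * f x)" by auto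
  have "(\<Sum>x\<in>S. real (count (add_mset a M) x) * f x) = (\<Sum>x\<in>S. real (count M x) * f x + (if x = a then f x else 0))"
    by (intro sum.cong refl) (simp add: algebra_simps)
  also have "\<dots> = (\<Sum>x\<in>S. real (count M x) * f x) + f a"
    using a assms(1) by (simp add: sum.distrib)
  finally show ?case using IH by simp
qed simp

lemma u_pos: "u n k > 0"
  unfolding u_def by (intro prod_pos) (auto simp: prime_gt_0_nat)

lemma ln_u_eq_ln_smooth:
  assumes "k \<le> n"
  shows "ln (real (u n k)) = ln_smooth k (n choose k)"
proof -
  define B where "B = n choose k"
  have B: "B > 0" unfolding B_def using assms by simp
  define S where "S = {p. prime p \<and> p \<le> k} \<union> prime_factors B"
  have fin: "finite {p::nat. prime p \<and> p \<le> k}" by (rule finite_subset[of _ "{..k}"]) auto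
  have finS: "finite S" unfolding S_def using fin by (intro finite_UnI finite_set_mset)
  have "ln_smooth k B = (\<Sum>p\<in>S. real (count (prime_factorization B) p) * (if p \<le> k then ln (real p) else 0))"
    unfolding ln_smooth_def by (rule sum_mset_eq_sum_count) (auto simp: finS, simp add: S_def)
  also have "\<dots> = (\<Sum>p | prime p \<and> p \<le> k. real (multiplicity p B) * ln (real p))"
    using finS by (intro sum.mono_neutral_cong_right) (auto simp: S_def count_prime_factorization_prime prime_factors_multiplicity)
  also have "\<dots> = (\<Sum>p | prime p \<and> p \<le> k. ln (real p ^ multiplicity p B))"
    by (intro sum.cong refl) (auto simp: ln_realpow prime_gt_0_nat)
  also have "\<dots> = ln (\<Prod>p | prime p \<and> p \<le> k. real p ^ multiplicity p B)"
    using fin by (intro ln_prod [symmetric]) (auto simp: prime_gt_0_nat)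
  also have "\<dots> = ln (real (u n k))" by (simp add: u_def B_def)
  finally show ?thesis by (simp add: B_def)
qed

text \<open>Kummer's carry at the modulus d: when k and n - k are added, the remainders overflow
  exactly if the remainder of the sum falls below that of k.\<close>

lemma div_carry:
  fixes n k d :: nat
  assumes "k \<le> n" "d > 0"
  shows "real (n div d) - real (k div d) - real ((n - k) div d) = of_bool (n mod d < k mod d)"
proof -
  define m where "m = n - k"
  have n: "n = k + m" using assms by (simp add: m_def)
  have div: "n div d = k div d + m div d + (k mod d + m mod d) div d" unfolding n by (rule div_add1_eq)
  have mod: "n mod d = (k mod d + m mod d) mod d" unfolding n by (simp add: mod_add_eq)
  have lt: "k mod d < d" "m mod d < d" using assms by auto
  show ?thesis
  proof (cases "k mod d + m mod d < d")
    case True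
    then show ?thesis using div mod by (simp add: m_def)
  next
    case False
    define x where "x = k mod d + m mod d - d"
    have x: "k mod d + m mod d = d + x" "x < d" "x < k mod d"
      using False lt unfolding x_def by linarith+
    have "(d + x) div d = 1" "(d + x) mod d = x" using x assms by auto
    then show ?thesis using div mod x unfolding m_def [symmetric] by simp
  qed
qed

lemma ln_u_eq:
  assumes "k \<le> n"
  shows "ln (real (u n k)) = (\<Sum>d=1..n. mangoldt_upto k d * of_bool (n mod d < k mod d))"
proof -
  have "fact n = fact k * fact (n - k) * (n choose k)"
    using binomial_fact_lemma[OF assms] by simp
  moreover have "n choose k \<noteq> 0" using assms by simp
  ultimately have "ln_smooth k (fact n) = ln_smooth k (fact k) + ln_smooth k (fact (n - k)) + ln_smooth k (n choose k)"
    by (simp add: ln_smooth_mult)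
  then have "ln (real (u n k)) = ln_smooth k (fact n) - ln_smooth k (fact k) - ln_smooth k (fact (n - k))"
    using ln_u_eq_ln_smooth[OF assms] by simp
  also have "\<dots> = (\<Sum>d=1..n. mangoldt_upto k d * (real (n div d) - real (k div d) - real ((n - k) div d)))"
    using assms by (simp add: ln_smooth_fact[of _ n] right_diff_distrib sum_subtractf)
  also have "\<dots> = (\<Sum>d=1..n. mangoldt_upto k d * of_bool (n mod d < k mod d))"
    using assms by (intro sum.cong refl) (simp add: div_carry)
  finally show ?thesis .
qed

section \<open>Splitting the moduli into q <= k and proper prime powers\<close>

definition carry_sum :: "nat \<Rightarrow> nat \<Rightarrow> real" where
  "carry_sum n k = (\<Sum>q=1..k. mangoldt q * of_bool (n mod q < k mod q))"

definition mangoldt_proper :: "nat \<Rightarrow> real" where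
  "mangoldt_proper d = (if prime d then 0 else mangoldt d)"

lemma mangoldt_proper_nonneg: "mangoldt_proper d \<ge> 0"
  by (simp add: mangoldt_proper_def mangoldt_nonneg)

lemma mangoldt_upto_nonneg: "mangoldt_upto k d \<ge> 0"
  by (simp add: mangoldt_upto_def mangoldt_nonneg)

lemma mangoldt_upto_small: "d \<le> k \<Longrightarrow> mangoldt_upto k d = mangoldt d"
  using aprimedivisor_le_nat[of d] primepow_gt_Suc_0[of d] by (auto simp: mangoldt_upto_def mangoldt_def)

text \<open>A prime d > k is its own prime divisor and is therefore excluded; beyond k only proper
  powers remain.\<close>

lemma mangoldt_upto_large: "d > k \<Longrightarrow> mangoldt_upto k d \<le> mangoldt_proper d"
  by (auto simp: mangoldt_upto_def mangoldt_proper_def mangoldt_nonneg)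

lemma ln_u_lower:
  assumes "k \<le> n"
  shows "carry_sum n k \<le> ln (real (u n k))"
proof -
  have "carry_sum n k = (\<Sum>d=1..k. mangoldt_upto k d * of_bool (n mod d < k mod d))"
    unfolding carry_sum_def by (intro sum.cong refl) (simp add: mangoldt_upto_small)
  also have "\<dots> \<le> (\<Sum>d=1..n. mangoldt_upto k d * of_bool (n mod d < k mod d))"
    using assms by (intro sum_mono2) (auto simp: mangoldt_upto_nonneg)
  finally show ?thesis by (simp add: ln_u_eq[OF assms])
qed

text \<open>The last two sums depend on \<open>K\<close> and not on k, so one estimate of them
  serves all k <= K at once.\<close>

lemma ln_u_upper:
  assumes "k \<le> K" "K \<le> n"
  shows "ln (real (u n k)) \<le> carry_sum n k + (\<Sum>d=1..K. mangoldt_proper d) +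
    (\<Sum>d\<in>{K<..n}. mangoldt_proper d * of_bool (n mod d < K))"
proof -
  define t where "t d = mangoldt_upto k d * of_bool (n mod d < k mod d)" for d
  have "ln (real (u n k)) = (\<Sum>d\<in>{1..k} \<union> {k<..K} \<union> {K<..n}. t d)"
    unfolding t_def using assms by (subst ln_u_eq) (auto intro!: sum.cong)
  also have "\<dots> = (\<Sum>d\<in>{1..k}. t d) + (\<Sum>d\<in>{k<..K}. t d) + (\<Sum>d\<in>{K<..n}. t d)"
    using assms by (subst sum.union_disjoint; (subst sum.union_disjoint)?) auto
  also have "(\<Sum>d\<in>{1..k}. t d) = carry_sum n k"
    unfolding carry_sum_def t_def by (intro sum.cong refl) (simp add: mangoldt_upto_small)
  also have "(\<Sum>d\<in>{k<..K}. t d) \<le> (\<Sum>d\<in>{k<..K}. mangoldt_proper d)"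
  proof (rule sum_mono)
    fix d assume "d \<in> {k<..K}"
    then show "t d \<le> mangoldt_proper d"
      using mangoldt_upto_large[of k d] mangoldt_proper_nonneg[of d] by (auto simp: t_def)
  qed
  also have "\<dots> \<le> (\<Sum>d=1..K. mangoldt_proper d)"
    by (intro sum_mono2) (auto simp: mangoldt_proper_nonneg)
  also have "(\<Sum>d\<in>{K<..n}. t d) \<le> (\<Sum>d\<in>{K<..n}. mangoldt_proper d * of_bool (n mod d < K))"
  proof (rule sum_mono)
    fix d assume d: "d \<in> {K<..n}"
    show "t d \<le> mangoldt_proper d * of_bool (n mod d < K)"
      unfolding t_def using d assms mangoldt_upto_large[of k d] mangoldt_upto_nonneg[of k d] mangoldt_proper_nonneg[of d]
      by (intro mult_mono) auto
  qed
  finally show ?thesis by simp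
qed

text \<open>For each p the powers p^j with j >= 2 contribute at most ln p * 2 / p^2, and ln p <= 2
  sqrt p leaves the convergent majorant 4 p^(-3/2).\<close>

lemma summable_mangoldt_proper: "summable (\<lambda>d. mangoldt_proper d / real d)"
proof -
  define s where "s p = 4 * real p powr (- 3 / 2)" for p :: nat
  have s: "summable s" unfolding s_def by (intro summable_mult) (simp add: summable_real_powr_iff)
  have s0: "s p \<ge> 0" for p by (simp add: s_def)
  have inner: "(\<Sum>j=2..N. ln (real p) / real p ^ j) \<le> s p" if p: "p \<ge> 2" for p N :: nat
  proof -
    have l: "0 \<le> ln (real p)" using p by simp
    have geo: "(\<Sum>j=2..N. (1 / real p) ^ j) \<le> 2 / real p ^ 2"
    proof -
      have "(\<Sum>j=2..N. (1 / real p) ^ j) \<le> (\<Sum>j=2..N. (1 / real p)^2 * (1/2) ^ (j - 2))"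
      proof (rule sum_mono)
        fix j assume "j \<in> {2..N}"
        then obtain i where i: "j = 2 + i" using le_Suc_ex[of 2 j] by auto
        have "(1 / real p) ^ j = (1 / real p)^2 * (1 / real p) ^ (j - 2)"
          unfolding i power_add by simp
        also have "\<dots> \<le> (1 / real p)^2 * (1 / 2) ^ (j - 2)"
          using p by (intro mult_left_mono power_mono) (auto simp: field_simps)
        finally show "(1 / real p) ^ j \<le> (1 / real p)^2 * (1/2) ^ (j - 2)" .
      qed
      also have "\<dots> = (1 / real p)^2 * (\<Sum>j=2..N. (1/2) ^ (j - 2))" by (simp add: sum_distrib_left)
      also have "\<dots> \<le> (1 / real p)^2 * 2"
      proof (rule mult_left_mono)
        have "(\<Sum>j=2..N. (1/2::real) ^ (j - 2)) \<le> (\<Sum>i<N. (1/2) ^ i)"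
          by (intro sum_le_included[where i = "\<lambda>i. i + 2"]) (auto intro!: bexI[of _ "_ - 2"])
        also have "\<dots> \<le> 2" by (simp add: geometric_sum)
        finally show "(\<Sum>j=2..N. (1/2::real) ^ (j - 2)) \<le> 2" .
      qed simp
      finally show ?thesis by (simp add: power_divide)
    qed
    have "ln (sqrt (real p)) \<le> sqrt (real p)" using p by (intro order_trans[OF ln_le_minus_one]) auto
    then have ln: "ln (real p) \<le> 2 * sqrt (real p)" using p by (simp add: ln_sqrt)
    have "(\<Sum>j=2..N. ln (real p) / real p ^ j) = ln (real p) * (\<Sum>j=2..N. (1 / real p) ^ j)"
      by (simp add: sum_distrib_left power_divide)
    also have "\<dots> \<le> 2 * sqrt (real p) * (2 / real p ^ 2)"
      using geo ln l by (intro mult_mono) (auto intro!: sum_nonneg)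
    also have "\<dots> = s p"
    proof -
      have "sqrt (real p) / real p ^ 2 = real p powr (1/2) / real p powr 2"
        using p by (simp add: powr_half_sqrt)
      also have "\<dots> = real p powr (- 3 / 2)" by (subst powr_diff [symmetric]) simp
      finally show ?thesis by (simp add: s_def)
    qed
    finally show ?thesis .
  qed
  have "(\<Sum>d<N. mangoldt_proper d / real d) \<le> suminf s" for N
  proof -
    define Q where "Q = {d. d < N \<and> primepow d \<and> \<not> prime d}"
    define g where "g = (\<lambda>d::nat. (aprimedivisor d, multiplicity (aprimedivisor d) d))"
    have "(\<Sum>d<N. mangoldt_proper d / real d) = (\<Sum>d\<in>Q. mangoldt d / real d)"
      by (intro sum.mono_neutral_cong_right) (auto simp: Q_def mangoldt_proper_def mangoldt_def)
    also have "\<dots> \<le> (\<Sum>(p,j)\<in>{2..<N} \<times> {2..N}. ln (real p) / real p ^ j)"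
    proof (rule sum_le_included[where i = "\<lambda>(p,j). p ^ j"])
      show "\<forall>y\<in>{2..<N} \<times> {2..N}. 0 \<le> (case y of (p, j) \<Rightarrow> ln (real p) / real p ^ j)"
        by auto
      show "\<forall>x\<in>Q. \<exists>y\<in>{2..<N} \<times> {2..N}. (case y of (p, j) \<Rightarrow> p ^ j) = x \<and> mangoldt x / real x \<le> (case y of (p, j) \<Rightarrow> ln (real p) / real p ^ j)"
      proof
        fix d assume d: "d \<in> Q"
        then obtain p j where pj: "prime p" "j > 0" "d = p ^ j" by (auto simp: Q_def primepow_def)
        have "j \<noteq> 1" using d pj by (auto simp: Q_def)
        then have j: "j \<ge> 2" using pj by simp
        have p: "p \<ge> 2" using pj prime_ge_2_nat by blast
        \<comment> \<open>Since p >= 2, base and exponent of a power p^j < N are both below N, which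
          confines the pairs (p, j) to a finite box.\<close>
        have "j < 2 ^ j" by simp
        also have "(2::nat) ^ j \<le> p ^ j" using p by (intro power_mono) auto
        finally have "j < N" using d pj by (auto simp: Q_def)
        moreover have "p ^ 1 \<le> p ^ j" using p j by (intro power_increasing) auto
        then have "p < N" using d pj by (auto simp: Q_def)
        ultimately show "\<exists>y\<in>{2..<N} \<times> {2..N}. (case y of (p, j) \<Rightarrow> p ^ j) = d \<and> mangoldt d / real d \<le> (case y of (p, j) \<Rightarrow> ln (real p) / real p ^ j)"
          using p j pj by (intro bexI[of _ "(p, j)"]) auto
      qed
    qed (auto simp: Q_def)
    also have "\<dots> = (\<Sum>p\<in>{2..<N}. \<Sum>j=2..N. ln (real p) / real p ^ j)"
      by (simp add: sum.cartesian_product)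
    also have "\<dots> \<le> (\<Sum>p\<in>{2..<N}. s p)" by (intro sum_mono inner) auto
    also have "\<dots> \<le> suminf s" using s s0 by (intro sum_le_suminf) auto
    finally show ?thesis .
  qed
  note bd = this
  show ?thesis
  proof (rule bounded_imp_summable)
    show "(\<Sum>d\<le>n. mangoldt_proper d / real d) \<le> suminf s" for n
      using bd[of "Suc n"] by (simp only: lessThan_Suc_atMost)
  qed (simp add: mangoldt_proper_nonneg)
qed

section \<open>Variance of residue sums\<close>

lemma card_residue_class:
  fixes a m N :: nat
  assumes "a < m"
  shows "N div m \<le> card {n \<in> {1..N}. n mod m = a}" "card {n \<in> {1..N}. n mod m = a} \<le> N div m + 1"
proof -
  have m: "m > 0" using assms by simp
  have "inj_on (\<lambda>n. n div m) {n \<in> {1..N}. n mod m = a}"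
  proof (rule inj_onI)
    fix x y assume "x \<in> {n \<in> {1..N}. n mod m = a}" "y \<in> {n \<in> {1..N}. n mod m = a}" "x div m = y div m"
    then show "x = y" using div_mult_mod_eq[of x m] div_mult_mod_eq[of y m] by auto
  qed
  moreover have "(\<lambda>n. n div m) ` {n \<in> {1..N}. n mod m = a} \<subseteq> {0..N div m}"
    by (auto intro: div_le_mono)
  ultimately have "card {n \<in> {1..N}. n mod m = a} \<le> card {0..N div m}"
    by (intro card_inj_on_le) auto
  then show "card {n \<in> {1..N}. n mod m = a} \<le> N div m + 1" by simp
  \<comment> \<open>The range {1..N} omits n = 0, so for the residue 0 the multipliers start at
    1.\<close>
  define I where "I = (if a = 0 then {1..N div m} else {0..<N div m})"
  have "(\<lambda>i. a + m * i) ` I \<subseteq> {n \<in> {1..N}. n mod m = a}"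
  proof
    fix n assume "n \<in> (\<lambda>i. a + m * i) ` I"
    then obtain i where i: "i \<in> I" "n = a + m * i" by blast
    have "n \<le> m * (N div m)"
    proof (cases "a = 0")
      case False
      then have "m * Suc i \<le> m * (N div m)" using i by (intro mult_le_mono2) (auto simp: I_def)
      then show ?thesis using i assms by simp
    qed (use i in \<open>auto simp: I_def\<close>)
    moreover have "m * (N div m) \<le> N" by simp
    moreover have "n \<ge> 1" using i m by (cases "a = 0") (auto simp: I_def Suc_le_eq)
    ultimately have "1 \<le> n" "n \<le> N" by linarith+
    then show "n \<in> {n \<in> {1..N}. n mod m = a}" using i assms by auto
  qed
  then have "card ((\<lambda>i. a + m * i) ` I) \<le> card {n \<in> {1..N}. n mod m = a}"
    by (intro card_mono) auto
  also have "card ((\<lambda>i. a + m * i) ` I) = card I"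
    using m by (intro card_image) (auto simp: inj_on_def)
  also have "card I = N div m" by (auto simp: I_def)
  finally show "N div m \<le> card {n \<in> {1..N}. n mod m = a}" .
qed

lemma card_residue_set:
  fixes m N :: nat
  assumes A: "A \<subseteq> {..<m}" and m: "m > 0"
  shows "\<bar>real (card {n \<in> {1..N}. n mod m \<in> A}) - real N * real (card A) / real m\<bar> \<le> real (card A)"
proof -
  have fin: "finite A" using A finite_subset by blast
  have "{n \<in> {1..N}. n mod m \<in> A} = (\<Union>a\<in>A. {n \<in> {1..N}. n mod m = a})" by auto
  also have "card \<dots> = (\<Sum>a\<in>A. card {n \<in> {1..N}. n mod m = a})"
    using fin by (intro card_UN_disjoint) auto
  finally have card: "real (card {n \<in> {1..N}. n mod m \<in> A}) - real N * real (card A) / real m =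
      (\<Sum>a\<in>A. real (card {n \<in> {1..N}. n mod m = a}) - real N / real m)"
    by (simp add: sum_subtractf)
  have "\<bar>\<Sum>a\<in>A. real (card {n \<in> {1..N}. n mod m = a}) - real N / real m\<bar> \<le> (\<Sum>a\<in>A. 1)"
  proof (rule order_trans[OF sum_abs sum_mono])
    fix a assume "a \<in> A"
    then have a: "a < m" using A by auto
    have "real N / real m = real (N div m) + real (N mod m) / real m"
      using m by (simp add: field_simps flip: of_nat_mult of_nat_add)
    moreover have "0 \<le> real (N mod m) / real m" "real (N mod m) / real m \<le> 1" using m by (auto simp: less_imp_le)
    moreover note card_residue_class[OF a, of N]
    ultimately show "\<bar>real (card {n \<in> {1..N}. n mod m = a}) - real N / real m\<bar> \<le> 1" by linarith
  qed
  then show ?thesis unfolding card by simp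
qed

lemma card_crt:
  fixes q r :: nat
  assumes "coprime q r" "q > 0" "r > 0" "A \<subseteq> {..<q}" "B \<subseteq> {..<r}"
  shows "card {x \<in> {..<q * r}. x mod q \<in> A \<and> x mod r \<in> B} = card A * card B"
proof -
  have "bij_betw (\<lambda>x. (x mod q, x mod r)) {x \<in> {..<q * r}. x mod q \<in> A \<and> x mod r \<in> B} (A \<times> B)"
    unfolding bij_betw_def
  proof
    show "inj_on (\<lambda>x. (x mod q, x mod r)) {x \<in> {..<q * r}. x mod q \<in> A \<and> x mod r \<in> B}"
    proof (rule inj_onI)
      fix x y assume xy: "x \<in> {x \<in> {..<q * r}. x mod q \<in> A \<and> x mod r \<in> B}" "y \<in> {x \<in> {..<q * r}. x mod q \<in> A \<and> x mod r \<in> B}"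
        "(x mod q, x mod r) = (y mod q, y mod r)"
      then have "[x = y] (mod q)" "[x = y] (mod r)" by (auto simp: cong_def)
      then have "[x = y] (mod (q * r))" using assms(1) by (rule coprime_cong_mult_nat)
      then show "x = y" using xy by (auto simp: cong_def)
    qed
    show "(\<lambda>x. (x mod q, x mod r)) ` {x \<in> {..<q * r}. x mod q \<in> A \<and> x mod r \<in> B} = A \<times> B"
    proof (intro equalityI subsetI)
      fix ab assume ab: "ab \<in> A \<times> B"
      then obtain a b where [simp]: "ab = (a, b)" and "a \<in> A" "b \<in> B" by auto
      then have lt: "a < q" "b < r" using assms by auto
      obtain x where x: "[x = a] (mod q)" "[x = b] (mod r)"
        using binary_chinese_remainder_nat[OF assms(1)] by blast
      have "(x mod (q * r)) mod q = a" "(x mod (q * r)) mod r = b"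
        using x lt by (auto simp: cong_def mod_mod_cancel)
      moreover have "x mod (q * r) < q * r" using assms by simp
      ultimately show "ab \<in> (\<lambda>x. (x mod q, x mod r)) ` {x \<in> {..<q * r}. x mod q \<in> A \<and> x mod r \<in> B}"
        using \<open>a \<in> A\<close> \<open>b \<in> B\<close> by (intro image_eqI[of _ _ "x mod (q * r)"]) auto
    qed auto
  qed
  from bij_betw_same_card[OF this] show ?thesis by (simp add: card_cartesian_product)
qed

text \<open>By the Chinese remainder theorem the two conditions amount to one condition modulo q * r
  on card A * card B classes, each counted with an error of at most 1.\<close>

lemma card_two_residue_sets:
  fixes q r :: nat
  assumes "coprime q r" "q > 0" "r > 0" "A \<subseteq> {..<q}" "B \<subseteq> {..<r}"
  shows "real (card {n \<in> {1..N}. n mod q \<in> A \<and> n mod r \<in> B}) \<le>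
    real N * (real (card A) / real q) * (real (card B) / real r) + real q * real r"
proof -
  define C where "C = {x \<in> {..<q * r}. x mod q \<in> A \<and> x mod r \<in> B}"
  have C: "C \<subseteq> {..<q * r}" by (auto simp: C_def)
  define X where "X = real N * (real (card A) / real q) * (real (card B) / real r)"
  define Y where "Y = real q * real r"
  have e: "{n \<in> {1..N}. n mod q \<in> A \<and> n mod r \<in> B} = {n \<in> {1..N}. n mod (q * r) \<in> C}"
    using assms by (auto simp: C_def mod_mod_cancel)
  have "real N * real (card C) / real (q * r) = X"
    unfolding C_def card_crt[OF assms] X_def by simp
  moreover have "\<bar>real (card {n \<in> {1..N}. n mod (q * r) \<in> C}) - real N * real (card C) / real (q * r)\<bar> \<le> real (card C)"
    using assms by (intro card_residue_set C) auto
  moreover have "card C \<le> q * r" using card_mono[OF _ C] by simp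
  then have "real (card C) \<le> Y" unfolding Y_def by (simp flip: of_nat_mult)
  ultimately show ?thesis unfolding e X_def [symmetric] Y_def [symmetric] by linarith
qed

text \<open>Every prime power r in the sum is a power of the prime p underlying q, hence divides the
  largest power p^J <= K, and the divisors of p^J have total weight ln (p^J).\<close>

lemma sum_mangoldt_not_coprime:
  assumes "primepow q" "K > 0"
  shows "(\<Sum>r\<in>{r\<in>{1..K}. \<not> coprime q r}. mangoldt r) \<le> ln (real K)"
proof -
  obtain p j where pj: "prime p" "j > 0" "q = p ^ j" using assms by (auto simp: primepow_def)
  have p: "p > 1" using pj prime_gt_1_nat by blast
  define J where "J = Max {j. p ^ j \<le> K}"
  have "{j. p ^ j \<le> K} \<subseteq> {..K}"
  proof
    fix j assume "j \<in> {j. p ^ j \<le> K}"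
    moreover have "j < p ^ j" using p by (intro power_gt_expt) auto
    ultimately show "j \<in> {..K}" by auto
  qed
  then have fin: "finite {j. p ^ j \<le> K}" using finite_subset by blast
  moreover have "0 \<in> {j. p ^ j \<le> K}" using assms by simp
  ultimately have "J \<in> {j. p ^ j \<le> K}" unfolding J_def by (intro Max_in) blast+
  then have J: "p ^ J \<le> K" by simp
  have "(\<Sum>r\<in>{r\<in>{1..K}. \<not> coprime q r}. mangoldt r) = (\<Sum>r\<in>{r\<in>{1..K}. \<not> coprime q r \<and> primepow r}. mangoldt r :: real)"
    by (intro sum.mono_neutral_right) (auto simp: mangoldt_def)
  also have "\<dots> \<le> (\<Sum>r | r dvd p ^ J. mangoldt r :: real)"
  proof (rule sum_mono2)
    show "finite {r. r dvd p ^ J}" using p by (intro finite_divisors_nat) auto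
    show "{r\<in>{1..K}. \<not> coprime q r \<and> primepow r} \<subseteq> {r. r dvd p ^ J}"
    proof
      fix r assume r: "r \<in> {r\<in>{1..K}. \<not> coprime q r \<and> primepow r}"
      then obtain p' i where pi: "prime p'" "i > 0" "r = p' ^ i" by (auto simp: primepow_def)
      have "\<not> coprime p p'" using r pi pj by auto
      then have "p' = p" using primes_coprime pj pi by blast
      then have "i \<le> J" unfolding J_def using r pi fin by (intro Max_ge) auto
      then show "r \<in> {r. r dvd p ^ J}" using pi \<open>p' = p\<close> by (auto intro: le_imp_power_dvd)
    qed
  qed (auto intro: mangoldt_nonneg)
  also have "\<dots> = ln (real (p ^ J))" using mangoldt_sum[of "p ^ J", where 'a = real] p by simp
  also have "\<dots> \<le> ln (real K)" using J p assms by (subst ln_le_cancel_iff) (auto simp flip: of_nat_power)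
  finally show ?thesis .
qed

text \<open>Coprime moduli are independent up to the error \<open>q * r\<close> from the Chinese remainder theorem; the
  remaining pairs are powers of a common prime and contribute at most \<open>psi K * ln K\<close>.\<close>

theorem residue_sum_variance:
  fixes A :: "nat \<Rightarrow> nat set"
  assumes A: "\<And>q. q \<in> {1..K} \<Longrightarrow> A q \<subseteq> {..<q}" and K: "K > 0"
  defines "T \<equiv> \<lambda>n. \<Sum>q=1..K. mangoldt q * of_bool (n mod q \<in> A q)"
  defines "\<mu> \<equiv> \<Sum>q=1..K. mangoldt q * (real (card (A q)) / real q)"
  shows "(\<Sum>n=1..N. (T n - \<mu>)^2) \<le> 4 * real N * real K * ln (real K) + 48 * real K ^ 4"
proof -
  define \<alpha> where "\<alpha> q = real (card (A q)) / real q" for q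
  have \<alpha>: "0 \<le> \<alpha> q" "\<alpha> q \<le> 1" if "q \<in> {1..K}" for q
    using card_mono[OF _ A[OF that]] that by (auto simp: \<alpha>_def)
  have psi0: "psi K \<ge> 0" by (rule psi_nonneg)
  have mu0: "0 \<le> \<mu>" unfolding \<mu>_def \<alpha>_def [symmetric] using \<alpha> by (intro sum_nonneg mult_nonneg_nonneg mangoldt_nonneg)
  have mupsi: "\<mu> \<le> psi K"
    unfolding \<mu>_def \<alpha>_def [symmetric] psi_def
  proof (rule sum_mono)
    fix q assume "q \<in> {1..K}"
    then show "mangoldt q * \<alpha> q \<le> mangoldt q" using \<alpha>[of q] mangoldt_nonneg[of q] by (simp add: mult_left_le)
  qed
  have ofb: "(\<Sum>n=1..N. of_bool (P n)) = real (card {n \<in> {1..N}. P n})" for P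
    by (simp add: Int_def)
  \<comment> \<open>A lower bound suffices, because in the variance the first moment carries the
    coefficient -2 \<mu> <= 0; the second moment correspondingly gets an upper bound.\<close>
  have S1: "(\<Sum>n=1..N. T n) \<ge> real N * \<mu> - real K * psi K"
  proof -
    have "(\<Sum>n=1..N. T n) = (\<Sum>q=1..K. mangoldt q * (\<Sum>n=1..N. of_bool (n mod q \<in> A q)))"
      unfolding T_def sum_distrib_left by (rule sum.swap)
    also have "\<dots> \<ge> (\<Sum>q=1..K. mangoldt q * (real N * \<alpha> q - real K))"
    proof (intro sum_mono mult_left_mono mangoldt_nonneg)
      fix q assume q: "q \<in> {1..K}"
      have "card (A q) \<le> q" using card_mono[OF _ A[OF q]] by simp
      then have "real (card (A q)) \<le> real K" using q by simp
      moreover have "\<bar>real (card {n \<in> {1..N}. n mod q \<in> A q}) - real N * real (card (A q)) / real q\<bar> \<le> real (card (A q))"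
        using q by (intro card_residue_set A) auto
      ultimately show "real N * \<alpha> q - real K \<le> (\<Sum>n=1..N. of_bool (n mod q \<in> A q))"
        unfolding ofb \<alpha>_def by simp
    qed
    also have "(\<Sum>q=1..K. mangoldt q * (real N * \<alpha> q - real K)) = real N * \<mu> - real K * psi K"
      by (simp add: \<mu>_def \<alpha>_def psi_def right_diff_distrib sum_subtractf sum_distrib_left mult_ac)
    finally show ?thesis .
  qed
  have S2: "(\<Sum>n=1..N. T n ^ 2) \<le> real N * \<mu>^2 + real K ^ 2 * psi K ^ 2 + real N * (psi K * ln (real K))"
  proof -
    have double: "(\<Sum>q\<in>S. \<Sum>r\<in>S. f q * f r * x) = sum f S * sum f S * x" for f :: "nat \<Rightarrow> real" and S x
      unfolding sum_product by (simp only: sum_distrib_right)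
    define c where "c q r = (\<Sum>n=1..N. of_bool (n mod q \<in> A q \<and> n mod r \<in> A r) :: real)" for q r
    have "(\<Sum>q=1..K. \<Sum>r=1..K. if coprime q r then 0 else mangoldt q * mangoldt r :: real) \<le> (\<Sum>q=1..K. mangoldt q * ln (real K))"
    proof (rule sum_mono)
      fix q assume "q \<in> {1..K}"
      have "(\<Sum>r=1..K. if coprime q r then 0 else mangoldt q * mangoldt r) = mangoldt q * (\<Sum>r=1..K. if \<not> coprime q r then mangoldt r else 0)"
        unfolding sum_distrib_left by (intro sum.cong refl) auto
      also have "\<dots> = mangoldt q * (\<Sum>r\<in>{r\<in>{1..K}. \<not> coprime q r}. mangoldt r)"
        by (simp only: sum.inter_filter finite_atLeastAtMost)
      also have "\<dots> \<le> mangoldt q * ln (real K)"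
      proof (cases "primepow q")
        case True
        then show ?thesis by (intro mult_left_mono sum_mangoldt_not_coprime K mangoldt_nonneg)
      qed (simp add: mangoldt_def)
      finally show "(\<Sum>r=1..K. if coprime q r then 0 else mangoldt q * mangoldt r) \<le> mangoldt q * ln (real K)" .
    qed
    also have "(\<Sum>q=1..K. mangoldt q * ln (real K)) = psi K * ln (real K)"
      by (simp add: psi_def sum_distrib_right)
    finally have V: "(\<Sum>q=1..K. \<Sum>r=1..K. if coprime q r then 0 else mangoldt q * mangoldt r) \<le> psi K * ln (real K)" .
    have "(\<Sum>n=1..N. T n ^ 2) = (\<Sum>n=1..N. \<Sum>q=1..K. \<Sum>r=1..K. mangoldt q * mangoldt r * of_bool (n mod q \<in> A q \<and> n mod r \<in> A r))"
      unfolding T_def power2_eq_square sum_product by (intro sum.cong refl) auto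
    also have "\<dots> = (\<Sum>q=1..K. \<Sum>n=1..N. \<Sum>r=1..K. mangoldt q * mangoldt r * of_bool (n mod q \<in> A q \<and> n mod r \<in> A r))"
      by (rule sum.swap)
    also have "\<dots> = (\<Sum>q=1..K. \<Sum>r=1..K. mangoldt q * mangoldt r * c q r)"
      unfolding c_def sum_distrib_left by (intro sum.cong refl sum.swap)
    also have "\<dots> \<le> (\<Sum>q=1..K. \<Sum>r=1..K. (mangoldt q * \<alpha> q) * (mangoldt r * \<alpha> r) * real N + mangoldt q * mangoldt r * real K ^ 2
        + real N * (if coprime q r then 0 else mangoldt q * mangoldt r))"
    proof (intro sum_mono)
      fix q r assume q: "q \<in> {1..K}" and r: "r \<in> {1..K}"
      have "c q r \<le> \<alpha> q * \<alpha> r * real N + real K ^ 2 + real N * (if coprime q r then 0 else 1)"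
      proof (cases "coprime q r")
        case True
        have "c q r \<le> real N * \<alpha> q * \<alpha> r + real q * real r"
          unfolding c_def ofb \<alpha>_def using True q r by (intro card_two_residue_sets A) auto
        moreover have "real q * real r \<le> real K * real K" using q r by (intro mult_mono) auto
        ultimately show ?thesis using True by (simp add: power2_eq_square mult_ac)
      next
        case False
        have "c q r \<le> (\<Sum>n=1..N. 1)" unfolding c_def by (intro sum_mono) auto
        then have "c q r \<le> real N" by simp
        moreover have "0 \<le> \<alpha> q * \<alpha> r * real N + real K ^ 2" using \<alpha>[OF q] \<alpha>[OF r] by simp
        ultimately show ?thesis using False by simp
      qed
      then have "mangoldt q * mangoldt r * c q r \<le> mangoldt q * mangoldt r * (\<alpha> q * \<alpha> r * real N + real K ^ 2 + real N * (if coprime q r then 0 else 1))"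
        by (intro mult_left_mono) (auto intro: mangoldt_nonneg mult_nonneg_nonneg)
      then show "mangoldt q * mangoldt r * c q r \<le> (mangoldt q * \<alpha> q) * (mangoldt r * \<alpha> r) * real N + mangoldt q * mangoldt r * real K ^ 2
        + real N * (if coprime q r then 0 else mangoldt q * mangoldt r)"
        by (simp add: algebra_simps split: if_splits)
    qed
    also have "\<dots> = \<mu> * \<mu> * real N + psi K * psi K * real K ^ 2 + real N * (\<Sum>q=1..K. \<Sum>r=1..K. if coprime q r then 0 else mangoldt q * mangoldt r)"
      unfolding sum.distrib double \<mu>_def \<alpha>_def [symmetric] psi_def sum_distrib_left ..
    also have "\<dots> \<le> \<mu> * \<mu> * real N + psi K * psi K * real K ^ 2 + real N * (psi K * ln (real K))"
      by (intro add_left_mono mult_left_mono V) auto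
    finally show ?thesis by (simp add: power2_eq_square mult_ac)
  qed
  have "(\<Sum>n=1..N. (T n - \<mu>)^2) = (\<Sum>n=1..N. T n ^ 2) - 2 * \<mu> * (\<Sum>n=1..N. T n) + real N * \<mu>^2"
    by (simp add: power2_diff sum.distrib sum_subtractf sum_distrib_left mult_ac)
  also have "\<dots> \<le> real N * \<mu>^2 + real K ^ 2 * psi K ^ 2 + real N * (psi K * ln (real K)) - 2 * \<mu> * (real N * \<mu> - real K * psi K) + real N * \<mu>^2"
    using S1 S2 mu0 by (intro add_right_mono diff_mono mult_left_mono) auto
  \<comment> \<open>The main terms N \<mu>^2 cancel.\<close>
  also have "\<dots> = real K ^ 2 * psi K ^ 2 + 2 * real K * (\<mu> * psi K) + real N * (psi K * ln (real K))"
    by (simp add: algebra_simps power2_eq_square)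
  also have "\<dots> \<le> real K ^ 2 * (4 * real K) ^ 2 + 2 * real K * ((4 * real K) * (4 * real K)) + real N * ((4 * real K) * ln (real K))"
    using psi_le[of K] mupsi mu0 psi0 K by (intro add_mono mult_left_mono mult_right_mono power_mono mult_mono) auto
  also have "\<dots> = 16 * real K ^ 4 + 32 * real K ^ 3 + 4 * real N * real K * ln (real K)"
    by (simp add: power2_eq_square eval_nat_numeral)
  \<comment> \<open>Absorbing the cubic term into the quartic one gives 48 = 16 + 32.\<close>
  also have "real K ^ 3 \<le> real K ^ 4" using K by (intro power_increasing) auto
  finally show ?thesis by simp
qed

section \<open>Concentration of the threshold\<close>

text \<open>Density zero for sets that change with N, as required by conditions whose parameter K
  depends on N. For a constant family it is natural density 0.\<close>

definition negligible_family :: "(nat \<Rightarrow> nat set) \<Rightarrow> bool" where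
  "negligible_family B \<longleftrightarrow> (\<lambda>N. real (card (B N \<inter> {1..N})) / real N) \<longlonglongrightarrow> 0"

lemma negligible_family_bound:
  assumes "\<forall>\<^sub>F N in sequentially. real (card (B N \<inter> {1..N})) / real N \<le> f N" "f \<longlonglongrightarrow> 0"
  shows "negligible_family B"
  unfolding negligible_family_def
proof (rule Lim_null_comparison)
  show "\<forall>\<^sub>F N in sequentially. norm (real (card (B N \<inter> {1..N})) / real N) \<le> f N"
    using assms(1) by eventually_elim simp
qed (rule assms(2))

lemma negligible_family_subset:
  assumes "negligible_family C" "\<forall>\<^sub>F N in sequentially. B N \<inter> {1..N} \<subseteq> C N"
  shows "negligible_family B"
proof (rule negligible_family_bound)
  show "\<forall>\<^sub>F N in sequentially. real (card (B N \<inter> {1..N})) / real N \<le> real (card (C N \<inter> {1..N})) / real N"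
    using assms(2)
  proof eventually_elim
    case (elim N)
    then have "card (B N \<inter> {1..N}) \<le> card (C N \<inter> {1..N})" by (intro card_mono) auto
    then show ?case by (intro divide_right_mono) auto
  qed
qed (use assms(1) in \<open>simp add: negligible_family_def\<close>)

lemma negligible_family_Un:
  assumes "negligible_family B" "negligible_family C"
  shows "negligible_family (\<lambda>N. B N \<union> C N)"
proof (rule negligible_family_bound)
  have "real (card ((B N \<union> C N) \<inter> {1..N})) / real N \<le> real (card (B N \<inter> {1..N})) / real N + real (card (C N \<inter> {1..N})) / real N" for N
  proof -
    have "card ((B N \<union> C N) \<inter> {1..N}) \<le> card (B N \<inter> {1..N}) + card (C N \<inter> {1..N})"
      unfolding Int_Un_distrib2 by (rule card_Un_le)
    then show ?thesis unfolding add_divide_distrib [symmetric] by (intro divide_right_mono) (simp_all flip: of_nat_add)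
  qed
  then show "\<forall>\<^sub>F N in sequentially. real (card ((B N \<union> C N) \<inter> {1..N})) / real N \<le>
      real (card (B N \<inter> {1..N})) / real N + real (card (C N \<inter> {1..N})) / real N" by simp
  show "(\<lambda>N. real (card (B N \<inter> {1..N})) / real N + real (card (C N \<inter> {1..N})) / real N) \<longlonglongrightarrow> 0"
    using tendsto_add[OF assms[unfolded negligible_family_def]] by simp
qed

lemma negligible_family_UN:
  fixes m :: nat
  assumes "\<And>i. i < m \<Longrightarrow> negligible_family (B i)"
  shows "negligible_family (\<lambda>N. \<Union>i<m. B i N)"
  using assms
proof (induction m)
  case 0
  then show ?case by (simp add: negligible_family_def)
next
  case (Suc m)
  have "negligible_family (\<lambda>N. (\<Union>i<m. B i N) \<union> B m N)"
    using Suc by (intro negligible_family_Un) auto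
  then show ?case by (simp add: lessThan_Suc Un_commute)
qed

section \<open>Moment bounds for the exceptional sets\<close>

lemma markov_card:
  fixes f :: "nat \<Rightarrow> real"
  assumes "finite S" "c > 0" "\<And>n. n \<in> S \<Longrightarrow> f n \<ge> 0"
  shows "real (card {n \<in> S. f n \<ge> c}) \<le> (\<Sum>n\<in>S. f n) / c"
proof -
  have "real (card {n \<in> S. f n \<ge> c}) * c = (\<Sum>n\<in>{n \<in> S. f n \<ge> c}. c)" by simp
  also have "\<dots> \<le> (\<Sum>n\<in>{n \<in> S. f n \<ge> c}. f n)" by (intro sum_mono) auto
  also have "\<dots> \<le> (\<Sum>n\<in>S. f n)" using assms by (intro sum_mono2) auto
  finally show ?thesis using assms(2) by (simp add: field_simps)
qed

text \<open>Chebyshev's inequality with \<open>residue_sum_variance\<close>: the exceptional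
  proportion is O(ln K / K + K^2 / N). The first term vanishes because K tends to infinity, the
  second because K = O(ln N).\<close>

lemma negligible_deviation:
  fixes K :: "nat \<Rightarrow> nat" and A :: "nat \<Rightarrow> nat \<Rightarrow> nat set"
  assumes K: "filterlim K at_top sequentially" and KC: "\<forall>\<^sub>F N in sequentially. real (K N) \<le> C * ln (real N)"
    and A: "\<And>N q. q > 0 \<Longrightarrow> A N q \<subseteq> {..<q}" and \<delta>: "\<delta> > 0"
  shows "negligible_family (\<lambda>N. {n. \<bar>(\<Sum>q=1..K N. mangoldt q * of_bool (n mod q \<in> A N q)) -
     (\<Sum>q=1..K N. mangoldt q * (real (card (A N q)) / real q))\<bar> \<ge> \<delta> * real (K N)})"
proof (rule negligible_family_bound)
  define T where "T N n = (\<Sum>q=1..K N. mangoldt q * of_bool (n mod q \<in> A N q)) -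
     (\<Sum>q=1..K N. mangoldt q * (real (card (A N q)) / real q))" for N n
  define f where "f N = 4 / \<delta>^2 * (ln (real (K N)) / real (K N)) + 48 * C^2 / \<delta>^2 * (ln (real N) ^ 2 / real N)" for N
  have lim1: "((\<lambda>x::real. ln x / x) \<longlongrightarrow> 0) at_top" by real_asymp
  have "(\<lambda>N. ln (real (K N)) / real (K N)) \<longlonglongrightarrow> 0"
    by (rule filterlim_compose[OF lim1 filterlim_compose[OF filterlim_real_sequentially K]])
  moreover have "(\<lambda>N. ln (real N) ^ 2 / real N) \<longlonglongrightarrow> 0" by real_asymp
  ultimately have "f \<longlonglongrightarrow> 4 / \<delta>^2 * 0 + 48 * C^2 / \<delta>^2 * 0"
    unfolding f_def by (intro tendsto_intros)
  then show "f \<longlonglongrightarrow> 0" by simp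
  have "\<forall>\<^sub>F N in sequentially. K N \<ge> 1" using K by (simp add: filterlim_at_top)
  with KC eventually_gt_at_top[of 0]
  show "\<forall>\<^sub>F N in sequentially. real (card ({n. \<bar>(\<Sum>q=1..K N. mangoldt q * of_bool (n mod q \<in> A N q)) -
     (\<Sum>q=1..K N. mangoldt q * (real (card (A N q)) / real q))\<bar> \<ge> \<delta> * real (K N)} \<inter> {1..N})) / real N \<le> f N"
  proof eventually_elim
    case (elim N)
    define k where "k = real (K N)"
    have k: "k \<ge> 1" using elim by (simp add: k_def)
    have N: "real N > 0" using elim by simp
    have "{n. \<bar>T N n\<bar> \<ge> \<delta> * k} \<inter> {1..N} \<subseteq> {n \<in> {1..N}. T N n ^ 2 \<ge> (\<delta> * k)^2}"
    proof
      fix n assume n: "n \<in> {n. \<bar>T N n\<bar> \<ge> \<delta> * k} \<inter> {1..N}"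
      then have "(\<delta> * k)^2 \<le> \<bar>T N n\<bar>^2" using \<delta> k by (intro power_mono) auto
      then show "n \<in> {n \<in> {1..N}. T N n ^ 2 \<ge> (\<delta> * k)^2}" using n by simp
    qed
    then have "card ({n. \<bar>T N n\<bar> \<ge> \<delta> * k} \<inter> {1..N}) \<le> card {n \<in> {1..N}. T N n ^ 2 \<ge> (\<delta> * k)^2}"
      by (intro card_mono) auto
    then have "real (card ({n. \<bar>T N n\<bar> \<ge> \<delta> * k} \<inter> {1..N})) \<le> real (card {n \<in> {1..N}. T N n ^ 2 \<ge> (\<delta> * k)^2})" by simp
    also have "\<dots> \<le> (\<Sum>n=1..N. T N n ^ 2) / (\<delta> * k)^2"
      using \<delta> k by (intro markov_card) auto
    also have "\<dots> \<le> (4 * real N * k * ln k + 48 * k ^ 4) / (\<delta> * k)^2"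
      unfolding T_def k_def using elim by (intro divide_right_mono residue_sum_variance A) auto
    also have "\<dots> = 4 * real N * (ln k / k) / \<delta>^2 + 48 * k^2 / \<delta>^2"
      using k \<delta> by (simp add: field_simps eval_nat_numeral)
    also have "k^2 \<le> (C * ln (real N))^2" using elim k unfolding k_def by (intro power_mono) auto
    finally have "real (card ({n. \<bar>T N n\<bar> \<ge> \<delta> * k} \<inter> {1..N})) \<le> 4 * real N * (ln k / k) / \<delta>^2 + 48 * (C * ln (real N))^2 / \<delta>^2"
      by (simp add: divide_right_mono)
    then have "real (card ({n. \<bar>T N n\<bar> \<ge> \<delta> * k} \<inter> {1..N})) / real N \<le> (4 * real N * (ln k / k) / \<delta>^2 + 48 * (C * ln (real N))^2 / \<delta>^2) / real N"
      by (intro divide_right_mono) auto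
    also have "\<dots> = f N" unfolding f_def k_def [symmetric] using N
      by (simp add: add_divide_distrib power_mult_distrib mult_ac)
    finally show ?case unfolding T_def k_def .
  qed
qed

text \<open>A first moment is enough: for K < d <= N a proportion of at most 2 K / d of the n
  satisfies n mod d < K, so the mean is at most 2 K times the tail of a convergent series.\<close>

lemma negligible_proper_powers:
  fixes K :: "nat \<Rightarrow> nat"
  assumes K: "filterlim K at_top sequentially" and \<delta>: "\<delta> > 0"
  shows "negligible_family (\<lambda>N. {n. (\<Sum>d\<in>{K N<..n}. mangoldt_proper d * of_bool (n mod d < K N)) \<ge> \<delta> * real (K N)})"
proof (rule negligible_family_bound)
  define Y where "Y N n = (\<Sum>d\<in>{K N<..n}. mangoldt_proper d * of_bool (n mod d < K N))" for N n
  define g where "g d = mangoldt_proper d / real d" for d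
  have g: "summable g" "\<And>d. g d \<ge> 0"
    using summable_mangoldt_proper unfolding g_def by (auto simp: mangoldt_proper_nonneg)
  define \<tau> where "\<tau> k = suminf g - (\<Sum>d<Suc k. g d)" for k
  have "\<tau> \<longlonglongrightarrow> suminf g - suminf g"
    unfolding \<tau>_def using g(1) by (intro tendsto_diff tendsto_const LIMSEQ_Suc[OF summable_LIMSEQ])
  then have "(\<lambda>N. \<tau> (K N)) \<longlonglongrightarrow> 0" using K by (auto intro: filterlim_compose)
  from tendsto_mult[OF tendsto_const[of "2 / \<delta>"] this]
  show "(\<lambda>N. 2 / \<delta> * \<tau> (K N)) \<longlonglongrightarrow> 0" by simp
  have "\<forall>\<^sub>F N in sequentially. K N \<ge> 1" using K by (simp add: filterlim_at_top)
  with eventually_gt_at_top[of 0]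
  show "\<forall>\<^sub>F N in sequentially. real (card ({n. (\<Sum>d\<in>{K N<..n}. mangoldt_proper d * of_bool (n mod d < K N)) \<ge> \<delta> * real (K N)} \<inter> {1..N})) / real N
     \<le> 2 / \<delta> * \<tau> (K N)"
  proof eventually_elim
    case (elim N)
    have N: "real N > 0" and k: "real (K N) > 0" using elim by auto
    have Y0: "Y N n \<ge> 0" for n unfolding Y_def by (intro sum_nonneg) (auto simp: mangoldt_proper_nonneg)
    have "(\<Sum>n=1..N. Y N n) \<le> (\<Sum>n=1..N. \<Sum>d\<in>{K N<..N}. mangoldt_proper d * of_bool (n mod d < K N))"
      unfolding Y_def by (intro sum_mono sum_mono2) (auto simp: mangoldt_proper_nonneg)
    also have "\<dots> = (\<Sum>d\<in>{K N<..N}. mangoldt_proper d * (\<Sum>n=1..N. of_bool (n mod d < K N)))"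
      unfolding sum_distrib_left by (rule sum.swap)
    also have "\<dots> \<le> (\<Sum>d\<in>{K N<..N}. mangoldt_proper d * (2 * real N * real (K N) / real d))"
    proof (intro sum_mono mult_left_mono mangoldt_proper_nonneg)
      fix d assume d: "d \<in> {K N<..N}"
      have "(\<Sum>n=1..N. of_bool (n mod d < K N)) = real (card {n \<in> {1..N}. n mod d \<in> {..<K N}})"
        by (simp add: Int_def)
      also have "\<dots> \<le> real N * real (card {..<K N}) / real d + real (card {..<K N})"
        using card_residue_set[of "{..<K N}" d N] d by (simp add: abs_le_iff)
      \<comment> \<open>As d <= N, the counting error K is at most K N / d, which doubles the main
        term.\<close>
      also have "\<dots> \<le> 2 * real N * real (K N) / real d"
      proof -
        have "real (K N) * real d \<le> real (K N) * real N" using d by (intro mult_left_mono) auto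
        then show ?thesis using d by (simp add: field_simps)
      qed
      finally show "(\<Sum>n=1..N. of_bool (n mod d < K N)) \<le> 2 * real N * real (K N) / real d" .
    qed
    also have "\<dots> = 2 * real N * real (K N) * (\<Sum>d\<in>{K N<..N}. g d)"
      by (simp add: sum_distrib_left g_def mult_ac)
    also have "(\<Sum>d\<in>{K N<..N}. g d) \<le> \<tau> (K N)"
    proof -
      have "(\<Sum>d<Suc (K N). g d) + (\<Sum>d\<in>{K N<..N}. g d) = (\<Sum>d\<in>{..<Suc (K N)} \<union> {K N<..N}. g d)"
        by (intro sum.union_disjoint [symmetric]) auto
      also have "\<dots> \<le> suminf g" using g by (intro sum_le_suminf) auto
      finally show ?thesis by (simp add: \<tau>_def)
    qed
    finally have YN: "(\<Sum>n=1..N. Y N n) \<le> 2 * real N * real (K N) * \<tau> (K N)"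
      using k by (simp add: mult_left_mono)
    have "{n. Y N n \<ge> \<delta> * real (K N)} \<inter> {1..N} = {n \<in> {1..N}. Y N n \<ge> \<delta> * real (K N)}" by auto
    then have "real (card ({n. Y N n \<ge> \<delta> * real (K N)} \<inter> {1..N})) \<le> (\<Sum>n=1..N. Y N n) / (\<delta> * real (K N))"
      using \<delta> k Y0 by (simp only:) (intro markov_card, auto)
    also have "\<dots> \<le> 2 * real N * real (K N) * \<tau> (K N) / (\<delta> * real (K N))"
      using YN \<delta> by (intro divide_right_mono) auto
    also have "\<dots> = 2 / \<delta> * \<tau> (K N) * real N" using k by simp
    finally show ?case unfolding Y_def using N by (simp add: field_simps)
  qed
qed

text \<open>Kronecker's lemma for the convergent series of mangoldt_proper d / d: the terms up to a
  fixed \<open>B\<close> disappear after division by K, and the later ones sum to at most K times a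
  small tail.\<close>

lemma sum_mangoldt_proper_small: "(\<lambda>K. (\<Sum>d=1..K. mangoldt_proper d) / real K) \<longlonglongrightarrow> 0"
proof (rule LIMSEQ_I)
  fix r :: real assume r: "r > 0"
  define g where "g d = mangoldt_proper d / real d" for d
  have g: "summable g" "\<And>d. g d \<ge> 0"
    using summable_mangoldt_proper unfolding g_def by (auto simp: mangoldt_proper_nonneg)
  obtain B where B: "\<And>m n. m \<ge> B \<Longrightarrow> norm (\<Sum>d\<in>{m..<n}. g d) < r / 2"
    using g(1) r unfolding summable_Cauchy by (metis half_gt_zero)
  define W where "W = (\<Sum>d=1..B. mangoldt_proper d)"
  have "(\<lambda>K. W / real K) \<longlonglongrightarrow> 0" by real_asymp
  then have "\<forall>\<^sub>F K in sequentially. W / real K < r / 2" using r by (intro order_tendstoD) auto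
  then obtain K0 where K0: "\<And>K. K \<ge> K0 \<Longrightarrow> W / real K < r / 2" by (auto simp: eventually_sequentially)
  show "\<exists>no. \<forall>K\<ge>no. norm ((\<Sum>d=1..K. mangoldt_proper d) / real K - 0) < r"
  proof (intro exI allI impI)
    fix K assume K: "K \<ge> max K0 (B + 1)"
    then have K1: "real K > 0" by simp
    have "(\<Sum>d=1..K. mangoldt_proper d) = W + (\<Sum>d\<in>{Suc B..<Suc K}. mangoldt_proper d)"
      unfolding W_def using K by (subst sum.union_disjoint [symmetric]) (auto intro!: sum.cong)
    also have "(\<Sum>d\<in>{Suc B..<Suc K}. mangoldt_proper d) \<le> (\<Sum>d\<in>{Suc B..<Suc K}. real K * g d)"
    proof (rule sum_mono)
      fix d assume d: "d \<in> {Suc B..<Suc K}"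
      then have "mangoldt_proper d = real d * g d" by (simp add: g_def)
      also have "\<dots> \<le> real K * g d" using d g by (intro mult_right_mono) auto
      finally show "mangoldt_proper d \<le> real K * g d" .
    qed
    also have "\<dots> = real K * (\<Sum>d\<in>{Suc B..<Suc K}. g d)" by (simp only: sum_distrib_left)
    also have "(\<Sum>d\<in>{Suc B..<Suc K}. g d) \<le> r / 2" using B[of "Suc B" "Suc K"] by auto
    finally have "(\<Sum>d=1..K. mangoldt_proper d) \<le> W + real K * (r / 2)" using K1 by simp
    then have "(\<Sum>d=1..K. mangoldt_proper d) / real K \<le> W / real K + r / 2" using K1 by (simp add: field_simps)
    moreover have "W / real K < r / 2" using K0[of K] K by simp
    moreover have "(\<Sum>d=1..K. mangoldt_proper d) / real K \<ge> 0" by (intro divide_nonneg_nonneg sum_nonneg mangoldt_proper_nonneg) auto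
    ultimately show "norm ((\<Sum>d=1..K. mangoldt_proper d) / real K - 0) < r"
      unfolding real_norm_def diff_0_right by linarith
  qed
qed

text \<open>The average of \<open>carry_sum n k\<close> over n, as the condition n mod q < k mod q
  has density (k mod q) / q.\<close>

definition mean_carry :: "nat \<Rightarrow> real" where
  "mean_carry k = (\<Sum>q=1..k. mangoldt q * (real (k mod q) / real q))"

lemma mean_carry_asymp: "(\<lambda>k. mean_carry k / real k) \<longlonglongrightarrow> 1 - euler_mascheroni"
proof -
  define r where "r k = ln (fact k :: real) / real k - ln (real k)" for k
  have "(\<lambda>k. r k + 1) \<longlonglongrightarrow> 0"
  proof (rule Lim_null_comparison)
    show "(\<lambda>k. (ln (real k) + 1) / real k) \<longlonglongrightarrow> 0" by real_asymp
    show "\<forall>\<^sub>F k in sequentially. norm (r k + 1) \<le> (ln (real k) + 1) / real k"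
      using eventually_gt_at_top[of 0]
    proof eventually_elim
      case (elim k)
      have "r k + 1 = (ln (fact k) - (real k * ln (real k) - real k)) / real k"
        using elim by (simp add: r_def field_simps)
      moreover have "0 \<le> ln (fact k) - (real k * ln (real k) - real k)" "ln (fact k) - (real k * ln (real k) - real k) \<le> ln (real k) + 1"
        using ln_fact_bounds[OF elim] by auto
      ultimately show ?case using elim by (simp add: divide_right_mono)
    qed
  qed
  from tendsto_diff[OF this tendsto_const[of 1]] have r: "r \<longlonglongrightarrow> -1" by simp
  have "(\<lambda>k. (mangoldt_harm k - ln (real k)) - r k) \<longlonglongrightarrow> - euler_mascheroni - (-1)"
    by (intro tendsto_diff mangoldt_harm_asymp r)
  moreover have "\<forall>\<^sub>F k in sequentially. (mangoldt_harm k - ln (real k)) - r k = mean_carry k / real k"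
    using eventually_gt_at_top[of 0]
  proof eventually_elim
    case (elim k)
    have "mean_carry k = real k * mangoldt_harm k - ln (fact k)"
      using sum_mangoldt_mod[of k] by (simp add: mean_carry_def)
    then show ?case using elim by (simp add: r_def field_simps)
  qed
  ultimately have "(\<lambda>k. mean_carry k / real k) \<longlonglongrightarrow> - euler_mascheroni - (-1)"
    by (rule Lim_transform_eventually)
  then show ?thesis by simp
qed

section \<open>Uniformity in k and comparison of neighbouring k\<close>

lemma mean_carry_le_psi: "mean_carry k \<le> psi k"
  unfolding mean_carry_def psi_def
proof (rule sum_mono)
  fix q assume "q \<in> {1..k}"
  then have "real (k mod q) / real q \<le> 1" by (simp add: less_imp_le)
  from mult_left_mono[OF this mangoldt_nonneg] show "mangoldt q * (real (k mod q) / real q) \<le> mangoldt q" by simp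
qed

lemma one_minus_gamma_pos: "1 - euler_mascheroni > (0::real)"
  using euler_mascheroni_less_13_over_22 by simp

text \<open>The asymptotic formula says nothing about small k, yet grid points may be small. Below a
  fixed \<open>k0\<close> the crude bound 4 k0 is used, which a large K dominates.\<close>

lemma mean_carry_uniform_upper:
  assumes \<delta>: "\<delta> > 0"
  shows "\<forall>\<^sub>F K in sequentially. \<forall>k\<le>K. mean_carry k \<le> (1 - euler_mascheroni + \<delta>) * real K"
proof -
  define c where "c = 1 - (euler_mascheroni::real) + \<delta>"
  have c: "c > 0" using \<delta> one_minus_gamma_pos by (simp add: c_def)
  have "\<forall>\<^sub>F k in sequentially. mean_carry k / real k < c"
    using \<delta> by (intro order_tendstoD(2)[OF mean_carry_asymp]) (simp add: c_def)
  then obtain k0 where k0: "\<And>k. k \<ge> k0 \<Longrightarrow> mean_carry k / real k < c" by (auto simp: eventually_sequentially)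
  obtain K0 where K0: "4 * real k0 / c \<le> real K0" using real_arch_simple by blast
  show ?thesis
    unfolding eventually_sequentially c_def [symmetric]
  proof (intro exI allI impI)
    fix K k assume K: "K \<ge> K0" and k: "k \<le> K"
    show "mean_carry k \<le> c * real K"
    proof (cases "k \<ge> k0 \<and> k > 0")
      case True
      then have "mean_carry k \<le> c * real k" using k0[of k] by (simp add: field_simps)
      also have "\<dots> \<le> c * real K" using k c by (intro mult_left_mono) auto
      finally show ?thesis .
    next
      case False
      then have "k \<le> k0" by auto
      have "mean_carry k \<le> psi k" by (rule mean_carry_le_psi)
      also have "\<dots> \<le> 4 * real k0" using psi_le[of k] \<open>k \<le> k0\<close> by simp
      also have "\<dots> \<le> c * real K0" using K0 c by (simp add: field_simps)
      also have "\<dots> \<le> c * real K" using K c by (intro mult_left_mono) auto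
      finally show ?thesis .
    qed
  qed
qed

lemma of_bool_le_add: "(P \<Longrightarrow> Q \<or> R) \<Longrightarrow> (of_bool P :: real) \<le> of_bool Q + of_bool R"
  by (cases P; cases Q; cases R) auto

text \<open>n mod q < k mod q means that some j < k in the same block of length q as k is congruent
  to n. If j < k0, there is a carry for k0 as well; otherwise j lies in the window {k0..<k0 +
  w}.\<close>

lemma carry_sum_window:
  assumes "k0 \<le> k" "k \<le> k0 + w" "k \<le> K"
  shows "carry_sum n k \<le> (\<Sum>q=1..K. mangoldt q * of_bool (n mod q \<in> (if q \<le> k0 then {..<k0 mod q} else {}))) +
    (\<Sum>q=1..K. mangoldt q * of_bool (n mod q \<in> (\<lambda>j. j mod q) ` {k0..<k0 + w}))"
proof -
  have "carry_sum n k \<le> (\<Sum>q=1..k. mangoldt q * (of_bool (n mod q \<in> (if q \<le> k0 then {..<k0 mod q} else {})) +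
      of_bool (n mod q \<in> (\<lambda>j. j mod q) ` {k0..<k0 + w})))"
    unfolding carry_sum_def
  proof (intro sum_mono mult_left_mono mangoldt_nonneg)
    fix q assume q: "q \<in> {1..k}"
    have "n mod q \<in> (if q \<le> k0 then {..<k0 mod q} else {}) \<or> n mod q \<in> (\<lambda>j. j mod q) ` {k0..<k0 + w}"
      if lt: "n mod q < k mod q"
    proof (rule disjCI)
      assume no: "n mod q \<notin> (\<lambda>j. j mod q) ` {k0..<k0 + w}"
      define j where "j = q * (k div q) + n mod q"
      have "j < k" using lt mult_div_mod_eq[of q k] unfolding j_def by linarith
      have "j mod q = n mod q" by (simp add: j_def)
      have "j < k0"
      proof (rule ccontr)
        assume "\<not> j < k0"
        then have "j \<in> {k0..<k0 + w}" using \<open>j < k\<close> assms by auto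
        then show False using no \<open>j mod q = n mod q\<close> by (metis image_eqI)
      qed
      \<comment> \<open>The start q * (k div q) of the block is at most j, and j < k0 <= k, so k0
        and k lie in the same block.\<close>
      have "k0 div q = k div q"
      proof (rule antisym)
        show "k0 div q \<le> k div q" using assms by (intro div_le_mono)
        have "(q * (k div q)) div q \<le> k0 div q" using \<open>j < k0\<close> unfolding j_def by (intro div_le_mono) simp
        then show "k div q \<le> k0 div q" using q by simp
      qed
      then have "n mod q < k0 mod q" using \<open>j < k0\<close> mult_div_mod_eq[of q k0] unfolding j_def by simp
      moreover have "k div q \<ge> 1" using q by (simp add: Suc_le_eq div_greater_zero_iff)
      then have "q \<le> k0" using \<open>k0 div q = k div q\<close> q by (metis div_less not_less not_one_le_zero)
      ultimately show "n mod q \<in> (if q \<le> k0 then {..<k0 mod q} else {})" by simp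
    qed
    then show "of_bool (n mod q < k mod q) \<le> of_bool (n mod q \<in> (if q \<le> k0 then {..<k0 mod q} else {})) +
      (of_bool (n mod q \<in> (\<lambda>j. j mod q) ` {k0..<k0 + w}) :: real)"
      by (rule of_bool_le_add)
  qed
  also have "\<dots> \<le> (\<Sum>q=1..K. mangoldt q * (of_bool (n mod q \<in> (if q \<le> k0 then {..<k0 mod q} else {})) +
      of_bool (n mod q \<in> (\<lambda>j. j mod q) ` {k0..<k0 + w})))"
    using assms by (intro sum_mono2) (auto intro!: mult_nonneg_nonneg mangoldt_nonneg)
  finally show ?thesis by (simp only: distrib_left sum.distrib)
qed

text \<open>Moduli up to R, about K/t, are estimated trivially and cost psi R, of order K/t. For
  larger q a window of about K/t^2 integers occupies a proportion of at most w/R, about 1/t, of the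
  residues, which costs about psi K / t. Both are small relative to K when t is large.\<close>

lemma mean_window:
  assumes t: "t > 0" and K: "K > 0"
  shows "(\<Sum>q=1..K. mangoldt q * (real (card ((\<lambda>j. j mod q) ` {k0..<k0 + (K div t^2 + 1)})) / real q)) \<le> 8 * real K / real t + 4 + 4 * real t"
proof -
  define R where "R = K div t + 1"
  define w where "w = K div t^2 + 1"
  have R1: "real K / real t \<le> real R"
  proof -
    have "K < t * (K div t) + t"
      using mult_div_mod_eq[of t K] mod_less_divisor[OF t, of K] by linarith
    then have "K < t * (K div t + 1)" by simp
    then have "real K < real (t * R)" unfolding R_def by (simp only: of_nat_less_iff)
    then show ?thesis using t by (simp add: field_simps)
  qed
  have R2: "real R \<le> real K / real t + 1"
    unfolding R_def using of_nat_div_le_of_nat[where ?'a = real, of K t] by simp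
  have w: "real w \<le> real K / real t ^ 2 + 1"
    unfolding w_def using of_nat_div_le_of_nat[where ?'a = real, of K "t^2"] by simp
  have wR: "real w / real R \<le> 1 / real t + real t / real K"
  proof -
    have "real w / real R \<le> (real K / real t ^ 2 + 1) / (real K / real t)"
      using R1 w t K by (intro frac_le) auto
    also have "\<dots> = 1 / real t + real t / real K" using t K by (simp add: field_simps power2_eq_square)
    finally show ?thesis .
  qed
  have "mangoldt q * (real (card ((\<lambda>j. j mod q) ` {k0..<k0 + w})) / real q) \<le>
      (if q \<le> R then mangoldt q else 0) + mangoldt q * (real w / real R)" if q: "q \<in> {1..K}" for q
  proof (cases "q \<le> R")
    case True
    have "card ((\<lambda>j. j mod q) ` {k0..<k0 + w}) \<le> card {..<q}" using q by (intro card_mono) auto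
    then have "real (card ((\<lambda>j. j mod q) ` {k0..<k0 + w})) / real q \<le> 1" using q by simp
    from mult_left_mono[OF this mangoldt_nonneg[of q]] show ?thesis
      using True mangoldt_nonneg[of q] by (simp add: add_increasing2)
  next
    case False
    have "card ((\<lambda>j. j mod q) ` {k0..<k0 + w}) \<le> w" using card_image_le[of "{k0..<k0 + w}" "\<lambda>j. j mod q"] by simp
    then have "real (card ((\<lambda>j. j mod q) ` {k0..<k0 + w})) / real q \<le> real w / real R"
      using False by (intro frac_le) (auto simp: R_def)
    from mult_left_mono[OF this mangoldt_nonneg[of q]] show ?thesis using False by simp
  qed
  then have "(\<Sum>q=1..K. mangoldt q * (real (card ((\<lambda>j. j mod q) ` {k0..<k0 + w})) / real q)) \<le>
      (\<Sum>q=1..K. (if q \<le> R then mangoldt q else 0) + mangoldt q * (real w / real R))"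
    by (rule sum_mono)
  also have "\<dots> = (\<Sum>q=1..K. if q \<le> R then mangoldt q else 0) + psi K * (real w / real R)"
    unfolding sum.distrib psi_def sum_distrib_right ..
  also have "(\<Sum>q=1..K. if q \<le> R then mangoldt q else 0) \<le> psi R"
  proof -
    have "(\<Sum>q=1..K. if q \<le> R then mangoldt q else 0) = (\<Sum>q\<in>{q\<in>{1..K}. q \<le> R}. mangoldt q :: real)"
      by (simp only: sum.inter_filter finite_atLeastAtMost)
    also have "\<dots> \<le> psi R" unfolding psi_def by (intro sum_mono2) (auto intro: mangoldt_nonneg)
    finally show ?thesis .
  qed
  also have "psi R \<le> 4 * (real K / real t + 1)" using psi_le[of R] R2 by simp
  also have "psi K * (real w / real R) \<le> (4 * real K) * (1 / real t + real t / real K)"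
    using psi_le[of K] wR by (intro mult_mono) auto
  also have "4 * (real K / real t + 1) + (4 * real K) * (1 / real t + real t / real K) = 8 * real K / real t + 4 + 4 * real t"
    using t K by (simp add: field_simps)
  finally show ?thesis unfolding w_def by simp
qed

text \<open>One value of k suffices here. Failure at k = K N forces the carry sum down to 2 ln N <=
  (2/a) K N, a fixed proportion below its mean (1 - gamma) K N because a > 2/(1 - gamma).\<close>

lemma negligible_small_u:
  fixes a :: real
  assumes a: "a > 2 / (1 - euler_mascheroni)"
  defines "K \<equiv> \<lambda>N. nat \<lceil>a * ln (real N)\<rceil>"
  shows "negligible_family (\<lambda>N. {n. K N \<le> n \<and> u n (K N) \<le> n ^ 2})"
proof -
  define c where "c = 1 - (euler_mascheroni::real)"
  have c: "c > 0" using one_minus_gamma_pos by (simp add: c_def)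
  have a0: "a > 0" using a c less_trans[of 0 "2 / c" a] by (simp add: c_def)
  have ca: "c > 2 / a" using a a0 c by (simp add: c_def field_simps)
  \<comment> \<open>Half of the gap: one half absorbs the error of the mean, the other half is the
    remaining deviation.\<close>
  define \<delta> where "\<delta> = (c - 2 / a) / 2"
  have \<delta>: "\<delta> > 0" using ca by (simp add: \<delta>_def)
  have K: "filterlim K at_top sequentially" unfolding K_def using a0 by real_asymp
  have KC: "\<forall>\<^sub>F N in sequentially. real (K N) \<le> (a + 1) * ln (real N)"
    unfolding K_def using a0 by real_asymp
  define A where "A N q = (if q \<le> K N then {..<K N mod q} else {})" for N q :: nat
  have A: "A N q \<subseteq> {..<q}" if "q > 0" for N q
    using that by (auto simp: A_def intro: less_trans[OF _ mod_less_divisor])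
  note negligible_deviation[OF K KC A \<delta>]
  then show ?thesis
  proof (rule negligible_family_subset)
    have "\<forall>\<^sub>F k in sequentially. mean_carry k / real k > c - \<delta>"
      using \<delta> by (intro order_tendstoD(1)[OF mean_carry_asymp]) (simp add: c_def)
    then have "\<forall>\<^sub>F N in sequentially. mean_carry (K N) / real (K N) > c - \<delta>"
      using K by (rule eventually_compose_filterlim)
    moreover have "\<forall>\<^sub>F N in sequentially. K N \<ge> 1" using K by (simp add: filterlim_at_top)
    ultimately show "\<forall>\<^sub>F N in sequentially. {n. K N \<le> n \<and> u n (K N) \<le> n ^ 2} \<inter> {1..N} \<subseteq>
       {n. \<bar>(\<Sum>q=1..K N. mangoldt q * of_bool (n mod q \<in> A N q)) -
       (\<Sum>q=1..K N. mangoldt q * (real (card (A N q)) / real q))\<bar> \<ge> \<delta> * real (K N)}"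
    proof eventually_elim
      case (elim N)
      show ?case
      proof
        fix n assume n: "n \<in> {n. K N \<le> n \<and> u n (K N) \<le> n ^ 2} \<inter> {1..N}"
        have s: "(\<Sum>q=1..K N. mangoldt q * of_bool (n mod q \<in> A N q)) = carry_sum n (K N)"
          unfolding carry_sum_def A_def by (intro sum.cong refl) auto
        have m: "(\<Sum>q=1..K N. mangoldt q * (real (card (A N q)) / real q)) = mean_carry (K N)"
          unfolding mean_carry_def A_def by (intro sum.cong refl) auto
        have "carry_sum n (K N) \<le> ln (real (u n (K N)))" using n by (intro ln_u_lower) auto
        also have "\<dots> \<le> ln (real (n ^ 2))"
          using n u_pos[of n "K N"] by (subst ln_le_cancel_iff) (auto simp flip: of_nat_power)
        also have "\<dots> = 2 * ln (real n)" using n by (simp add: ln_realpow)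
        also have "\<dots> \<le> 2 * ln (real N)" using n by simp
        also have "\<dots> \<le> 2 / a * real (K N)"
        proof -
          have "a * ln (real N) \<le> real (K N)" unfolding K_def by (rule real_nat_ceiling_ge)
          then show ?thesis using a0 by (simp add: field_simps)
        qed
        also have "2 / a = c - 2 * \<delta>" using a0 by (simp add: \<delta>_def field_simps)
        also have "(c - 2 * \<delta>) * real (K N) \<le> mean_carry (K N) - \<delta> * real (K N)"
          using elim by (simp add: field_simps)
        finally have "\<bar>carry_sum n (K N) - mean_carry (K N)\<bar> \<ge> \<delta> * real (K N)" by linarith
        then show "n \<in> {n. \<bar>(\<Sum>q=1..K N. mangoldt q * of_bool (n mod q \<in> A N q)) -
           (\<Sum>q=1..K N. mangoldt q * (real (card (A N q)) / real q))\<bar> \<ge> \<delta> * real (K N)}"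
          unfolding mem_Collect_eq s m .
      qed
    qed
  qed
qed

text \<open>The variance bound only gives probability \<open>ln K / K\<close> for a single \<open>k\<close>, which is too weak for a
  union over all \<open>k \<le> K\<close>. Hence \<open>k\<close> is compared with a grid of boundedly many points \<open>i * w N\<close>, and
  the difference is controlled by a second sum of the same type over the residues of one grid cell.\<close>

lemma negligible_large_u:
  fixes b \<theta> :: real
  assumes b: "b > 0" "(1 - euler_mascheroni) * b < 2 * \<theta>" and \<theta>: "\<theta> < 1"
  defines "K \<equiv> \<lambda>N. nat \<lfloor>b * ln (real N)\<rfloor>"
  shows "negligible_family (\<lambda>N. {n. K N \<le> n \<and> \<theta> * ln (real N) \<le> ln (real n) \<and> (\<exists>k\<le>K N. u n k > n ^ 2)})"
proof -
  define c where "c = 1 - (euler_mascheroni::real)"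
  have c: "c > 0" using one_minus_gamma_pos by (simp add: c_def)
  \<comment> \<open>Six errors of size \<delta> K are collected: the grid point's mean, its
    deviation, the mean and the deviation of the window, and the proper powers up to K and beyond
    K.\<close>
  define \<delta> where "\<delta> = (2 * \<theta> / b - c) / 6"
  have \<delta>: "\<delta> > 0" using b by (simp add: \<delta>_def c_def field_simps)
  have K: "filterlim K at_top sequentially" unfolding K_def using b by real_asymp
  have Kle: "real (K N) \<le> b * ln (real N)" if "N \<ge> 1" for N
    unfolding K_def using b that by (intro of_nat_floor) auto
  have KC: "\<forall>\<^sub>F N in sequentially. real (K N) \<le> b * ln (real N)"
    using eventually_ge_at_top[of 1] by eventually_elim (rule Kle)
  \<comment> \<open>Makes the term 8 K / t of \<open>mean_window\<close> at most half of \<delta> K;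
    the other half takes its constant terms.\<close>
  obtain t :: nat where t: "16 / \<delta> \<le> real t" "t > 0"
  proof -
    obtain t :: nat where "16 / \<delta> \<le> real t" using real_arch_simple by blast
    then show ?thesis using that[of "t + 1"] by simp
  qed
  \<comment> \<open>A cell width of about K/t^2 keeps the number of grid points at most t^2 + 1,
    independently of N; the added 1 makes it positive and covers the rounding.\<close>
  define w where "w N = K N div t^2 + 1" for N
  \<comment> \<open>For q > i * w N the remainder of i * w N modulo q is i * w N itself, but the
    carry sum at that point stops earlier; hence the empty set.\<close>
  define A where "A i N q = (if q \<le> i * w N then {..<(i * w N) mod q} else {})" for i N q :: nat
  define D where "D i N q = (\<lambda>j. j mod q) ` {i * w N..<i * w N + w N}" for i N q :: nat
  have A: "A i N q \<subseteq> {..<q}" if "q > 0" for i N q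
    using that by (auto simp: A_def intro: less_trans[OF _ mod_less_divisor])
  have D: "D i N q \<subseteq> {..<q}" if "q > 0" for i N q
    using that by (auto simp: D_def)
  define BA where "BA i N = {n. \<bar>(\<Sum>q=1..K N. mangoldt q * of_bool (n mod q \<in> A i N q)) -
     (\<Sum>q=1..K N. mangoldt q * (real (card (A i N q)) / real q))\<bar> \<ge> \<delta> * real (K N)}" for i N
  define BD where "BD i N = {n. \<bar>(\<Sum>q=1..K N. mangoldt q * of_bool (n mod q \<in> D i N q)) -
     (\<Sum>q=1..K N. mangoldt q * (real (card (D i N q)) / real q))\<bar> \<ge> \<delta> * real (K N)}" for i N
  define BY where "BY N = {n. (\<Sum>d\<in>{K N<..n}. mangoldt_proper d * of_bool (n mod d < K N)) \<ge> \<delta> * real (K N)}" for N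
  have "negligible_family (BA i)" for i
    unfolding BA_def by (rule negligible_deviation[OF K KC A \<delta>])
  moreover have "negligible_family (BD i)" for i
    unfolding BD_def by (rule negligible_deviation[OF K KC D \<delta>])
  moreover have "negligible_family BY"
    unfolding BY_def by (rule negligible_proper_powers[OF K \<delta>])
  ultimately have "negligible_family (\<lambda>N. (\<Union>i<t^2 + 1. BA i N \<union> BD i N) \<union> BY N)"
    by (intro negligible_family_Un negligible_family_UN)
  then show ?thesis
  proof (rule negligible_family_subset)
    have "\<forall>\<^sub>F k in sequentially. (\<Sum>d=1..k. mangoldt_proper d) / real k < \<delta>"
      using \<delta> by (intro order_tendstoD(2)[OF sum_mangoldt_proper_small])
    then have e1: "\<forall>\<^sub>F N in sequentially. (\<Sum>d=1..K N. mangoldt_proper d) / real (K N) < \<delta>"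
      using K by (rule eventually_compose_filterlim)
    have e2: "\<forall>\<^sub>F N in sequentially. \<forall>k\<le>K N. mean_carry k \<le> (c + \<delta>) * real (K N)"
      unfolding c_def using mean_carry_uniform_upper[OF \<delta>] K by (rule eventually_compose_filterlim)
    obtain K0 :: nat where K0: "(8 + 8 * real t) / \<delta> \<le> real K0" using real_arch_simple by blast
    have e3: "\<forall>\<^sub>F N in sequentially. K N \<ge> max K0 1" using K unfolding filterlim_at_top by blast
    from e1 e2 e3 eventually_ge_at_top[of 1]
    show "\<forall>\<^sub>F N in sequentially. {n. K N \<le> n \<and> \<theta> * ln (real N) \<le> ln (real n) \<and> (\<exists>k\<le>K N. u n k > n ^ 2)} \<inter> {1..N} \<subseteq>
       (\<Union>i<t^2 + 1. BA i N \<union> BD i N) \<union> BY N"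
    proof eventually_elim
      case (elim N)
      have KN: "real (K N) > 0" "K N \<ge> K0" "K N > 0" using elim by auto
      have W: "(\<Sum>d=1..K N. mangoldt_proper d) \<le> \<delta> * real (K N)"
        using elim KN by (simp add: field_simps)
      show ?case
      proof (rule subsetI, rule ccontr)
        fix n assume n: "n \<in> {n. K N \<le> n \<and> \<theta> * ln (real N) \<le> ln (real n) \<and> (\<exists>k\<le>K N. u n k > n ^ 2)} \<inter> {1..N}"
          and good: "n \<notin> (\<Union>i<t^2 + 1. BA i N \<union> BD i N) \<union> BY N"
        obtain k where k: "k \<le> K N" "u n k > n ^ 2" using n by auto
        define i where "i = k div w N"
        have w0: "w N > 0" by (simp add: w_def)
        have ik: "i * w N \<le> k" "k \<le> i * w N + w N"
          using w0 div_mult_mod_eq[of k "w N"] mod_less_divisor[OF w0, of k] unfolding i_def by linarith+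
        have i: "i < t^2 + 1"
        proof -
          have "K N mod t^2 < t^2" using t by simp
          then have "K N < t^2 * (K N div t^2) + t^2" using mult_div_mod_eq[of "t^2" "K N"] by linarith
          then have "K N < t^2 * w N" by (simp add: w_def)
          then have "i * w N < t^2 * w N" using ik k by linarith
          then show ?thesis by simp
        qed
        have mA: "(\<Sum>q=1..K N. mangoldt q * (real (card (A i N q)) / real q)) = mean_carry (i * w N)"
        proof -
          have "(\<Sum>q=1..K N. mangoldt q * (real (card (A i N q)) / real q)) =
             (\<Sum>q=1..i * w N. mangoldt q * (real (card (A i N q)) / real q))"
            using ik k by (intro sum.mono_neutral_right) (auto simp: A_def)
          also have "\<dots> = mean_carry (i * w N)"
            unfolding mean_carry_def by (intro sum.cong refl) (simp add: A_def)
          finally show ?thesis .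
        qed
        have mD: "(\<Sum>q=1..K N. mangoldt q * (real (card (D i N q)) / real q)) \<le> \<delta> * real (K N)"
        proof -
          have "(\<Sum>q=1..K N. mangoldt q * (real (card (D i N q)) / real q)) \<le> 8 * real (K N) / real t + 4 + 4 * real t"
            unfolding D_def w_def by (rule mean_window) (use t KN in auto)
          moreover have "8 * real (K N) / real t \<le> \<delta> / 2 * real (K N)"
          proof -
            have "8 / real t \<le> \<delta> / 2" using t \<delta> by (simp add: field_simps)
            from mult_right_mono[OF this, of "real (K N)"] show ?thesis by simp
          qed
          moreover have "4 + 4 * real t \<le> \<delta> / 2 * real (K N)"
          proof -
            have "(8 + 8 * real t) / \<delta> \<le> real (K N)" using K0 KN by linarith
            then show ?thesis using \<delta> by (simp add: field_simps)
          qed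
          ultimately show ?thesis by linarith
        qed
        have g: "n \<notin> BA i N" "n \<notin> BD i N" "n \<notin> BY N" using good i by auto
        have "ln (real (u n k)) \<le> carry_sum n k + (\<Sum>d=1..K N. mangoldt_proper d) +
            (\<Sum>d\<in>{K N<..n}. mangoldt_proper d * of_bool (n mod d < K N))"
          using k n by (intro ln_u_upper) auto
        moreover have "carry_sum n k \<le> (\<Sum>q=1..K N. mangoldt q * of_bool (n mod q \<in> A i N q)) +
            (\<Sum>q=1..K N. mangoldt q * of_bool (n mod q \<in> D i N q))"
          unfolding A_def D_def by (rule carry_sum_window[OF ik k(1)])
        moreover have "(\<Sum>q=1..K N. mangoldt q * of_bool (n mod q \<in> A i N q)) \<le> mean_carry (i * w N) + \<delta> * real (K N)"
          using g(1) unfolding BA_def mA by auto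
        moreover have "(\<Sum>q=1..K N. mangoldt q * of_bool (n mod q \<in> D i N q)) \<le> 2 * (\<delta> * real (K N))"
          using g(2) mD unfolding BD_def by auto
        moreover have "(\<Sum>d\<in>{K N<..n}. mangoldt_proper d * of_bool (n mod d < K N)) \<le> \<delta> * real (K N)"
          using g(3) unfolding BY_def by auto
        moreover have "mean_carry (i * w N) \<le> (c + \<delta>) * real (K N)"
          using elim ik k by auto
        ultimately have "ln (real (u n k)) \<le> (c + \<delta>) * real (K N) + 5 * (\<delta> * real (K N))"
          using W by linarith
        also have "\<dots> = (c + 6 * \<delta>) * real (K N)" by (simp add: algebra_simps)
        also have "c + 6 * \<delta> = 2 * \<theta> / b" by (simp add: \<delta>_def diff_divide_distrib)
        also have "2 * \<theta> / b * real (K N) \<le> 2 * \<theta> / b * (b * ln (real N))"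
        proof (rule mult_left_mono)
          have "0 < (1 - euler_mascheroni) * b" using b one_minus_gamma_pos by simp
          then show "0 \<le> 2 * \<theta> / b" using b by simp
        qed (use Kle elim in auto)
        also have "\<dots> = 2 * (\<theta> * ln (real N))" using b by simp
        also have "\<dots> \<le> 2 * ln (real n)" using n by simp
        also have "\<dots> = ln (real (n ^ 2))" using n by (simp add: ln_realpow)
        finally have "real (u n k) \<le> real (n ^ 2)"
          using n u_pos[of n k] by (subst (asm) ln_le_cancel_iff) auto
        then show False using k by simp
      qed
    qed
  qed
qed

section \<open>From exceptional sets to the concentration of f2\<close>

lemma f2_bounds:
  assumes "K1 \<le> n" "u n K1 > n ^ 2" "\<forall>k\<le>K2. k \<le> n \<longrightarrow> u n k \<le> n ^ 2"
  shows "f2 n \<noteq> \<infinity>" "the_enat (f2 n) \<le> K1" "K2 < the_enat (f2 n)"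
proof -
  have le: "f2 n \<le> enat K1"
    unfolding f2_def using assms by (intro INF_lower2[of K1]) auto
  then obtain m where m: "f2 n = enat m" by (cases "f2 n") auto
  have "enat (Suc K2) \<le> f2 n"
    unfolding f2_def using assms(3) by (intro INF_greatest) (auto simp: not_le[symmetric] Suc_le_eq)
  then show "f2 n \<noteq> \<infinity>" "the_enat (f2 n) \<le> K1" "K2 < the_enat (f2 n)"
    using le by (auto simp: m)
qed

text \<open>These n lie below N^\<theta>. Off this set ln n and ln N agree up to the factor
  \<theta>, so thresholds expressed through N transfer to n.\<close>

lemma negligible_small_ln:
  assumes "\<theta> < 1"
  shows "negligible_family (\<lambda>N. {n. ln (real n) < \<theta> * ln (real N)})"
proof (rule negligible_family_bound)
  show "(\<lambda>N. real N powr (\<theta> - 1)) \<longlonglongrightarrow> 0" using assms by real_asymp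
  show "\<forall>\<^sub>F N in sequentially. real (card ({n. ln (real n) < \<theta> * ln (real N)} \<inter> {1..N})) / real N \<le> real N powr (\<theta> - 1)"
    using eventually_gt_at_top[of 0]
  proof eventually_elim
    case (elim N)
    have "{n. ln (real n) < \<theta> * ln (real N)} \<inter> {1..N} \<subseteq> {1..nat \<lfloor>real N powr \<theta>\<rfloor>}"
    proof
      fix n assume n: "n \<in> {n. ln (real n) < \<theta> * ln (real N)} \<inter> {1..N}"
      then have "ln (real n) < ln (real N powr \<theta>)" using elim by (simp add: ln_powr)
      then have "real n < real N powr \<theta>" using n elim by (subst (asm) ln_less_cancel_iff) auto
      then show "n \<in> {1..nat \<lfloor>real N powr \<theta>\<rfloor>}" using n by (auto simp: le_nat_iff le_floor_iff)
    qed
    then have "card ({n. ln (real n) < \<theta> * ln (real N)} \<inter> {1..N}) \<le> card {1..nat \<lfloor>real N powr \<theta>\<rfloor>}"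
      by (intro card_mono) auto
    then have "real (card ({n. ln (real n) < \<theta> * ln (real N)} \<inter> {1..N})) \<le> real N powr \<theta>"
      by (simp add: le_nat_iff le_floor_iff)
    then show ?case using elim by (simp add: powr_diff divide_right_mono)
  qed
qed

lemma f2_concentration:
  assumes \<eta>: "\<eta> > 0"
  shows "has_natural_density {n::nat. n \<ge> 2 \<and> (f2 n = \<infinity> \<or>
     \<bar>real (the_enat (f2 n)) / ln (real n) - 2 / (1 - euler_mascheroni)\<bar> > \<eta>)} 0"
    (is "has_natural_density ?S 0")
proof -
  define c where "c = 1 - (euler_mascheroni::real)"
  have c: "c > 0" using one_minus_gamma_pos by (simp add: c_def)
  define C where "C = 2 / c"
  have C: "C > 0" using c by (simp add: C_def)
  \<comment> \<open>\<epsilon> <= \<eta> / 4 leaves room for rounding and for replacing ln N by ln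
    n; \<epsilon> <= C / 2 keeps \<open>b\<close> positive.\<close>
  define \<epsilon> where "\<epsilon> = min (\<eta> / 4) (C / 2)"
  have \<epsilon>: "\<epsilon> > 0" "\<epsilon> \<le> \<eta> / 4" "\<epsilon> \<le> C / 2" using \<eta> C by (auto simp: \<epsilon>_def)
  \<comment> \<open>The first entry turns (C + 2 \<epsilon>) ln N into at most (C + \<eta>) ln n
    once \<theta> ln N <= ln n; the second yields (1 - gamma) b < 2 \<theta>, as
    \<open>negligible_large_u\<close> requires.\<close>
  define \<theta> where "\<theta> = max ((C + 2 * \<epsilon>) / (C + \<eta>)) (1 - \<epsilon> / (2 * C))"
  have \<theta>: "\<theta> < 1" "\<theta> > 0" "C + 2 * \<epsilon> \<le> \<theta> * (C + \<eta>)" "(C - \<epsilon>) < \<theta> * C"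
  proof -
    show "\<theta> < 1" using \<epsilon> C \<eta> by (auto simp: \<theta>_def field_simps)
    have "0 < (C + 2 * \<epsilon>) / (C + \<eta>)" using \<epsilon> C \<eta> by simp
    then show "\<theta> > 0" by (simp add: \<theta>_def less_max_iff_disj)
    have "(C + 2 * \<epsilon>) / (C + \<eta>) \<le> \<theta>" by (simp add: \<theta>_def)
    then show "C + 2 * \<epsilon> \<le> \<theta> * (C + \<eta>)" using C \<eta> by (simp add: field_simps)
    have "C - \<epsilon> < (1 - \<epsilon> / (2 * C)) * C" using \<epsilon> C by (simp add: field_simps)
    also have "\<dots> \<le> \<theta> * C" using C by (intro mult_right_mono) (auto simp: \<theta>_def)
    finally show "(C - \<epsilon>) < \<theta> * C" .
  qed
  define a where "a = C + \<epsilon>"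
  define b where "b = C - \<epsilon>"
  have b0: "b > 0" using \<epsilon> C by (simp add: b_def)
  have cC: "c * C = 2" using c by (simp add: C_def)
  have "c * b < c * (\<theta> * C)" unfolding b_def using \<theta> c by (intro mult_strict_left_mono) auto
  also have "c * (\<theta> * C) = 2 * \<theta>" using cC by (simp add: mult_ac)
  finally have cb: "(1 - euler_mascheroni) * b < 2 * \<theta>" by (simp add: c_def)
  define K1 where "K1 N = nat \<lceil>a * ln (real N)\<rceil>" for N
  define K2 where "K2 N = nat \<lfloor>b * ln (real N)\<rfloor>" for N
  define B1 where "B1 N = {n. K1 N \<le> n \<and> u n (K1 N) \<le> n ^ 2}" for N
  define B2 where "B2 N = {n. K2 N \<le> n \<and> \<theta> * ln (real N) \<le> ln (real n) \<and> (\<exists>k\<le>K2 N. u n k > n ^ 2)}" for N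
  define B3 where "B3 N = {n. ln (real n) < \<theta> * ln (real N)}" for N
  have "negligible_family B1"
    unfolding B1_def K1_def using \<epsilon> by (intro negligible_small_u) (simp add: a_def C_def c_def)
  moreover have "negligible_family B2"
    unfolding B2_def K2_def by (rule negligible_large_u[OF b0 cb \<theta>(1)])
  moreover have "negligible_family B3"
    unfolding B3_def by (rule negligible_small_ln[OF \<theta>(1)])
  ultimately have "negligible_family (\<lambda>N. B1 N \<union> B2 N \<union> B3 N)" by (intro negligible_family_Un)
  then have "negligible_family (\<lambda>N. ?S)"
  proof (rule negligible_family_subset)
    have e1: "\<forall>\<^sub>F N in sequentially. real (K1 N) \<le> (C + 2 * \<epsilon>) * ln (real N)"
      unfolding K1_def a_def using \<epsilon> C by real_asymp
    \<comment> \<open>Outside \<open>B3\<close> one has n >= N^\<theta>, so \<open>K1 N\<close> and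
      \<open>K2 N\<close> are at most n, that is, admissible values of k.\<close>
    have e2: "\<forall>\<^sub>F N in sequentially. real (K1 N) < real N powr \<theta>"
      unfolding K1_def a_def using \<epsilon> C \<theta> by real_asymp
    have e3: "\<forall>\<^sub>F N in sequentially. real (K2 N) < real N powr \<theta>"
      unfolding K2_def using b0 \<theta> by real_asymp
    from e1 e2 e3 eventually_ge_at_top[of 2]
    show "\<forall>\<^sub>F N in sequentially. ?S \<inter> {1..N} \<subseteq> B1 N \<union> B2 N \<union> B3 N"
    proof eventually_elim
      case (elim N)
      show ?case
      proof (rule subsetI, rule ccontr)
        fix n assume n: "n \<in> ?S \<inter> {1..N}" and good: "n \<notin> B1 N \<union> B2 N \<union> B3 N"
        have n2: "n \<ge> 2" "n \<le> N" using n by auto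
        have lnn: "ln (real n) > 0" "ln (real n) \<le> ln (real N)" using n2 by auto
        have ge: "\<theta> * ln (real N) \<le> ln (real n)" using good by (auto simp: B3_def)
        have "ln (real N powr \<theta>) \<le> ln (real n)" using ge elim by (simp add: ln_powr)
        then have "real N powr \<theta> \<le> real n" using n2 elim by (subst (asm) ln_le_cancel_iff) auto
        then have Kn: "K1 N \<le> n" "K2 N \<le> n" using elim by linarith+
        have u1: "u n (K1 N) > n ^ 2" using good Kn by (auto simp: B1_def)
        have u2: "\<forall>k\<le>K2 N. k \<le> n \<longrightarrow> u n k \<le> n ^ 2" using good Kn ge by (auto simp: B2_def not_less)
        note f2 = f2_bounds[OF Kn(1) u1 u2]
        define f where "f = real (the_enat (f2 n))"
        have "f \<le> (C + 2 * \<epsilon>) * ln (real N)" using f2(2) elim unfolding f_def by linarith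
        also have "\<dots> \<le> (\<theta> * (C + \<eta>)) * ln (real N)"
          using \<theta>(3) lnn by (intro mult_right_mono) auto
        also have "\<dots> = (C + \<eta>) * (\<theta> * ln (real N))" by simp
        also have "\<dots> \<le> (C + \<eta>) * ln (real n)" using ge C \<eta> by (intro mult_left_mono) auto
        finally have up: "f / ln (real n) \<le> C + \<eta>" using lnn by (simp add: field_simps)
        have "(C - \<eta>) * ln (real n) \<le> b * ln (real n)"
          using \<epsilon> lnn \<eta> by (intro mult_right_mono) (auto simp: b_def)
        also have "\<dots> \<le> b * ln (real N)" using b0 lnn by (intro mult_left_mono) auto
        \<comment> \<open>The 1 lost to the floor is regained from the strict inequality K2 N < f2 n
          between integers.\<close>
        also have "\<dots> \<le> real (K2 N) + 1" unfolding K2_def by linarith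
        also have "\<dots> \<le> f" using f2(3) unfolding f_def by linarith
        finally have low: "C - \<eta> \<le> f / ln (real n)" using lnn by (simp add: field_simps)
        have "\<bar>f / ln (real n) - C\<bar> \<le> \<eta>" using up low by (simp add: abs_le_iff)
        then show False using n f2(1) by (auto simp: f_def C_def c_def)
      qed
    qed
  qed
  then show ?thesis by (simp add: has_natural_density_def negligible_family_def)
qed

theorem corollary1p2:
  shows "4.730544237 \<le> 2 / (1 - (euler_mascheroni :: real)) \<and>
         2 / (1 - (euler_mascheroni :: real)) < 4.730544238 \<and>
         (\<forall>\<eta>::real. \<eta> > 0 \<longrightarrow>
            has_natural_density
              {n::nat. n \<ge> 2 \<and>
                 (f2 n = \<infinity> \<or>
                  \<bar>real (the_enat (f2 n)) / ln (real n) - 2 / (1 - euler_mascheroni)\<bar> > \<eta>)}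
              0)"
  using two_over_one_minus_gamma_bounds f2_concentration by blast

end
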